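(* Let $E$ be an operator space and $C\ge1$. The following are equivalent: (a) $E$ has the $C$-W*CBAP; (b) for every operator space $F$ (equivalently, only for $F=E'$), the identity $E\otimes_{\overleftarrow{\mathrm{proj}}}F\to E\otimes_{\mathrm{proj}}F$ has cb-norm at most $C$; (c) for every operator space $F$, the identity $E\otimes_{\overleftarrow{\mathrm{proj}}}F\to E\otimes_{\mathrm{proj}}F$ has norm at most $C$. In particular, $E$ has the W*CMAP if and only if $\mathrm{proj}=\overleftarrow{\mathrm{proj}}$ on $E\otimes F$ for every operator space $F$ (equivalently, only for $F=E'$).
   Context: $\mathrm{proj}$ is the operator space projective tensor norm: $\mathrm{proj}_n(u)=\inf\{\|a\|\|x\|\|y\|\|b\|: u=a(x\otimes y)b,\ x\in M_p(E),y\in M_q(F),a\in M_{n,pq},b\in M_{pq,n}\}$. Its cofinite hull is $\overleftarrow{\mathrm{proj}}_n(u;E,F)=\sup\{\mathrm{proj}_n((q^E_K\otimes q^F_L)_n(u);E/K,F/L)\}$ over all subspaces $K\subseteq E$, $L\subseteq F$ of finite codimension. $E$ has the $C$-W*CBAP if there is a net of finite-rank maps $\phi_i:E\to E''$ with $\|\phi_i\|_{cb}\le C$ and $\phi_i(x)\to\kappa_E(x)$ weak$^*$ for every $x\in E$ ($\kappa_E$ the canonical embedding into the bidual); W*CMAP means $1$-W*CBAP. *)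

theory Defs
  imports Complex_Main "HOL-Library.Function_Algebras"
begin

class cvec = ab_group_add +
  fixes cscale :: "complex \<Rightarrow> 'a \<Rightarrow> 'a"
  assumes cscale_add_right: "cscale a (x + y) = cscale a x + cscale a y"
    and cscale_add_left: "cscale (a + b) x = cscale a x + cscale b x"
    and cscale_cscale: "cscale a (cscale b x) = cscale (a * b) x"
    and cscale_one: "cscale 1 x = x"

instantiation complex :: cvec
begin
definition cscale_complex :: "complex \<Rightarrow> complex \<Rightarrow> complex" where
  "cscale_complex a z = a * z"
instance by standard (auto simp: cscale_complex_def algebra_simps)
end

instantiation "fun" :: (type, cvec) cvec
begin
definition cscale_fun :: "complex \<Rightarrow> ('a \<Rightarrow> 'b) \<Rightarrow> 'a \<Rightarrow> 'b" where
  "cscale_fun a f = (\<lambda>t. cscale a (f t))"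
instance by standard
  (auto simp: cscale_fun_def plus_fun_def cscale_add_right cscale_add_left cscale_cscale cscale_one)
end

definition csubspace :: "'a::cvec set \<Rightarrow> bool" where
  "csubspace S \<longleftrightarrow> 0 \<in> S \<and> (\<forall>x\<in>S. \<forall>y\<in>S. x + y \<in> S) \<and> (\<forall>c. \<forall>x\<in>S. cscale c x \<in> S)"

definition lin_on :: "'a::cvec set \<Rightarrow> ('a \<Rightarrow> 'b::cvec) \<Rightarrow> bool" where
  "lin_on V f \<longleftrightarrow> (\<forall>x\<in>V. \<forall>y\<in>V. f (x + y) = f x + f y) \<and>
                   (\<forall>c. \<forall>x\<in>V. f (cscale c x) = cscale c (f x))"

section \<open>Matrices: M_{m,n}(X) as nat \<Rightarrow> nat \<Rightarrow> X, only entries i<m, j<n matter\<close>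

definition mat_in :: "'a set \<Rightarrow> nat \<Rightarrow> nat \<Rightarrow> (nat \<Rightarrow> nat \<Rightarrow> 'a) \<Rightarrow> bool" where
  "mat_in S m n x \<longleftrightarrow> (\<forall>i<m. \<forall>j<n. x i j \<in> S)"

definition cmat_norm :: "nat \<Rightarrow> nat \<Rightarrow> (nat \<Rightarrow> nat \<Rightarrow> complex) \<Rightarrow> real" where
  "cmat_norm m n a = Sup {sqrt (\<Sum>i<m. (cmod (\<Sum>j<n. a i j * v j))\<^sup>2) | v.
                            (\<Sum>j<n. (cmod (v j))\<^sup>2) \<le> 1}"

definition mat_mult3 :: "(nat \<Rightarrow> nat \<Rightarrow> complex) \<Rightarrow> nat \<Rightarrow> (nat \<Rightarrow> nat \<Rightarrow> 'a::cvec)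
                          \<Rightarrow> (nat \<Rightarrow> nat \<Rightarrow> complex) \<Rightarrow> nat \<Rightarrow> nat \<Rightarrow> 'a" where
  "mat_mult3 \<alpha> n x \<beta> = (\<lambda>i j. \<Sum>k<n. \<Sum>l<n. cscale (\<alpha> i k * \<beta> l j) (x k l))"

definition mat_dsum :: "nat \<Rightarrow> (nat \<Rightarrow> nat \<Rightarrow> 'a::zero) \<Rightarrow> (nat \<Rightarrow> nat \<Rightarrow> 'a) \<Rightarrow> nat \<Rightarrow> nat \<Rightarrow> 'a" where
  "mat_dsum n x y = (\<lambda>i j. if i < n \<and> j < n then x i j
                           else if n \<le> i \<and> n \<le> j then y (i - n) (j - n) else 0)"

section \<open>Operator spaces (Ruan's axioms), given by a carrier subspace V and matrix norms N n on M_n(V)\<close>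

definition operator_space :: "'a::cvec set \<Rightarrow> (nat \<Rightarrow> (nat \<Rightarrow> nat \<Rightarrow> 'a) \<Rightarrow> real) \<Rightarrow> bool" where
  "operator_space V N \<longleftrightarrow> csubspace V \<and>
     (\<forall>n x y. (\<forall>i<n. \<forall>j<n. x i j = y i j) \<longrightarrow> N n x = N n y) \<and>
     (\<forall>n x. mat_in V n n x \<longrightarrow> 0 \<le> N n x \<and> (N n x = 0 \<longleftrightarrow> (\<forall>i<n. \<forall>j<n. x i j = 0))) \<and>
     (\<forall>n x y. mat_in V n n x \<and> mat_in V n n y \<longrightarrow> N n (\<lambda>i j. x i j + y i j) \<le> N n x + N n y) \<and>
     (\<forall>m n \<alpha> x \<beta>. mat_in V n n x \<longrightarrow>
        N m (mat_mult3 \<alpha> n x \<beta>) \<le> cmat_norm m n \<alpha> * N n x * cmat_norm n m \<beta>) \<and>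
     (\<forall>n m x y. mat_in V n n x \<and> mat_in V m m y \<longrightarrow>
        N (n + m) (mat_dsum n x y) = max (N n x) (N m y))"

definition cb_le :: "'a set \<Rightarrow> (nat \<Rightarrow> (nat \<Rightarrow> nat \<Rightarrow> 'a) \<Rightarrow> real) \<Rightarrow>
                     (nat \<Rightarrow> (nat \<Rightarrow> nat \<Rightarrow> 'b) \<Rightarrow> real) \<Rightarrow> real \<Rightarrow> ('a \<Rightarrow> 'b) \<Rightarrow> bool" where
  "cb_le V N M C \<phi> \<longleftrightarrow> (\<forall>n x. mat_in V n n x \<longrightarrow> M n (\<lambda>i j. \<phi> (x i j)) \<le> C * N n x)"

section \<open>Dual operator space: M_n(E') = CB(E, M_n)\<close>

definition dual_carrier :: "'a::cvec set \<Rightarrow> (nat \<Rightarrow> (nat \<Rightarrow> nat \<Rightarrow> 'a) \<Rightarrow> real) \<Rightarrow> ('a \<Rightarrow> complex) set" where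
  "dual_carrier V N = {f. lin_on V f \<and> (\<forall>x. x \<notin> V \<longrightarrow> f x = 0) \<and>
                          (\<exists>B. \<forall>x\<in>V. cmod (f x) \<le> B * N 1 (\<lambda>_ _. x))}"

text \<open>Norm of [f_ij] in M_n(E'): the cb-norm of x \<mapsto> [f_ij(x)] from E to M_n;
  [f_ij(x_pq)] is arranged as a kn x kn scalar matrix.\<close>
definition dual_norm :: "'a::cvec set \<Rightarrow> (nat \<Rightarrow> (nat \<Rightarrow> nat \<Rightarrow> 'a) \<Rightarrow> real) \<Rightarrow>
                          nat \<Rightarrow> (nat \<Rightarrow> nat \<Rightarrow> ('a \<Rightarrow> complex)) \<Rightarrow> real" where
  "dual_norm V N n F = Sup {cmat_norm (k * n) (k * n)
        (\<lambda>a b. F (a mod n) (b mod n) (x (a div n) (b div n))) | k x. mat_in V k k x \<and> N k x \<le> 1}"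

definition bidual_carrier where
  "bidual_carrier V N = dual_carrier (dual_carrier V N) (dual_norm V N)"

definition bidual_norm where
  "bidual_norm V N = dual_norm (dual_carrier V N) (dual_norm V N)"

definition kappa :: "'a::cvec set \<Rightarrow> (nat \<Rightarrow> (nat \<Rightarrow> nat \<Rightarrow> 'a) \<Rightarrow> real) \<Rightarrow> 'a \<Rightarrow> ('a \<Rightarrow> complex) \<Rightarrow> complex" where
  "kappa V N x = (\<lambda>f. if f \<in> dual_carrier V N then f x else 0)"

definition finite_rank_on :: "'a set \<Rightarrow> ('a \<Rightarrow> 'b::cvec) \<Rightarrow> bool" where
  "finite_rank_on V \<phi> \<longleftrightarrow> (\<exists>T. finite T \<and> (\<forall>x\<in>V. \<exists>c. \<phi> x = (\<Sum>t\<in>T. cscale (c t) t)))"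

text \<open>C-W*CBAP: a net (here: a proper filter) of finite-rank maps E \<rightarrow> E'' with cb-norm \<le> C
  converging weak* pointwise to the canonical embedding.\<close>
definition wcbap :: "'a::cvec set \<Rightarrow> (nat \<Rightarrow> (nat \<Rightarrow> nat \<Rightarrow> 'a) \<Rightarrow> real) \<Rightarrow> real \<Rightarrow> bool" where
  "wcbap V N C \<longleftrightarrow> (\<exists>F :: ('a \<Rightarrow> (('a \<Rightarrow> complex) \<Rightarrow> complex)) filter. F \<noteq> bot \<and>
      eventually (\<lambda>\<phi>. lin_on V \<phi> \<and> \<phi> ` V \<subseteq> bidual_carrier V N \<and> finite_rank_on V \<phi> \<and>
                      cb_le V N (bidual_norm V N) C \<phi>) F \<and>
      (\<forall>x\<in>V. \<forall>f\<in>dual_carrier V N. ((\<lambda>\<phi>. \<phi> x f) \<longlongrightarrow> kappa V N x f) F))"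

definition alg_dual :: "'a::cvec set \<Rightarrow> ('a \<Rightarrow> complex) set" where
  "alg_dual V = {f. lin_on V f \<and> (\<forall>x. x \<notin> V \<longrightarrow> f x = 0)}"

definition annih :: "'a::cvec set \<Rightarrow> 'a set \<Rightarrow> ('a \<Rightarrow> complex) set" where
  "annih V K = {f \<in> alg_dual V. \<forall>k\<in>K. f k = 0}"

text \<open>The algebraic tensor product V \<otimes> W, realised (injectively) as bilinear forms
  on V^* \<times> W^* (algebraic duals); sum_i x_i \<otimes> y_i \<mapsto> ((f,g) \<mapsto> sum_i f(x_i) g(y_i)).\<close>
definition tensors :: "'a::cvec set \<Rightarrow> 'b::cvec set \<Rightarrow> (('a \<Rightarrow> complex) \<times> ('b \<Rightarrow> complex) \<Rightarrow> complex) set" where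
  "tensors V W = {t. \<exists>(k::nat) xs ys. (\<forall>i<k. xs i \<in> V \<and> ys i \<in> W) \<and>
      t = (\<lambda>(f, g). if f \<in> alg_dual V \<and> g \<in> alg_dual W then (\<Sum>i<k. f (xs i) * g (ys i)) else 0)}"

definition quot_norm :: "'a::cvec set \<Rightarrow> (nat \<Rightarrow> (nat \<Rightarrow> nat \<Rightarrow> 'a) \<Rightarrow> real) \<Rightarrow> 'a set \<Rightarrow>
                         nat \<Rightarrow> (nat \<Rightarrow> nat \<Rightarrow> 'a) \<Rightarrow> real" where
  "quot_norm V N K p x = Inf {N p (\<lambda>i j. x i j + k i j) | k. mat_in K p p k}"

text \<open>proj_n((q_K \<otimes> q_L)_n(u); V/K, W/L).  (V/K) \<otimes> (W/L) is realised as bilinear forms on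
  K^\<bottom> \<times> L^\<bottom> (= (V/K)^* \<times> (W/L)^*), and (q_K \<otimes> q_L)(u) is the restriction of u.
  Factorisations a (x \<otimes> y) b with x \<in> M_p(V/K), y \<in> M_q(W/L) (given by representatives),
  (x \<otimes> y)_{(i,k),(j,l)} = x_ij \<otimes> y_kl, index (i,k) \<leftrightarrow> i*q+k.\<close>
definition proj_q :: "'a::cvec set \<Rightarrow> (nat \<Rightarrow> (nat \<Rightarrow> nat \<Rightarrow> 'a) \<Rightarrow> real) \<Rightarrow> 'a set \<Rightarrow>
                      'b::cvec set \<Rightarrow> (nat \<Rightarrow> (nat \<Rightarrow> nat \<Rightarrow> 'b) \<Rightarrow> real) \<Rightarrow> 'b set \<Rightarrow>
                      nat \<Rightarrow> (nat \<Rightarrow> nat \<Rightarrow> (('a \<Rightarrow> complex) \<times> ('b \<Rightarrow> complex) \<Rightarrow> complex)) \<Rightarrow> real" where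
  "proj_q V N K W M L n u = Inf
     {cmat_norm n (p * q) a * quot_norm V N K p x * quot_norm W M L q y * cmat_norm (p * q) n b
      | p q a b x y. mat_in V p p x \<and> mat_in W q q y \<and>
        (\<forall>r<n. \<forall>s<n. \<forall>f\<in>annih V K. \<forall>g\<in>annih W L.
           u r s (f, g) = (\<Sum>c<p * q. \<Sum>d<p * q.
              a r c * b d s * (f (x (c div q) (d div q)) * g (y (c mod q) (d mod q)))))}"

definition proj :: "'a::cvec set \<Rightarrow> (nat \<Rightarrow> (nat \<Rightarrow> nat \<Rightarrow> 'a) \<Rightarrow> real) \<Rightarrow>
                    'b::cvec set \<Rightarrow> (nat \<Rightarrow> (nat \<Rightarrow> nat \<Rightarrow> 'b) \<Rightarrow> real) \<Rightarrow>
                    nat \<Rightarrow> (nat \<Rightarrow> nat \<Rightarrow> (('a \<Rightarrow> complex) \<times> ('b \<Rightarrow> complex) \<Rightarrow> complex)) \<Rightarrow> real" where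
  "proj V N W M n u = proj_q V N {0} W M {0} n u"

definition cofinite_sub :: "'a::cvec set \<Rightarrow> (nat \<Rightarrow> (nat \<Rightarrow> nat \<Rightarrow> 'a) \<Rightarrow> real) \<Rightarrow> 'a set \<Rightarrow> bool" where
  "cofinite_sub V N K \<longleftrightarrow> csubspace K \<and> K \<subseteq> V \<and>
     (\<exists>T. finite T \<and> T \<subseteq> V \<and> (\<forall>x\<in>V. \<exists>k\<in>K. \<exists>c. x = k + (\<Sum>t\<in>T. cscale (c t) t))) \<and>
     (\<forall>x\<in>V. (\<forall>e>0. \<exists>k\<in>K. N 1 (\<lambda>_ _. x - k) < e) \<longrightarrow> x \<in> K)"

definition cproj :: "'a::cvec set \<Rightarrow> (nat \<Rightarrow> (nat \<Rightarrow> nat \<Rightarrow> 'a) \<Rightarrow> real) \<Rightarrow>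
                     'b::cvec set \<Rightarrow> (nat \<Rightarrow> (nat \<Rightarrow> nat \<Rightarrow> 'b) \<Rightarrow> real) \<Rightarrow>
                     nat \<Rightarrow> (nat \<Rightarrow> nat \<Rightarrow> (('a \<Rightarrow> complex) \<times> ('b \<Rightarrow> complex) \<Rightarrow> complex)) \<Rightarrow> real" where
  "cproj V N W M n u = Sup {proj_q V N K W M L n u | K L. cofinite_sub V N K \<and> cofinite_sub W M L}"

definition id_cb_le :: "'a::cvec set \<Rightarrow> (nat \<Rightarrow> (nat \<Rightarrow> nat \<Rightarrow> 'a) \<Rightarrow> real) \<Rightarrow>
                     'b::cvec set \<Rightarrow> (nat \<Rightarrow> (nat \<Rightarrow> nat \<Rightarrow> 'b) \<Rightarrow> real) \<Rightarrow> real \<Rightarrow> bool" where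
  "id_cb_le V N W M C \<longleftrightarrow> (\<forall>n u. mat_in (tensors V W) n n u \<longrightarrow> proj V N W M n u \<le> C * cproj V N W M n u)"

definition id_norm_le :: "'a::cvec set \<Rightarrow> (nat \<Rightarrow> (nat \<Rightarrow> nat \<Rightarrow> 'a) \<Rightarrow> real) \<Rightarrow>
                     'b::cvec set \<Rightarrow> (nat \<Rightarrow> (nat \<Rightarrow> nat \<Rightarrow> 'b) \<Rightarrow> real) \<Rightarrow> real \<Rightarrow> bool" where
  "id_norm_le V N W M C \<longleftrightarrow> (\<forall>u. mat_in (tensors V W) 1 1 u \<longrightarrow> proj V N W M 1 u \<le> C * cproj V N W M 1 u)"

definition proj_eq_cproj :: "'a::cvec set \<Rightarrow> (nat \<Rightarrow> (nat \<Rightarrow> nat \<Rightarrow> 'a) \<Rightarrow> real) \<Rightarrow>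
                     'b::cvec set \<Rightarrow> (nat \<Rightarrow> (nat \<Rightarrow> nat \<Rightarrow> 'b) \<Rightarrow> real) \<Rightarrow> bool" where
  "proj_eq_cproj V N W M \<longleftrightarrow> (\<forall>n u. mat_in (tensors V W) n n u \<longrightarrow> proj V N W M n u = cproj V N W M n u)"

end

theory Submission
  imports Defs "HOL-Library.Product_Plus" "HOL-Analysis.L2_Norm"
begin

text \<open>The dual of the projective tensor product consists of the completely bounded maps into the dual
  of \<open>W\<close>. The unit ball of the dual of its cofinite hull is generated by the finite-rank maps in
  that ball, because a finite-rank map factors through \<open>V / K\<close> and \<open>(W / L)'\<close> for its kernel \<open>K\<close> and the
  preannihilator \<open>L\<close> of its range. So the identity between the two is bounded by \<open>C\<close> iff every completely
  contractive map \<open>T\<close> from \<open>V\<close> to \<open>W'\<close> is a point-weak* limit of finite-rank maps of cb-norm at most \<open>C\<close>.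
  For \<open>W = V'\<close> and \<open>T\<close> the canonical embedding this is the approximation property, and conversely
  approximations \<open>\<phi>\<close> of the embedding yield the approximations \<open>T'' \<circ> \<phi>\<close> of \<open>T\<close>.
  At matrix level a norming functional is not yet a completely contractive map into matrices; the
  Effros-Ruan argument repairs this with two positive forms on \<open>\<complex>\<^sup>n\<close> whose orthonormal bases turn the
  functional into a matrix over \<open>V'\<close> of norm at most one, on which elements of the matrices over \<open>V''\<close>
  can be evaluated.\<close>

text \<open>Subadditivity of the projective norm is hidden in its formula, an infimum of products
  over factorisations of varying size. Direct sums make it visible: factorisations of
  \<open>u\<close> and \<open>u'\<close> combine to one of \<open>u + u'\<close>, and the squared
  row norms of the outer factors add as functions on \<open>\<complex>\<^sup>n\<close>. So a
  factorisation is remembered only through these two functions, and a bound on an outer factor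
  becomes a pointwise inequality with a multiple of \<open>vnorm2\<close>. This gives a convex cone,
  and one Hahn-Banach functional on it replaces the usual choice of states by a minimax or
  compactness argument. The price is the arithmetic-geometric mean, which trades
  \<open>\<alpha> * \<beta>\<close> for half a sum of squares. The resulting forms may be
  degenerate; a perturbation by \<open>\<epsilon>\<close> restores orthonormal bases, and
  \<open>\<epsilon>\<close> tends to zero at the end. In the converse only finitely many values of a
  map matter at a time, so the separation takes place in the coordinates of a finite set; it yields
  one approximation for each finite set and accuracy, and these are then assembled into a
  net.\<close>

interpretation cv: vector_space "cscale :: complex \<Rightarrow> 'a::cvec \<Rightarrow> 'a"
  by standard (simp_all add: cscale_add_right cscale_add_left cscale_cscale cscale_one)

declare cscale_complex_def [simp]

text \<open>The separation theorem applies Hahn-Banach to triples of a tensor matrix and two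
  functions, so products must be vector spaces.\<close>

instantiation prod :: (cvec, cvec) cvec
begin
definition cscale_prod :: "complex \<Rightarrow> 'a \<times> 'b \<Rightarrow> 'a \<times> 'b" where
  "cscale_prod a z = (cscale a (fst z), cscale a (snd z))"
instance
  by standard (simp_all add: cscale_prod_def cscale_add_right cscale_add_left cscale_cscale cscale_one
      prod_eq_iff)
end

lemma csubspace_iff_subspace: "csubspace S \<longleftrightarrow> cv.subspace S"
  by (auto simp: csubspace_def cv.subspace_def)

section \<open>A Hahn-Banach theorem for convex cones\<close>

text \<open>A pair \<open>(z, s)\<close> in the cone stands for the constraint \<open>f z \<le> s\<close> on the functional \<open>f\<close> to be found; a
  maximal cone determines \<open>f\<close> as the infimum of \<open>s\<close>.\<close>
definition epi_cone :: "('z::cvec \<times> real) set \<Rightarrow> bool" where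
  "epi_cone G \<longleftrightarrow> (0, 0) \<in> G \<and>
     (\<forall>z s z' s'. (z, s) \<in> G \<longrightarrow> (z', s') \<in> G \<longrightarrow> (z + z', s + s') \<in> G) \<and>
     (\<forall>t\<ge>0. \<forall>z s. (z, s) \<in> G \<longrightarrow> (cscale (of_real t) z, t * s) \<in> G) \<and>
     (\<forall>s. (0, s) \<in> G \<longrightarrow> 0 \<le> s)"

lemma epi_coneD:
  assumes "epi_cone G"
  shows "(0, 0) \<in> G"
    and "\<And>z s z' s'. (z, s) \<in> G \<Longrightarrow> (z', s') \<in> G \<Longrightarrow> (z + z', s + s') \<in> G"
    and "\<And>t z s. 0 \<le> t \<Longrightarrow> (z, s) \<in> G \<Longrightarrow> (cscale (of_real t) z, t * s) \<in> G"
    and "\<And>s. (0, s) \<in> G \<Longrightarrow> 0 \<le> s"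
  using assms unfolding epi_cone_def by blast+

text \<open>The new constraint \<open>f z \<le> r\<close> can clash only with constraints on
  \<open>- z\<close> that force \<open>f z\<close> above \<open>r\<close>, and \<open>no\<close>
  excludes these. The last conclusion keeps track of the domain during the extension.\<close>

lemma epi_cone_adjoin:
  assumes G: "epi_cone G"
    and no: "\<And>s. (- z, s) \<in> G \<Longrightarrow> - r \<le> s"
  obtains G' where "epi_cone G'" "G \<subseteq> G'" "(z, r) \<in> G'"
    "\<And>w s. (w, s) \<in> G' \<Longrightarrow> \<exists>w' s' t. (w', s') \<in> G \<and> w = w' + cscale (of_real t) z"
proof
  define G' where "G' = {(w + cscale (of_real t) z, s + t * r) | w s t. (w, s) \<in> G \<and> 0 \<le> t}"
  note zero = epi_coneD(1)[OF G] and add = epi_coneD(2)[OF G]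
    and scl = epi_coneD(3)[OF G] and pos = epi_coneD(4)[OF G]
  have I: "0 \<le> t \<Longrightarrow> (w, s) \<in> G \<Longrightarrow> (w + cscale (of_real t) z, s + t * r) \<in> G'" for w s t
    unfolding G'_def by blast
  show "G \<subseteq> G'" using I[of 0] by auto
  show "(z, r) \<in> G'" using I[OF _ zero, of 1] by (simp add: cscale_one)
  show "\<exists>w' s' t. (w', s') \<in> G \<and> w = w' + cscale (of_real t) z" if "(w, s) \<in> G'" for w s
    using that unfolding G'_def by auto
  have 1: "(0, 0) \<in> G'" using I[OF _ zero, of 0] by simp
  have 2: "(a + a', s + s') \<in> G'" if "(a, s) \<in> G'" "(a', s') \<in> G'" for a s a' s'
  proof -
    from that obtain b u t b' u' t' where
      *: "(b, u) \<in> G" "0 \<le> t" "a = b + cscale (of_real t) z" "s = u + t * r"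
         "(b', u') \<in> G" "0 \<le> t'" "a' = b' + cscale (of_real t') z" "s' = u' + t' * r"
      unfolding G'_def by auto
    have "((b + b') + cscale (of_real (t + t')) z, (u + u') + (t + t') * r) \<in> G'"
      using * by (intro I add) auto
    thus ?thesis using * by (simp add: cscale_add_left algebra_simps)
  qed
  have 3: "(cscale (of_real c) a, c * s) \<in> G'" if "(a, s) \<in> G'" "0 \<le> c" for a s c
  proof -
    from that obtain b u t where
      *: "(b, u) \<in> G" "0 \<le> t" "a = b + cscale (of_real t) z" "s = u + t * r"
      unfolding G'_def by auto
    have "(cscale (of_real c) b + cscale (of_real (c * t)) z, c * u + (c * t) * r) \<in> G'"
      using * that by (intro I scl) auto
    thus ?thesis using * by (simp add: cscale_add_right cscale_cscale algebra_simps)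
  qed
  have 4: "0 \<le> s" if "(0, s) \<in> G'" for s
  proof -
    from that obtain b u t where
      *: "(b, u) \<in> G" "0 \<le> t" "0 = b + cscale (of_real t) z" "s = u + t * r"
      unfolding G'_def by auto
    show ?thesis
    proof (cases "t = 0")
      case True
      thus ?thesis using * pos[of u] by simp
    next
      case False
      hence t: "t > 0" using * by simp
      have b: "b = - cscale (of_real t) z" using * by (simp add: eq_neg_iff_add_eq_0)
      have "(cscale (of_real (inverse t)) b, inverse t * u) \<in> G"
        using * t by (intro scl) auto
      hence "(- z, inverse t * u) \<in> G"
        using t unfolding b by (simp add: cv.scale_minus_right cscale_cscale cscale_one flip: of_real_mult)
      hence "- r \<le> inverse t * u" by (rule no)
      thus ?thesis using t * by (simp add: field_simps)
    qed
  qed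
  show "epi_cone G'" unfolding epi_cone_def using 1 2 3 4 by blast
qed

text \<open>The lower bound at \<open>z0\<close> is itself a constraint,
  \<open>f (- z0) \<le> - t0\<close>, and is adjoined before Zorn's lemma is applied.
  \<open>total\<close> provides a constraint at every point, so that the infimum defining
  \<open>f\<close> is finite.\<close>

theorem hahn_banach_cone:
  fixes G :: "('z::cvec \<times> real) set" and D :: "'z set"
  assumes D: "csubspace D" and G: "epi_cone G" and DG: "fst ` G \<subseteq> D"
    and total: "\<And>z. z \<in> D \<Longrightarrow> \<exists>s. (z, s) \<in> G"
    and z0: "z0 \<in> D" and low: "\<And>s. (z0, s) \<in> G \<Longrightarrow> t0 \<le> s"
  obtains f :: "'z \<Rightarrow> real"
  where "\<And>x y. x \<in> D \<Longrightarrow> y \<in> D \<Longrightarrow> f (x + y) = f x + f y"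
    and "\<And>t x. x \<in> D \<Longrightarrow> f (cscale (of_real t) x) = t * f x"
    and "\<And>z s. (z, s) \<in> G \<Longrightarrow> f z \<le> s" and "t0 \<le> f z0"
proof -
  have Dadd: "x \<in> D \<Longrightarrow> y \<in> D \<Longrightarrow> x + y \<in> D"
    and Dscl: "x \<in> D \<Longrightarrow> cscale c x \<in> D"
    and Dminus: "x \<in> D \<Longrightarrow> - x \<in> D" for x y c
    using D unfolding csubspace_iff_subspace
    by (auto intro: cv.subspace_add cv.subspace_scale cv.subspace_neg)
  obtain G0 where G0: "epi_cone G0" "G \<subseteq> G0" "(- z0, - t0) \<in> G0" "fst ` G0 \<subseteq> D"
  proof (rule epi_cone_adjoin[OF G, of "- z0" "- t0"])
    show "- (- t0) \<le> s" if "(- (- z0), s) \<in> G" for s using low that by simp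
    fix G' assume G': "epi_cone G'" "G \<subseteq> G'" "(- z0, - t0) \<in> G'"
      "\<And>w s. (w, s) \<in> G' \<Longrightarrow> \<exists>w' s' t. (w', s') \<in> G \<and> w = w' + cscale (complex_of_real t) (- z0)"
    have "fst ` G' \<subseteq> D"
    proof clarsimp
      fix w s assume "(w, s) \<in> G'"
      from G'(4)[OF this] obtain w' s' t where "(w', s') \<in> G" "w = w' + cscale (complex_of_real t) (- z0)"
        by blast
      moreover from this have "w' \<in> D" using DG by force
      ultimately show "w \<in> D" using Dadd[OF _ Dscl[OF Dminus[OF z0]]] by simp
    qed
    thus thesis by (rule that[OF G'(1-3)])
  qed
  define \<C> where "\<C> = {H. epi_cone H \<and> G0 \<subseteq> H \<and> fst ` H \<subseteq> D}"
  have "\<exists>M\<in>\<C>. \<forall>X\<in>\<C>. M \<subseteq> X \<longrightarrow> X = M"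
  proof (rule subset_Zorn_nonempty)
    show "\<C> \<noteq> {}" using G0 unfolding \<C>_def by blast
  next
    fix Ch assume ne: "Ch \<noteq> {}" and ch: "subset.chain \<C> Ch"
    have sub: "\<And>H. H \<in> Ch \<Longrightarrow> epi_cone H \<and> G0 \<subseteq> H \<and> fst ` H \<subseteq> D"
      using ch by (auto simp: subset.chain_def \<C>_def)
    have lin: "\<And>H K. H \<in> Ch \<Longrightarrow> K \<in> Ch \<Longrightarrow> H \<subseteq> K \<or> K \<subseteq> H"
      using ch by (auto simp: subset.chain_def)
    have "epi_cone (\<Union>Ch)"
      unfolding epi_cone_def
    proof (intro conjI allI impI)
      show "(0, 0) \<in> \<Union>Ch" using ne sub epi_coneD(1) by blast
    next
      fix z s z' s' assume "(z, s) \<in> \<Union>Ch" "(z', s') \<in> \<Union>Ch"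
      then obtain H K where HK: "H \<in> Ch" "K \<in> Ch" "(z, s) \<in> H" "(z', s') \<in> K" by blast
      then obtain J where "J \<in> Ch" "(z, s) \<in> J" "(z', s') \<in> J" using lin by blast
      thus "(z + z', s + s') \<in> \<Union>Ch" using sub epi_coneD(2) by blast
    next
      fix t :: real and z s assume "0 \<le> t" "(z, s) \<in> \<Union>Ch"
      thus "(cscale (of_real t) z, t * s) \<in> \<Union>Ch" using sub epi_coneD(3) by blast
    next
      fix s assume "(0, s) \<in> \<Union>Ch"
      thus "0 \<le> s" using sub epi_coneD(4) by blast
    qed
    moreover have "G0 \<subseteq> \<Union>Ch" using ne sub by blast
    moreover have "fst ` \<Union>Ch \<subseteq> D" using sub by blast
    ultimately show "\<Union>Ch \<in> \<C>" unfolding \<C>_def by blast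
  qed
  then obtain H where "H \<in> \<C>" and Hmax: "\<forall>X\<in>\<C>. H \<subseteq> X \<longrightarrow> X = H" by (rule bexE)
  hence H: "epi_cone H" "G0 \<subseteq> H" "fst ` H \<subseteq> D" unfolding \<C>_def by auto
  have max: "X = H" if "epi_cone X" "H \<subseteq> X" "fst ` X \<subseteq> D" for X
    using Hmax that H(2) unfolding \<C>_def by (metis (mono_tags, lifting) mem_Collect_eq subset_trans)
  note zero = epi_coneD(1)[OF H(1)] and add = epi_coneD(2)[OF H(1)]
    and scl = epi_coneD(3)[OF H(1)] and pos = epi_coneD(4)[OF H(1)]
  \<comment> \<open>By maximality a constraint is missing only if the cone already holds one that
    contradicts it.\<close>
  have dich: "(z, r) \<in> H \<or> (\<exists>s. s < - r \<and> (- z, s) \<in> H)" if z: "z \<in> D" for z r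
  proof (rule ccontr)
    assume n: "\<not> ?thesis"
    have "\<And>s. (- z, s) \<in> H \<Longrightarrow> - r \<le> s" using n by force
    then obtain G' where G': "epi_cone G'" "H \<subseteq> G'" "(z, r) \<in> G'"
      "\<And>w s. (w, s) \<in> G' \<Longrightarrow> \<exists>w' s' t. (w', s') \<in> H \<and> w = w' + cscale (of_real t) z"
      using epi_cone_adjoin[OF H(1), of z r] by blast
    have "fst ` G' \<subseteq> D"
    proof clarsimp
      fix w s assume "(w, s) \<in> G'"
      from G'(4)[OF this] obtain w' s' t where "(w', s') \<in> H" "w = w' + cscale (complex_of_real t) z"
        by blast
      moreover from this have "w' \<in> D" using H(3) by force
      ultimately show "w \<in> D" using z by (auto intro!: Dadd Dscl)
    qed
    with max[of G'] G' n show False by blast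
  qed
  define f where "f = (\<lambda>z. Inf {s. (z, s) \<in> H})"
  have ne: "\<exists>s. (z, s) \<in> H" if "z \<in> D" for z using total[OF that] G0 H by blast
  have bdd: "bdd_below {s. (z, s) \<in> H}" if z: "z \<in> D" for z
  proof -
    obtain s' where "(- z, s') \<in> H" using ne Dminus z by blast
    hence "- s' \<le> s" if "(z, s) \<in> H" for s using add[OF that, of "- z" s'] pos by fastforce
    thus ?thesis by (auto simp: bdd_below_def)
  qed
  have f_le: "f z \<le> s" if "(z, s) \<in> H" for z s
  proof -
    have "z \<in> D" using H(3) that by force
    thus ?thesis unfolding f_def using that by (intro cInf_lower bdd) auto
  qed
  have f_ge: "c \<le> f z" if "z \<in> D" "\<And>s. (z, s) \<in> H \<Longrightarrow> c \<le> s" for z c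
    unfolding f_def using that ne by (intro cInf_greatest) auto
  have sub: "f (x + y) \<le> f x + f y" if "x \<in> D" "y \<in> D" for x y
  proof -
    have "f (x + y) - f y \<le> f x"
    proof (rule f_ge[OF that(1)])
      fix s assume s: "(x, s) \<in> H"
      have "f (x + y) - s \<le> f y"
        by (rule f_ge[OF that(2)]) (use f_le[OF add[OF s]] in force)
      thus "f (x + y) - f y \<le> s" by simp
    qed
    thus ?thesis by simp
  qed
  \<comment> \<open>As an infimum over a cone \<open>f\<close> is sublinear; the dichotomy makes it
    odd, and an odd sublinear function is linear.\<close>
  have fneg: "f (- z) = - f z" if z: "z \<in> D" for z
  proof (rule antisym)
    have "f (- z) \<le> - f z + e" if "e > 0" for e
    proof -
      have "(z, f z - e) \<notin> H" using f_le[of z "f z - e"] that by auto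
      with dich[OF z, of "f z - e"] obtain s where "s < - (f z - e)" "(- z, s) \<in> H" by blast
      with f_le[of "- z" s] show ?thesis by linarith
    qed
    thus "f (- z) \<le> - f z" by (rule field_le_epsilon)
    have "0 \<le> f (z + - z)" using pos D by (intro f_ge) (auto simp: csubspace_def)
    also have "\<dots> \<le> f z + f (- z)" using z Dminus by (intro sub)
    finally show "- f z \<le> f (- z)" by simp
  qed
  have fadd: "f (x + y) = f x + f y" if "x \<in> D" "y \<in> D" for x y
  proof -
    have "f (- x + - y) \<le> f (- x) + f (- y)" using that by (intro sub Dminus)
    moreover have "f (- x + - y) = - f (x + y)" using fneg[OF Dadd[OF that]] by simp
    ultimately show ?thesis using sub[OF that] fneg that by force
  qed
  have fpos: "f (cscale (of_real t) x) \<le> t * f x" if "x \<in> D" "0 < t" for x t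
  proof -
    have "f (cscale (of_real t) x) / t \<le> f x"
    proof (rule f_ge[OF that(1)])
      fix s assume "(x, s) \<in> H"
      with f_le[OF scl[OF _ this, of t]] that show "f (cscale (of_real t) x) / t \<le> s"
        by (simp add: field_simps)
    qed
    thus ?thesis using that by (simp add: field_simps)
  qed
  have fscl1: "f (cscale (of_real t) x) = t * f x" if "x \<in> D" "0 < t" for x t
  proof (rule antisym[OF fpos[OF that]])
    have "f (cscale (of_real t) (- x)) \<le> t * f (- x)" using that by (intro fpos Dminus)
    thus "t * f x \<le> f (cscale (of_real t) x)"
      using that by (simp add: cv.scale_minus_right fneg Dscl)
  qed
  have f0: "f 0 = 0" using fadd[of 0 0] D by (simp add: csubspace_def)
  have fscl: "f (cscale (of_real t) x) = t * f x" if "x \<in> D" for x t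
  proof (cases t "0 :: real" rule: linorder_cases)
    case less
    have "cscale (of_real t) x = - cscale (of_real (- t)) x" by (simp add: cv.scale_minus_left)
    moreover have "f (- cscale (of_real (- t)) x) = - (- t * f x)"
      using less that by (simp only: fneg Dscl fscl1 neg_0_less_iff_less)
    ultimately show ?thesis by simp
  qed (use f0 that fscl1 in auto)
  show thesis
  proof
    show "f z \<le> s" if "(z, s) \<in> G" for z s using that G0 H f_le by blast
    have "f (- z0) \<le> - t0" using G0 H f_le by blast
    thus "t0 \<le> f z0" using fneg[OF z0] by simp
  qed (use fadd fscl in auto)
qed

section \<open>Scalar matrices\<close>

lemma div_mod_eq_diff:
  fixes a :: nat
  assumes "i * q \<le> a" "a < i * q + q"
  shows "a div q = i" "a mod q = a - i * q"
proof -
  obtain k where k: "a = i * q + k" "k < q"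
    using assms by (metis le_iff_add nat_add_left_cancel_less)
  thus "a div q = i" "a mod q = a - i * q" by auto
qed

text \<open>The index pair \<open>(i, k)\<close> is stored as \<open>i * q + k\<close>, the
  Kronecker convention of the projective norm.\<close>

lemma sum_lessThan_mult:
  fixes h :: "nat \<Rightarrow> nat \<Rightarrow> 'b::comm_monoid_add"
  shows "(\<Sum>c<p * q. h (c div q) (c mod q)) = (\<Sum>i<p. \<Sum>k<q. h i k)"
proof -
  have "(\<Sum>c<p * q. h (c div q) (c mod q)) =
      (\<Sum>i<p. \<Sum>c\<in>{i * q..<i * q + q}. h (c div q) (c mod q))"
    by (rule sum.nat_group[symmetric])
  also have "\<dots> = (\<Sum>i<p. \<Sum>k<q. h i k)"
  proof (rule sum.cong[OF refl])
    fix i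
    show "(\<Sum>c\<in>{i * q..<i * q + q}. h (c div q) (c mod q)) = (\<Sum>k<q. h i k)"
      by (rule sum.reindex_bij_witness[of _ "\<lambda>k. i * q + k" "\<lambda>c. c - i * q"])
         (auto simp: div_mod_eq_diff)
  qed
  finally show ?thesis .
qed

lemma sum_lessThan_add:
  fixes f :: "nat \<Rightarrow> 'b::comm_monoid_add"
  shows "(\<Sum>i<m + n. f i) = (\<Sum>i<m. f i) + (\<Sum>i<n. f (m + i))"
  by (induction n) (simp_all add: add.assoc)

lemma cmod_sum_mult_le:
  fixes a b :: "'i \<Rightarrow> complex"
  shows "cmod (\<Sum>i\<in>A. a i * b i) \<le> sqrt (\<Sum>i\<in>A. (cmod (a i))\<^sup>2) * sqrt (\<Sum>i\<in>A. (cmod (b i))\<^sup>2)"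
proof -
  have "cmod (\<Sum>i\<in>A. a i * b i) \<le> (\<Sum>i\<in>A. \<bar>cmod (a i)\<bar> * \<bar>cmod (b i)\<bar>)"
    by (rule order_trans[OF norm_sum]) (simp add: norm_mult)
  also have "\<dots> \<le> L2_set (\<lambda>i. cmod (a i)) A * L2_set (\<lambda>i. cmod (b i)) A"
    by (rule L2_set_mult_ineq)
  finally show ?thesis by (simp add: L2_set_def)
qed

abbreviation vnorm2 :: "nat \<Rightarrow> (nat \<Rightarrow> complex) \<Rightarrow> real" where
  "vnorm2 n v \<equiv> \<Sum>j<n. (cmod (v j))\<^sup>2"

abbreviation mnorm2 :: "nat \<Rightarrow> nat \<Rightarrow> (nat \<Rightarrow> nat \<Rightarrow> complex) \<Rightarrow> real" where
  "mnorm2 p q c \<equiv> \<Sum>i<p. \<Sum>k<q. (cmod (c i k))\<^sup>2"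

lemma vnorm2_nonneg: "0 \<le> vnorm2 n v" by (simp add: sum_nonneg)
lemma mnorm2_nonneg: "0 \<le> mnorm2 p q c" by (simp add: sum_nonneg)

text \<open>The Hilbert-Schmidt norm dominates the operator norm, which makes the supremum in
  \<open>cmat_norm\<close> finite.\<close>

lemma mat_vec_bound:
  fixes a :: "nat \<Rightarrow> nat \<Rightarrow> complex" and m :: nat
  shows "(\<Sum>i<m. (cmod (\<Sum>j<n. a i j * v j))\<^sup>2) \<le> (\<Sum>i<m. \<Sum>j<n. (cmod (a i j))\<^sup>2) * vnorm2 n v"
  unfolding sum_distrib_right
proof (rule sum_mono)
  fix i
  have "(cmod (\<Sum>j<n. a i j * v j))\<^sup>2
      \<le> (sqrt (\<Sum>j<n. (cmod (a i j))\<^sup>2) * sqrt (vnorm2 n v))\<^sup>2"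
    by (intro power_mono cmod_sum_mult_le) simp
  also have "\<dots> = (\<Sum>j<n. (cmod (a i j))\<^sup>2 * vnorm2 n v)"
    by (simp add: power_mult_distrib sum_nonneg sum_distrib_right)
  finally show "(cmod (\<Sum>j<n. a i j * v j))\<^sup>2 \<le> (\<Sum>j<n. (cmod (a i j))\<^sup>2 * vnorm2 n v)" .
qed

lemma cmat_norm_bdd:
  fixes a :: "nat \<Rightarrow> nat \<Rightarrow> complex" and m :: nat
  shows "bdd_above {sqrt (\<Sum>i<m. (cmod (\<Sum>j<n. a i j * v j))\<^sup>2) | v. vnorm2 n v \<le> 1}"
proof (rule bdd_aboveI, clarify)
  fix v assume v: "vnorm2 n v \<le> 1"
  have "(\<Sum>i<m. (cmod (\<Sum>j<n. a i j * v j))\<^sup>2) \<le> mnorm2 m n a * vnorm2 n v"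
    by (rule mat_vec_bound)
  also have "\<dots> \<le> mnorm2 m n a * 1" using v by (intro mult_left_mono mnorm2_nonneg)
  finally show "sqrt (\<Sum>i<m. (cmod (\<Sum>j<n. a i j * v j))\<^sup>2) \<le> sqrt (mnorm2 m n a)" by simp
qed

lemma cmat_norm_upper:
  "vnorm2 n v \<le> 1 \<Longrightarrow> sqrt (\<Sum>i<m. (cmod (\<Sum>j<n. a i j * v j))\<^sup>2) \<le> cmat_norm m n a"
  unfolding cmat_norm_def by (rule cSup_upper[OF _ cmat_norm_bdd]) blast

lemma cmat_norm_nonneg: "0 \<le> cmat_norm m n a"
  using cmat_norm_upper[of "\<lambda>_. 0" n a m] by simp

lemma cmat_norm_least:
  assumes "\<And>v. vnorm2 n v \<le> 1 \<Longrightarrow> (\<Sum>i<m. (cmod (\<Sum>j<n. a i j * v j))\<^sup>2) \<le> t\<^sup>2" "0 \<le> t"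
  shows "cmat_norm m n a \<le> t"
  unfolding cmat_norm_def
proof (rule cSup_least)
  show "{sqrt (\<Sum>i<m. (cmod (\<Sum>j<n. a i j * v j))\<^sup>2) | v. vnorm2 n v \<le> 1} \<noteq> {}"
    by (auto intro!: exI[of _ "\<lambda>_. 0"])
qed (use assms in \<open>auto intro: real_le_lsqrt simp: sum_nonneg\<close>)

lemma vnorm2_scale: "vnorm2 n (\<lambda>j. z * v j) = (cmod z)\<^sup>2 * vnorm2 n v"
  by (simp add: norm_mult power_mult_distrib sum_distrib_left)

lemma vnorm2_zeroD: "vnorm2 n v = 0 \<Longrightarrow> j < n \<Longrightarrow> v j = 0"
  by (simp add: sum_nonneg_eq_0_iff)

lemma cmat_norm_apply:
  "(\<Sum>i<m. (cmod (\<Sum>j<n. a i j * v j))\<^sup>2) \<le> (cmat_norm m n a)\<^sup>2 * vnorm2 n v"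
proof (cases "vnorm2 n v = 0")
  case True
  hence "v j = 0" if "j < n" for j using vnorm2_zeroD that by blast
  thus ?thesis using True by simp
next
  case False
  define r where "r = vnorm2 n v"
  have r: "r > 0" using False vnorm2_nonneg[of v n] by (simp add: r_def)
  define z where "z = complex_of_real (inverse (sqrt r))"
  have z2: "(cmod z)\<^sup>2 = inverse r" using r by (simp add: z_def power_inverse norm_inverse)
  have "vnorm2 n (\<lambda>j. z * v j) \<le> 1"
    unfolding vnorm2_scale z2 using r by (simp add: r_def[symmetric])
  from cmat_norm_upper[OF this, of a m]
  have "(\<Sum>i<m. (cmod (\<Sum>j<n. a i j * (z * v j)))\<^sup>2) \<le> (cmat_norm m n a)\<^sup>2"
    by (rule sqrt_le_D)
  also have "(\<Sum>i<m. (cmod (\<Sum>j<n. a i j * (z * v j)))\<^sup>2) =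
      (\<Sum>i<m. (cmod (z * (\<Sum>j<n. a i j * v j)))\<^sup>2)"
    by (simp add: sum_distrib_left mult_ac)
  also have "\<dots> = inverse r * (\<Sum>i<m. (cmod (\<Sum>j<n. a i j * v j))\<^sup>2)"
    unfolding vnorm2_scale z2 ..
  finally show ?thesis using r unfolding r_def[symmetric] by (simp add: field_simps)
qed

lemma cmat_norm_bilinear:
  "cmod (\<Sum>i<m. \<Sum>j<n. c i * a i j * d j)
     \<le> cmat_norm m n a * sqrt (vnorm2 m c) * sqrt (vnorm2 n d)"
proof -
  have "cmod (\<Sum>i<m. \<Sum>j<n. c i * a i j * d j) = cmod (\<Sum>i<m. c i * (\<Sum>j<n. a i j * d j))"
    by (simp add: sum_distrib_left mult.assoc)
  also have "\<dots> \<le> sqrt (vnorm2 m c) * sqrt (\<Sum>i<m. (cmod (\<Sum>j<n. a i j * d j))\<^sup>2)"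
    by (rule cmod_sum_mult_le)
  also have "\<dots> \<le> sqrt (vnorm2 m c) * sqrt ((cmat_norm m n a)\<^sup>2 * vnorm2 n d)"
    by (intro mult_left_mono real_sqrt_le_mono cmat_norm_apply) (simp add: sum_nonneg)
  also have "\<dots> = cmat_norm m n a * sqrt (vnorm2 m c) * sqrt (vnorm2 n d)"
    by (simp add: real_sqrt_mult cmat_norm_nonneg)
  finally show ?thesis .
qed

lemma sum_cmod_square_as_dual:
  "complex_of_real (\<Sum>i\<in>A. (cmod (w i))\<^sup>2) = (\<Sum>i\<in>A. cnj (w i) * w i)"
  by (simp add: complex_norm_square[symmetric] mult.commute)

text \<open>Riesz: the bound is tested on \<open>c = cnj w / |w|\<close>.\<close>
lemma vec_norm_by_duality:
  assumes t: "0 \<le> t" and A: "finite A"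
    and b: "\<And>c. (\<Sum>i\<in>A. (cmod (c i))\<^sup>2) \<le> 1 \<Longrightarrow> cmod (\<Sum>i\<in>A. c i * w i) \<le> t"
  shows "(\<Sum>i\<in>A. (cmod (w i))\<^sup>2) \<le> t\<^sup>2"
proof (cases "(\<Sum>i\<in>A. (cmod (w i))\<^sup>2) = 0")
  case False
  define r where "r = sqrt (\<Sum>i\<in>A. (cmod (w i))\<^sup>2)"
  have r: "r > 0" "r\<^sup>2 = (\<Sum>i\<in>A. (cmod (w i))\<^sup>2)"
    using False sum_nonneg[of A "\<lambda>i. (cmod (w i))\<^sup>2"] by (auto simp: r_def less_le)
  have "(\<Sum>i\<in>A. (cmod (cnj (w i) / r))\<^sup>2) = inverse (r\<^sup>2) * (\<Sum>i\<in>A. (cmod (w i))\<^sup>2)"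
    by (simp add: norm_divide power_divide sum_distrib_left field_simps)
  also have "\<dots> = 1" unfolding r(2)[symmetric] using r(1) by simp
  finally have "cmod (\<Sum>i\<in>A. cnj (w i) / r * w i) \<le> t" by (intro b) simp
  also have "(\<Sum>i\<in>A. cnj (w i) / r * w i) = complex_of_real (r\<^sup>2) / r"
    unfolding r(2) sum_cmod_square_as_dual by (simp add: sum_divide_distrib)
  also have "\<dots> = complex_of_real r" using r(1) by (simp add: power2_eq_square)
  finally have "r \<le> t" using r by simp
  thus ?thesis unfolding r(2)[symmetric] using r by (intro power_mono) auto
qed (use t in simp)

text \<open>Testing bilinearly rather than sesquilinearly loses nothing, because conjugation
  preserves the unit ball. All later norm estimates are therefore free of conjugates.\<close>

lemma cmat_norm_least_bilinear:
  assumes "\<And>c d. vnorm2 m c \<le> 1 \<Longrightarrow> vnorm2 n d \<le> 1 \<Longrightarrow> cmod (\<Sum>i<m. \<Sum>j<n. c i * a i j * d j) \<le> t"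
    and "0 \<le> t"
  shows "cmat_norm m n a \<le> t"
proof (rule cmat_norm_least)
  fix d assume d: "vnorm2 n d \<le> 1"
  show "(\<Sum>i<m. (cmod (\<Sum>j<n. a i j * d j))\<^sup>2) \<le> t\<^sup>2"
    by (rule vec_norm_by_duality)
       (use assms d in \<open>auto simp: sum_distrib_left mult.assoc\<close>)
qed (fact assms)

text \<open>A matrix and its transpose have the same bilinear form. The left outer factor of a
  factorisation is tested on row vectors, which is where this form is used.\<close>

lemma cmat_norm_apply_transpose:
  "(\<Sum>j<n. (cmod (\<Sum>i<m. v i * a i j))\<^sup>2) \<le> (cmat_norm m n a)\<^sup>2 * vnorm2 m v"
proof -
  have "(\<Sum>j<n. (cmod (\<Sum>i<m. v i * a i j))\<^sup>2) \<le> (cmat_norm m n a * sqrt (vnorm2 m v))\<^sup>2"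
  proof (rule vec_norm_by_duality)
    fix c assume c: "(\<Sum>j<n. (cmod (c j))\<^sup>2) \<le> 1"
    have "cmod (\<Sum>j<n. c j * (\<Sum>i<m. v i * a i j)) = cmod (\<Sum>i<m. \<Sum>j<n. v i * a i j * c j)"
      by (subst sum.swap) (simp add: sum_distrib_left mult_ac)
    also have "\<dots> \<le> cmat_norm m n a * sqrt (vnorm2 m v) * sqrt (vnorm2 n c)"
      by (rule cmat_norm_bilinear)
    also have "\<dots> \<le> cmat_norm m n a * sqrt (vnorm2 m v) * 1"
      using c by (intro mult_left_mono) (auto simp: cmat_norm_nonneg sum_nonneg)
    finally show "cmod (\<Sum>j<n. c j * (\<Sum>i<m. v i * a i j)) \<le> cmat_norm m n a * sqrt (vnorm2 m v)"
      by simp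
  qed (auto simp: cmat_norm_nonneg sum_nonneg)
  thus ?thesis by (simp add: power_mult_distrib sum_nonneg)
qed

lemma cmat_norm_cong:
  assumes "\<And>i j. i < m \<Longrightarrow> j < n \<Longrightarrow> a i j = b i j"
  shows "cmat_norm m n a = cmat_norm m n b"
proof -
  have "(\<Sum>i<m. (cmod (\<Sum>j<n. a i j * v j))\<^sup>2) = (\<Sum>i<m. (cmod (\<Sum>j<n. b i j * v j))\<^sup>2)" for v
    using assms by (intro sum.cong arg_cong[of _ _ "\<lambda>z. (cmod z)\<^sup>2"]) auto
  thus ?thesis by (simp add: cmat_norm_def)
qed

lemma div_mod_less:
  assumes "a < p * (q :: nat)" shows "a div q < p" "a mod q < q"
proof -
  have "q > 0" using assms by (cases q) auto
  thus "a div q < p" "a mod q < q" using assms by (auto simp: less_mult_imp_div_less)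
qed

subsection \<open>Block matrices with index pairs flattened as \<open>i * n + r\<close>\<close>

text \<open>Row index \<open>(i, r)\<close> and column index \<open>(j, s)\<close> are kept apart,
  so that \<open>div\<close> and \<open>mod\<close> occur only in the passage to
  \<open>cmat_norm\<close>.\<close>

definition bform :: "nat \<Rightarrow> nat \<Rightarrow> (nat \<Rightarrow> nat \<Rightarrow> complex) \<Rightarrow> (nat \<Rightarrow> nat \<Rightarrow> nat \<Rightarrow> nat \<Rightarrow> complex)
    \<Rightarrow> (nat \<Rightarrow> nat \<Rightarrow> complex) \<Rightarrow> complex" where
  "bform k n c B d = (\<Sum>i<k. \<Sum>r<n. \<Sum>j<k. \<Sum>s<n. c i r * B i r j s * d j s)"

lemma bform_flatten:
  "bform k n c B d = (\<Sum>a<k * n. \<Sum>b<k * n.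
     c (a div n) (a mod n) * B (a div n) (a mod n) (b div n) (b mod n) * d (b div n) (b mod n))"
  unfolding bform_def
  by (subst sum_lessThan_mult[symmetric], rule sum.cong[OF refl], subst sum_lessThan_mult[symmetric]) simp

lemma mnorm2_flatten: "mnorm2 k n c = vnorm2 (k * n) (\<lambda>a. c (a div n) (a mod n))"
  by (simp add: sum_lessThan_mult[where h = "\<lambda>i r. (cmod (c i r))\<^sup>2"])

lemma vnorm2_unflatten: "vnorm2 (k * n) c = mnorm2 k n (\<lambda>i r. c (i * n + r))"
  unfolding mnorm2_flatten
  by (intro sum.cong) (auto simp: div_mod_less)

lemma cmat_norm_bform:
  "cmod (bform k n c B d) \<le> cmat_norm (k * n) (k * n) (\<lambda>a b. B (a div n) (a mod n) (b div n) (b mod n))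
      * sqrt (mnorm2 k n c) * sqrt (mnorm2 k n d)"
  unfolding bform_flatten mnorm2_flatten by (rule cmat_norm_bilinear)

lemma cmat_norm_least_bform:
  assumes "\<And>c d. mnorm2 k n c \<le> 1 \<Longrightarrow> mnorm2 k n d \<le> 1 \<Longrightarrow> cmod (bform k n c B d) \<le> t" "0 \<le> t"
  shows "cmat_norm (k * n) (k * n) (\<lambda>a b. B (a div n) (a mod n) (b div n) (b mod n)) \<le> t"
proof (rule cmat_norm_least_bilinear)
  fix c d assume "vnorm2 (k * n) c \<le> 1" "vnorm2 (k * n) d \<le> 1"
  hence "cmod (bform k n (\<lambda>i r. c (i * n + r)) B (\<lambda>i r. d (i * n + r))) \<le> t"
    unfolding vnorm2_unflatten by (rule assms)
  thus "cmod (\<Sum>i<k * n. \<Sum>j<k * n. c i * B (i div n) (i mod n) (j div n) (j mod n) * d j) \<le> t"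
    unfolding bform_flatten by simp
qed (fact assms)

section \<open>Operator spaces and their duals\<close>

lemma lin_onD:
  assumes "lin_on V f"
  shows "x \<in> V \<Longrightarrow> y \<in> V \<Longrightarrow> f (x + y) = f x + f y" "x \<in> V \<Longrightarrow> f (cscale c x) = cscale c (f x)"
  using assms unfolding lin_on_def by auto

lemma lin_on_zero:
  assumes "lin_on V f" "csubspace V" shows "f 0 = 0"
proof -
  have "0 \<in> V" using assms by (simp add: csubspace_def)
  from lin_onD(2)[OF assms(1) this, of 0] show ?thesis by simp
qed

lemma lin_on_sum:
  assumes f: "lin_on V f" and V: "csubspace V" and x: "\<And>i. i \<in> I \<Longrightarrow> x i \<in> V"
  shows "f (\<Sum>i\<in>I. x i) = (\<Sum>i\<in>I. f (x i))"
  using x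
proof (induction I rule: infinite_finite_induct)
  case (insert i I)
  hence "(\<Sum>i\<in>I. x i) \<in> V" using V by (intro cv.subspace_sum) (auto simp: csubspace_iff_subspace)
  thus ?case using insert lin_onD(1)[OF f] by simp
qed (simp_all add: lin_on_zero[OF f V])

lemma sum_swap4:
  "(\<Sum>i\<in>A. \<Sum>r\<in>B. \<Sum>j\<in>C. \<Sum>s\<in>D. h i r j s) = (\<Sum>r\<in>B. \<Sum>s\<in>D. \<Sum>i\<in>A. \<Sum>j\<in>C. h i r j s)"
proof -
  have "(\<Sum>i\<in>A. \<Sum>r\<in>B. \<Sum>j\<in>C. \<Sum>s\<in>D. h i r j s) = (\<Sum>r\<in>B. \<Sum>i\<in>A. \<Sum>j\<in>C. \<Sum>s\<in>D. h i r j s)"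
    by (rule sum.swap)
  also have "\<dots> = (\<Sum>r\<in>B. \<Sum>i\<in>A. \<Sum>s\<in>D. \<Sum>j\<in>C. h i r j s)"
    by (rule sum.cong[OF refl], rule sum.cong[OF refl], rule sum.swap)
  also have "\<dots> = (\<Sum>r\<in>B. \<Sum>s\<in>D. \<Sum>i\<in>A. \<Sum>j\<in>C. h i r j s)"
    by (rule sum.cong[OF refl], rule sum.swap)
  finally show ?thesis .
qed

lemma sum_delta2:
  fixes h :: "nat \<Rightarrow> nat \<Rightarrow> complex"
  assumes "r < n" "s < n"
  shows "(\<Sum>r'<n. \<Sum>s'<n. (if r' = r then 1 else 0) * h r' s' * (if s' = s then 1 else 0)) = h r s"
proof -
  have "(\<Sum>r'<n. \<Sum>s'<n. (if r' = r then 1 else 0) * h r' s' * (if s' = s then 1 else 0)) =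
      (\<Sum>r'<n. \<Sum>s'<n. if s' = s then (if r' = r then h r' s' else 0) else 0)"
    by (intro sum.cong refl) auto
  thus ?thesis using assms by simp
qed

lemma sum_fun_apply: "(\<Sum>i\<in>I. f i) x = (\<Sum>i\<in>I. f i x)"
  by (induction I rule: infinite_finite_induct) simp_all

section \<open>Elementary consequences of Ruan's axioms\<close>

locale opspace =
  fixes V :: "'a::cvec set" and N :: "nat \<Rightarrow> (nat \<Rightarrow> nat \<Rightarrow> 'a) \<Rightarrow> real"
  assumes op: "operator_space V N"
begin

lemma csub: "csubspace V" using op by (simp add: operator_space_def)
lemma sub: "cv.subspace V" using csub by (simp add: csubspace_iff_subspace)

lemmas zero_in = cv.subspace_0[OF sub]
  and add_in = cv.subspace_add[OF sub]
  and scale_in = cv.subspace_scale[OF sub]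
  and sum_in = cv.subspace_sum[OF sub]

lemma N_cong: "(\<And>i j. i < n \<Longrightarrow> j < n \<Longrightarrow> x i j = y i j) \<Longrightarrow> N n x = N n y"
  using op unfolding operator_space_def by meson
lemma N_nonneg: "mat_in V n n x \<Longrightarrow> 0 \<le> N n x"
  using op unfolding operator_space_def by meson
lemma N_eq_0: "mat_in V n n x \<Longrightarrow> N n x = 0 \<longleftrightarrow> (\<forall>i<n. \<forall>j<n. x i j = 0)"
  using op unfolding operator_space_def by meson
lemma N_triangle: "mat_in V n n x \<Longrightarrow> mat_in V n n y \<Longrightarrow> N n (\<lambda>i j. x i j + y i j) \<le> N n x + N n y"
  using op unfolding operator_space_def by meson
lemma N_ruan: "mat_in V n n x \<Longrightarrow> N m (mat_mult3 \<alpha> n x \<beta>) \<le> cmat_norm m n \<alpha> * N n x * cmat_norm n m \<beta>"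
  using op unfolding operator_space_def by meson
lemma N_dsum: "mat_in V n n x \<Longrightarrow> mat_in V m m y \<Longrightarrow> N (n + m) (mat_dsum n x y) = max (N n x) (N m y)"
  using op unfolding operator_space_def by meson

lemma N_zero: "N n (\<lambda>_ _. 0) = 0"
  using N_eq_0[of n "\<lambda>_ _. 0"] zero_in by (simp add: mat_in_def)

lemma cmat_norm_diag: "cmat_norm n n (\<lambda>i k. if i = k then c else 0) \<le> cmod c"
proof (rule cmat_norm_least)
  fix v :: "nat \<Rightarrow> complex" assume v: "vnorm2 n v \<le> 1"
  have "(\<Sum>i<n. (cmod (\<Sum>j<n. (if i = j then c else 0) * v j))\<^sup>2) = vnorm2 n (\<lambda>i. c * v i)"
    by (intro sum.cong) (auto simp: if_distrib[of "\<lambda>z. z * _"] cong: if_cong)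
  also have "\<dots> \<le> (cmod c)\<^sup>2" unfolding vnorm2_scale using v by (simp add: mult_left_le)
  finally show "(\<Sum>i<n. (cmod (\<Sum>j<n. (if i = j then c else 0) * v j))\<^sup>2) \<le> (cmod c)\<^sup>2" .
qed simp

text \<open>Homogeneity is not among the axioms; it follows from Ruan's inequality with a scalar
  diagonal matrix on the left.\<close>

lemma N_scale: 
  assumes x: "mat_in V n n x" shows "N n (\<lambda>i j. cscale c (x i j)) \<le> cmod c * N n x"
proof -
  let ?D = "\<lambda>c i k :: nat. if i = k then c else (0 :: complex)"
  have "N n (\<lambda>i j. cscale c (x i j)) = N n (mat_mult3 (?D c) n x (?D 1))"
  proof (rule N_cong)
    fix i j assume ij: "i < n" "j < n"
    have "mat_mult3 (?D c) n x (?D 1) i j = (\<Sum>k<n. \<Sum>l<n. if i = k then (if l = j then cscale c (x k l)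
        else 0) else 0)"
      unfolding mat_mult3_def by (intro sum.cong) auto
    also have "\<dots> = (\<Sum>k<n. if i = k then (\<Sum>l<n. if l = j then cscale c (x k l) else 0) else 0)"
      by (intro sum.cong) auto
    also have "\<dots> = cscale c (x i j)" using ij by simp
    finally show "cscale c (x i j) = mat_mult3 (?D c) n x (?D 1) i j" ..
  qed
  also have "\<dots> \<le> cmat_norm n n (?D c) * N n x * cmat_norm n n (?D 1)"
    by (rule N_ruan[OF x])
  also have "\<dots> \<le> cmod c * N n x * cmod 1"
    by (intro mult_mono cmat_norm_diag mult_nonneg_nonneg cmat_norm_nonneg N_nonneg[OF x]) auto
  finally show ?thesis by simp
qed

lemma cmat_norm_row: "cmat_norm 1 n (\<lambda>_. c) \<le> sqrt (vnorm2 n c)"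
proof (rule cmat_norm_least)
  fix v :: "nat \<Rightarrow> complex" assume v: "vnorm2 n v \<le> 1"
  have "(\<Sum>i<1::nat. (cmod (\<Sum>j<n. c j * v j))\<^sup>2) \<le> (\<Sum>i<1::nat. \<Sum>j<n. (cmod (c j))\<^sup>2) * vnorm2 n v"
    by (rule mat_vec_bound)
  also have "\<dots> \<le> vnorm2 n c" using v by (simp add: mult_left_le vnorm2_nonneg)
  finally show "(\<Sum>i<1::nat. (cmod (\<Sum>j<n. c j * v j))\<^sup>2) \<le> (sqrt (vnorm2 n c))\<^sup>2"
    by (simp add: vnorm2_nonneg)
qed (simp add: vnorm2_nonneg)

lemma cmat_norm_col: "cmat_norm n 1 (\<lambda>l _. d l) \<le> sqrt (vnorm2 n d)"
proof (rule cmat_norm_least)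
  fix v :: "nat \<Rightarrow> complex" assume v: "vnorm2 1 v \<le> 1"
  have "(\<Sum>i<n. (cmod (\<Sum>j<1::nat. d i * v j))\<^sup>2) \<le> (\<Sum>i<n. \<Sum>j<1::nat. (cmod (d i))\<^sup>2) * vnorm2 1 v"
    by (rule mat_vec_bound)
  also have "\<dots> \<le> vnorm2 n d * 1" using v by (intro mult_mono) (auto simp: vnorm2_nonneg)
  finally show "(\<Sum>i<n. (cmod (\<Sum>j<1::nat. d i * v j))\<^sup>2) \<le> (sqrt (vnorm2 n d))\<^sup>2"
    by (simp add: vnorm2_nonneg)
qed (simp add: vnorm2_nonneg)

lemma N_compress:
  assumes x: "mat_in V n n x"
  shows "N 1 (\<lambda>_ _. \<Sum>k<n. \<Sum>l<n. cscale (c k * d l) (x k l)) \<le> N n x * sqrt (vnorm2 n c) * sqrt (vnorm2 n d)"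
proof -
  have "N 1 (mat_mult3 (\<lambda>_. c) n x (\<lambda>l _. d l)) \<le> cmat_norm 1 n (\<lambda>_. c) * N n x * cmat_norm n 1 (\<lambda>l _. d l)"
    by (rule N_ruan[OF x])
  also have "\<dots> \<le> sqrt (vnorm2 n c) * N n x * sqrt (vnorm2 n d)"
    by (intro mult_mono cmat_norm_row cmat_norm_col mult_nonneg_nonneg cmat_norm_nonneg N_nonneg[OF x])
       (auto simp: vnorm2_nonneg)
  finally show ?thesis by (simp add: mat_mult3_def mult_ac)
qed

text \<open>Bounded functionals are completely bounded with the same constant: pulling
  \<open>c\<close> and \<open>d\<close> into the argument turns the sum into \<open>f\<close> at a
  compression of \<open>x\<close> to a single entry.\<close>

lemma functional_amplification:
  assumes f: "lin_on V f" and B: "\<And>x. x \<in> V \<Longrightarrow> cmod (f x) \<le> B * N 1 (\<lambda>_ _. x)" and B0: "0 \<le> B"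
    and x: "mat_in V n n x"
  shows "cmod (\<Sum>k<n. \<Sum>l<n. c k * f (x k l) * d l) \<le> B * N n x * sqrt (vnorm2 n c) * sqrt (vnorm2 n d)"
proof -
  have xin: "k < n \<Longrightarrow> l < n \<Longrightarrow> x k l \<in> V" for k l using x by (simp add: mat_in_def)
  let ?y = "\<Sum>k<n. \<Sum>l<n. cscale (c k * d l) (x k l)"
  have y: "?y \<in> V" by (intro sum_in scale_in xin) auto
  have "f ?y = (\<Sum>k<n. f (\<Sum>l<n. cscale (c k * d l) (x k l)))"
    by (intro lin_on_sum[OF f csub] sum_in scale_in xin) auto
  also have "\<dots> = (\<Sum>k<n. \<Sum>l<n. f (cscale (c k * d l) (x k l)))"
    by (intro sum.cong refl lin_on_sum[OF f csub] scale_in xin) auto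
  also have "\<dots> = (\<Sum>k<n. \<Sum>l<n. c k * f (x k l) * d l)"
    by (intro sum.cong refl) (simp add: lin_onD(2)[OF f] xin mult_ac)
  finally have "f ?y = (\<Sum>k<n. \<Sum>l<n. c k * f (x k l) * d l)" .
  hence "cmod (\<Sum>k<n. \<Sum>l<n. c k * f (x k l) * d l) \<le> B * N 1 (\<lambda>_ _. ?y)"
    using B[OF y] by simp
  also have "\<dots> \<le> B * (N n x * sqrt (vnorm2 n c) * sqrt (vnorm2 n d))"
    by (intro mult_left_mono N_compress x B0)
  finally show ?thesis by (simp add: mult.assoc)
qed

section \<open>The dual operator space\<close>

abbreviation "V' \<equiv> dual_carrier V N"
abbreviation "N' \<equiv> dual_norm V N"

lemma dualD:
  assumes "f \<in> V'"
  shows "lin_on V f" "x \<notin> V \<Longrightarrow> f x = 0" "\<exists>B\<ge>0. \<forall>x\<in>V. cmod (f x) \<le> B * N 1 (\<lambda>_ _. x)"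
proof -
  show "lin_on V f" "x \<notin> V \<Longrightarrow> f x = 0" using assms by (auto simp: dual_carrier_def)
  obtain B where B: "\<And>x. x \<in> V \<Longrightarrow> cmod (f x) \<le> B * N 1 (\<lambda>_ _. x)"
    using assms by (auto simp: dual_carrier_def)
  have "cmod (f x) \<le> max B 0 * N 1 (\<lambda>_ _. x)" if "x \<in> V" for x
  proof -
    have "0 \<le> N 1 (\<lambda>_ _. x)" using that by (intro N_nonneg) (simp add: mat_in_def)
    hence "B * N 1 (\<lambda>_ _. x) \<le> max B 0 * N 1 (\<lambda>_ _. x)" by (intro mult_right_mono) auto
    with B[OF that] show ?thesis by linarith
  qed
  thus "\<exists>B\<ge>0. \<forall>x\<in>V. cmod (f x) \<le> B * N 1 (\<lambda>_ _. x)" by (intro exI[of _ "max B 0"]) auto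
qed

lemma dual_memI:
  assumes "lin_on V f" "\<And>x. x \<notin> V \<Longrightarrow> f x = 0" "\<And>x. x \<in> V \<Longrightarrow> cmod (f x) \<le> B * N 1 (\<lambda>_ _. x)"
  shows "f \<in> V'"
  using assms by (auto simp: dual_carrier_def)

abbreviation pform where
  "pform k n c F x d \<equiv> bform k n c (\<lambda>i r j s. F r s (x i j)) d"

text \<open>A crude bound, entry by entry, which makes the supremum in \<open>dual_norm\<close>
  finite.\<close>

lemma pform_bounded:
  assumes F: "mat_in V' n n F"
  obtains B where "0 \<le> B" "\<And>k x c d. mat_in V k k x \<Longrightarrow> N k x \<le> 1 \<Longrightarrow> mnorm2 k n c \<le> 1 \<Longrightarrow> mnorm2 k n d \<le> 1 \<Longrightarrow>
    cmod (pform k n c F x d) \<le> B"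
proof -
  have "\<forall>r s. \<exists>B\<ge>0. r < n \<longrightarrow> s < n \<longrightarrow> (\<forall>x\<in>V. cmod (F r s x) \<le> B * N 1 (\<lambda>_ _. x))"
    using dualD(3) F unfolding mat_in_def by (meson order_refl)
  then obtain b where b0: "\<And>r s. (0::real) \<le> b r s"
    and b: "\<And>r s x. r < n \<Longrightarrow> s < n \<Longrightarrow> x \<in> V \<Longrightarrow> cmod (F r s x) \<le> b r s * N 1 (\<lambda>_ _. x)"
    by metis
  show thesis
  proof
    show "0 \<le> (\<Sum>r<n. \<Sum>s<n. b r s)" by (intro sum_nonneg b0)
    fix k x c d assume x: "mat_in V k k x" "N k x \<le> 1" and cd: "mnorm2 k n c \<le> 1" "mnorm2 k n d \<le> 1"
    have col: "sqrt (vnorm2 k (\<lambda>i. c i r)) \<le> 1" if "mnorm2 k n c \<le> 1" "r < n" for c :: "nat \<Rightarrow> nat \<Rightarrow>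
        complex" and r
    proof -
      have "vnorm2 k (\<lambda>i. c i r) \<le> mnorm2 k n c"
        using that(2) by (intro sum_mono member_le_sum) auto
      thus ?thesis using that by simp
    qed
    have "pform k n c F x d = (\<Sum>r<n. \<Sum>s<n. \<Sum>i<k. \<Sum>j<k. c i r * F r s (x i j) * d j s)"
      unfolding bform_def by (rule sum_swap4)
    also have "cmod \<dots> \<le> (\<Sum>r<n. \<Sum>s<n. b r s)"
    proof (rule order_trans[OF norm_sum sum_mono], rule order_trans[OF norm_sum sum_mono])
      fix r s assume rs: "r \<in> {..<n}" "s \<in> {..<n}"
      have "cmod (\<Sum>i<k. \<Sum>j<k. c i r * F r s (x i j) * d j s)
          \<le> b r s * N k x * sqrt (vnorm2 k (\<lambda>i. c i r)) * sqrt (vnorm2 k (\<lambda>j. d j s))"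
        by (rule functional_amplification[OF _ b b0 x(1)])
           (use F rs dualD(1) in \<open>auto simp: mat_in_def\<close>)
      also have "\<dots> \<le> b r s * 1 * 1 * 1"
        using rs cd x by (intro mult_mono col) (auto simp: b0 N_nonneg sum_nonneg)
      finally show "cmod (\<Sum>i<k. \<Sum>j<k. c i r * F r s (x i j) * d j s) \<le> b r s" by simp
    qed
    finally show "cmod (pform k n c F x d) \<le> (\<Sum>r<n. \<Sum>s<n. b r s)" .
  qed
qed

abbreviation "dset n F \<equiv> {cmat_norm (k * n) (k * n)
        (\<lambda>a b. F (a mod n) (b mod n) (x (a div n) (b div n))) | k x. mat_in V k k x \<and> N k x \<le> 1}"

lemma dset_bdd:
  assumes F: "mat_in V' n n F" shows "bdd_above (dset n F)"
proof -
  obtain B where B: "0 \<le> B" "\<And>k x c d. mat_in V k k x \<Longrightarrow> N k x \<le> 1 \<Longrightarrow> mnorm2 k n c \<le> 1 \<Longrightarrow> mnorm2 k n d \<le> 1 \<Longrightarrow>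
    cmod (pform k n c F x d) \<le> B" using pform_bounded[OF F] by metis
  show ?thesis
  proof (rule bdd_aboveI, clarify)
    fix k x assume x: "mat_in V k k x" "N k x \<le> 1"
    show "cmat_norm (k * n) (k * n) (\<lambda>a b. F (a mod n) (b mod n) (x (a div n) (b div n))) \<le> B"
      by (rule cmat_norm_least_bform[where B = "\<lambda>i r j s. F r s (x i j)"]) (use B x in auto)
  qed
qed

lemma dual_norm_least:
  assumes "0 \<le> t"
    "\<And>k x c d. mat_in V k k x \<Longrightarrow> N k x \<le> 1 \<Longrightarrow> mnorm2 k n c \<le> 1 \<Longrightarrow> mnorm2 k n d \<le> 1 \<Longrightarrow>
      cmod (pform k n c F x d) \<le> t"
  shows "N' n F \<le> t"
  unfolding dual_norm_def
proof (rule cSup_least)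
  show "dset n F \<noteq> {}"
    using N_zero zero_in by (auto intro!: exI[of _ "\<lambda>_ _. 0"] simp: mat_in_def)
  fix y assume "y \<in> dset n F"
  then obtain k x where x: "mat_in V k k x" "N k x \<le> 1"
    and y: "y = cmat_norm (k * n) (k * n) (\<lambda>a b. F (a mod n) (b mod n) (x (a div n) (b div n)))" by blast
  show "y \<le> t" unfolding y
    by (rule cmat_norm_least_bform[where B = "\<lambda>i r j s. F r s (x i j)"]) (use assms x in auto)
qed

lemma dual_norm_pairing1:
  assumes F: "mat_in V' n n F" and x: "mat_in V k k x" "N k x \<le> 1"
  shows "cmod (pform k n c F x d) \<le> N' n F * sqrt (mnorm2 k n c) * sqrt (mnorm2 k n d)"
proof -
  have "cmod (pform k n c F x d) \<le> cmat_norm (k * n) (k * n) (\<lambda>a b. F (a mod n) (b mod n) (x (a div n)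
      (b div n)))
      * sqrt (mnorm2 k n c) * sqrt (mnorm2 k n d)"
    by (rule cmat_norm_bform)
  also have "cmat_norm (k * n) (k * n) (\<lambda>a b. F (a mod n) (b mod n) (x (a div n) (b div n))) \<le> N' n F"
    unfolding dual_norm_def by (rule cSup_upper[OF _ dset_bdd[OF F]]) (use x in blast)
  finally show ?thesis by (auto simp: mult_right_mono mnorm2_nonneg)
qed

lemma dual_norm_nonneg: "mat_in V' n n F \<Longrightarrow> 0 \<le> N' n F"
  unfolding dual_norm_def
  by (rule cSup_upper2[OF _ cmat_norm_nonneg dset_bdd])
     (use N_zero zero_in in \<open>auto intro!: exI[of _ "0::nat"] exI[of _ "\<lambda>_ _. 0"] simp: mat_in_def\<close>)

lemma dual_norm_pairing_unit:
  assumes F: "mat_in V' n n F" and x: "mat_in V k k x" "N k x \<le> 1"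
    and cd: "mnorm2 k n c \<le> 1" "mnorm2 k n d \<le> 1"
  shows "cmod (pform k n c F x d) \<le> N' n F"
proof -
  have "cmod (pform k n c F x d) \<le> N' n F * sqrt (mnorm2 k n c) * sqrt (mnorm2 k n d)"
    by (rule dual_norm_pairing1[OF F x])
  also have "\<dots> \<le> N' n F * 1 * 1"
    using cd dual_norm_nonneg[OF F] by (intro mult_mono) (auto simp: mnorm2_nonneg)
  finally show ?thesis by simp
qed

lemma dual_norm_pairing:
  assumes F: "mat_in V' n n F" and x: "mat_in V k k x"
  shows "cmod (pform k n c F x d) \<le> N' n F * N k x * sqrt (mnorm2 k n c) * sqrt (mnorm2 k n d)"
proof (cases "N k x = 0")
  case True
  have "F r s (x i j) = 0" if "i < k" "j < k" "r < n" "s < n" for i j r s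
  proof -
    have "F r s \<in> V'" using F that by (simp add: mat_in_def)
    moreover have "x i j = 0" using True N_eq_0[OF x] that by blast
    ultimately show ?thesis using lin_on_zero[OF dualD(1) csub] by simp
  qed
  hence "pform k n c F x d = 0" unfolding bform_def by (intro sum.neutral) auto
  thus ?thesis using True by simp
next
  case False
  define t where "t = N k x"
  have t: "t > 0" using False N_nonneg[OF x] by (simp add: t_def)
  define x' where "x' = (\<lambda>i j. cscale (of_real (inverse t)) (x i j))"
  have x': "mat_in V k k x'" using x by (auto simp: mat_in_def x'_def intro: scale_in)
  have "N k x' \<le> inverse t * t"
    using N_scale[OF x, of "of_real (inverse t)"] t by (simp add: x'_def t_def norm_inverse)
  hence "N k x' \<le> 1" using t by simp
  from dual_norm_pairing1[OF F x' this]
  have *: "cmod (pform k n c F x' d) \<le> N' n F * sqrt (mnorm2 k n c) * sqrt (mnorm2 k n d)" .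
  have "pform k n c F x' d = inverse t * pform k n c F x d"
  proof -
    have "F r s (x' i j) = inverse t * F r s (x i j)" if "i < k" "j < k" "r < n" "s < n" for i j r s
      using that F x lin_onD(2)[OF dualD(1)] by (simp add: x'_def mat_in_def)
    hence "pform k n c F x' d = (\<Sum>i<k. \<Sum>r<n. \<Sum>j<k. \<Sum>s<n. inverse t * (c i r * F r s (x i j) * d j s))"
      unfolding bform_def by (intro sum.cong refl) (simp add: mult_ac)
    thus ?thesis by (simp only: bform_def sum_distrib_left)
  qed
  hence "cmod (pform k n c F x' d) = inverse t * cmod (pform k n c F x d)"
    using t by (simp add: norm_mult norm_inverse norm_divide divide_inverse mult_ac)
  with * have "inverse t * cmod (pform k n c F x d) \<le> N' n F * sqrt (mnorm2 k n c) * sqrt (mnorm2 k n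
      d)" by simp
  thus ?thesis using t unfolding t_def[symmetric] by (simp add: field_simps)
qed

lemma dual_norm_cong: 
  assumes "\<And>i j. i < n \<Longrightarrow> j < n \<Longrightarrow> F i j = G i j"
  shows "N' n F = N' n G"
proof -
  have "cmat_norm (k * n) (k * n) (\<lambda>a b. F (a mod n) (b mod n) (x (a div n) (b div n))) =
        cmat_norm (k * n) (k * n) (\<lambda>a b. G (a mod n) (b mod n) (x (a div n) (b div n)))" for k x
    by (intro cmat_norm_cong) (simp add: assms div_mod_less)
  thus ?thesis by (simp add: dual_norm_def)
qed

lemma dual_eval_bound:
  assumes "f \<in> V'" "x \<in> V"
  shows "cmod (f x) \<le> N' 1 (\<lambda>_ _. f) * N 1 (\<lambda>_ _. x)"
  using dual_norm_pairing[of 1 "\<lambda>_ _. f" 1 "\<lambda>_ _. x" "\<lambda>_ _. 1" "\<lambda>_ _. 1"] assms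
  by (simp add: mat_in_def bform_def)

lemma dual_csubspace: "csubspace V'"
  unfolding csubspace_def
proof (intro conjI ballI allI)
  show "0 \<in> V'" by (rule dual_memI[where B = 0]) (auto simp: lin_on_def)
  fix f assume f: "f \<in> V'"
  obtain B where B: "B \<ge> 0" "\<forall>x\<in>V. cmod (f x) \<le> B * N 1 (\<lambda>_ _. x)" using dualD(3)[OF f] by blast
  show "cscale c f \<in> V'" for c
  proof (rule dual_memI)
    show "lin_on V (cscale c f)"
      using lin_onD[OF dualD(1)[OF f]] by (simp add: lin_on_def cscale_fun_def algebra_simps)
    show "cmod (cscale c f x) \<le> (cmod c * B) * N 1 (\<lambda>_ _. x)" if "x \<in> V" for x
      using B that by (simp add: cscale_fun_def norm_mult mult.assoc mult_left_mono)
  qed (simp add: cscale_fun_def dualD(2)[OF f])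
  fix g assume g: "g \<in> V'"
  obtain B' where B': "B' \<ge> 0" "\<forall>x\<in>V. cmod (g x) \<le> B' * N 1 (\<lambda>_ _. x)" using dualD(3)[OF g] by blast
  show "f + g \<in> V'"
  proof (rule dual_memI)
    show "lin_on V (f + g)"
      using lin_onD[OF dualD(1)[OF f]] lin_onD[OF dualD(1)[OF g]] by (simp add: lin_on_def algebra_simps)
    show "cmod ((f + g) x) \<le> (B + B') * N 1 (\<lambda>_ _. x)" if "x \<in> V" for x
    proof -
      have "cmod ((f + g) x) \<le> cmod (f x) + cmod (g x)" by (simp add: norm_triangle_ineq)
      also have "\<dots> \<le> B * N 1 (\<lambda>_ _. x) + B' * N 1 (\<lambda>_ _. x)"
        using B(2) B'(2) that by (intro add_mono) auto
      finally show ?thesis by (simp add: algebra_simps)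
    qed
  qed (simp add: dualD(2)[OF f] dualD(2)[OF g])
qed

lemma dual_norm_eq_0:
  assumes F: "mat_in V' n n F"
  shows "N' n F = 0 \<longleftrightarrow> (\<forall>r<n. \<forall>s<n. F r s = 0)"
proof
  assume z: "N' n F = 0"
  show "\<forall>r<n. \<forall>s<n. F r s = 0"
  proof (intro allI impI ext)
    fix r s x assume rs: "r < n" "s < n"
    show "F r s x = 0 x"
    proof (cases "x \<in> V")
      case True
      let ?c = "\<lambda>r (i::nat) r'. if r' = r then 1 else (0::complex)"
      have "cmod (pform 1 n (?c r) F (\<lambda>_ _. x) (?c s)) \<le> 0"
        using dual_norm_pairing[OF F, of 1 "\<lambda>_ _. x"] True z by (simp add: mat_in_def)
      moreover have "pform 1 n (?c r) F (\<lambda>_ _. x) (?c s) = F r s x"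
        using sum_delta2[OF rs, of "\<lambda>r s. F r s x"] by (simp add: bform_def)
      ultimately show ?thesis by simp
    next
      case False
      thus ?thesis using dualD(2) F rs by (auto simp: mat_in_def)
    qed
  qed
next
  assume z: "\<forall>r<n. \<forall>s<n. F r s = 0"
  have "N' n F \<le> 0"
    by (rule dual_norm_least) (auto simp: bform_def z)
  thus "N' n F = 0" using dual_norm_nonneg[OF F] by linarith
qed

lemma dual_norm_triangle:
  assumes F: "mat_in V' n n F" and G: "mat_in V' n n G"
  shows "N' n (\<lambda>i j. F i j + G i j) \<le> N' n F + N' n G"
proof (rule dual_norm_least)
  show "0 \<le> N' n F + N' n G" using dual_norm_nonneg F G by simp
  fix k x c d assume x: "mat_in V k k x" "N k x \<le> 1" and cd: "mnorm2 k n c \<le> 1" "mnorm2 k n d \<le> 1"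
  have "pform k n c (\<lambda>i j. F i j + G i j) x d = pform k n c F x d + pform k n c G x d"
    unfolding bform_def by (simp add: algebra_simps sum.distrib)
  hence "cmod (pform k n c (\<lambda>i j. F i j + G i j) x d) \<le> cmod (pform k n c F x d) + cmod (pform k n c G x d)"
    by (simp add: norm_triangle_ineq)
  with dual_norm_pairing_unit[OF F x cd] dual_norm_pairing_unit[OF G x cd] show "cmod (pform k n c (\<lambda>i
      j. F i j + G i j) x d) \<le> N' n F + N' n G" by simp
qed

lemma mat_mult3_apply: "mat_mult3 \<alpha> n F \<beta> r s x = (\<Sum>k<n. \<Sum>l<n. \<alpha> r k * \<beta> l s * F k l x)"
  by (simp add: mat_mult3_def cscale_fun_def sum_fun_apply)

lemma dual_norm_ruan:
  assumes F: "mat_in V' n n F"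
  shows "N' m (mat_mult3 \<alpha> n F \<beta>) \<le> cmat_norm m n \<alpha> * N' n F * cmat_norm n m \<beta>"
proof (rule dual_norm_least)
  let ?A = "cmat_norm m n \<alpha>" and ?B = "cmat_norm n m \<beta>"
  show "0 \<le> ?A * N' n F * ?B" using dual_norm_nonneg[OF F] by (simp add: cmat_norm_nonneg)
  fix k x c d assume x: "mat_in V k k x" "N k x \<le> 1" and cd: "mnorm2 k m c \<le> 1" "mnorm2 k m d \<le> 1"
  \<comment> \<open>The scalar matrices are absorbed into the two test vectors, whose norms grow by
    at most \<open>?A\<close> and \<open>?B\<close>.\<close>
  define c' where "c' = (\<lambda>i s. \<Sum>r<m. c i r * \<alpha> r s)"
  define d' where "d' = (\<lambda>j t. \<Sum>u<m. \<beta> t u * d j u)"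
  have "mnorm2 k n c' \<le> (\<Sum>i<k. ?A\<^sup>2 * vnorm2 m (c i))"
    unfolding c'_def by (intro sum_mono cmat_norm_apply_transpose)
  also have "\<dots> \<le> ?A\<^sup>2" using cd by (simp add: sum_distrib_left[symmetric] mult_left_le)
  finally have c': "sqrt (mnorm2 k n c') \<le> ?A" by (intro real_le_lsqrt cmat_norm_nonneg) auto
  have "mnorm2 k n d' \<le> (\<Sum>i<k. ?B\<^sup>2 * vnorm2 m (d i))"
    unfolding d'_def by (intro sum_mono cmat_norm_apply)
  also have "\<dots> \<le> ?B\<^sup>2" using cd by (simp add: sum_distrib_left[symmetric] mult_left_le)
  finally have d': "sqrt (mnorm2 k n d') \<le> ?B" by (intro real_le_lsqrt cmat_norm_nonneg) auto
  have "pform k m c (mat_mult3 \<alpha> n F \<beta>) x d = pform k n c' F x d'"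
  proof -
    have "pform k m c (mat_mult3 \<alpha> n F \<beta>) x d = (\<Sum>i<k. \<Sum>j<k. \<Sum>r<m. \<Sum>t<m. \<Sum>s<n. \<Sum>u<n. c i r * \<alpha> r s * F s
        u (x i j) * \<beta> u t * d j t)"
      unfolding bform_def mat_mult3_apply sum_distrib_left sum_distrib_right
      by (rule sum.cong[OF refl], subst sum.swap) (simp add: mult_ac)
    also have "\<dots> = (\<Sum>i<k. \<Sum>j<k. \<Sum>s<n. \<Sum>u<n. \<Sum>r<m. \<Sum>t<m. c i r * \<alpha> r s * F s u (x i j) * \<beta> u t * d j t)"
    proof (rule sum.cong[OF refl], rule sum.cong[OF refl])
      fix i j
      let ?h = "\<lambda>r t s u. c i r * \<alpha> r s * F s u (x i j) * \<beta> u t * d j t"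
      have "(\<Sum>r<m. \<Sum>t<m. \<Sum>s<n. \<Sum>u<n. ?h r t s u) = (\<Sum>r<m. \<Sum>s<n. \<Sum>t<m. \<Sum>u<n. ?h r t s u)"
        by (rule sum.cong[OF refl], rule sum.swap)
      also have "\<dots> = (\<Sum>s<n. \<Sum>u<n. \<Sum>r<m. \<Sum>t<m. ?h r t s u)" by (rule sum_swap4)
      finally show "(\<Sum>r<m. \<Sum>t<m. \<Sum>s<n. \<Sum>u<n. ?h r t s u) = (\<Sum>s<n. \<Sum>u<n. \<Sum>r<m. \<Sum>t<m. ?h r t s u)" .
    qed
    also have "\<dots> = (\<Sum>i<k. \<Sum>j<k. \<Sum>s<n. \<Sum>u<n. c' i s * F s u (x i j) * d' j u)"
      unfolding c'_def d'_def by (simp add: sum_distrib_left sum_distrib_right mult_ac)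
    also have "\<dots> = pform k n c' F x d'"
      unfolding bform_def by (rule sum.cong[OF refl], rule sum.swap)
    finally show ?thesis .
  qed
  hence "cmod (pform k m c (mat_mult3 \<alpha> n F \<beta>) x d) \<le> N' n F * sqrt (mnorm2 k n c') * sqrt (mnorm2 k n d')"
    using dual_norm_pairing1[OF F x] by simp
  also have "\<dots> \<le> N' n F * ?A * ?B"
    using dual_norm_nonneg[OF F] c' d' by (intro mult_mono) (auto simp: cmat_norm_nonneg mnorm2_nonneg)
  finally show "cmod (pform k m c (mat_mult3 \<alpha> n F \<beta>) x d) \<le> ?A * N' n F * ?B" by (simp add: mult_ac)
qed

lemma pform_dsum:
  "pform k (n + m) c (mat_dsum n F G) x d =
     pform k n c F x d + pform k m (\<lambda>i r. c i (n + r)) G x (\<lambda>i r. d i (n + r))"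
  unfolding bform_def by (simp add: sum_lessThan_add mat_dsum_def sum.distrib)

lemma dual_norm_dsum:
  assumes F: "mat_in V' n n F" and G: "mat_in V' m m G"
  shows "N' (n + m) (mat_dsum n F G) = max (N' n F) (N' m G)"
proof (rule antisym)
  let ?M = "max (N' n F) (N' m G)"
  have M: "0 \<le> ?M" using dual_norm_nonneg[OF F] by simp
  have FG: "mat_in V' (n + m) (n + m) (mat_dsum n F G)"
    using F G dual_csubspace by (auto simp: mat_in_def mat_dsum_def csubspace_def)
  show "N' (n + m) (mat_dsum n F G) \<le> ?M"
  proof (rule dual_norm_least[OF M])
    fix k x c d assume x: "mat_in V k k x" "N k x \<le> 1"
      and cd: "mnorm2 k (n + m) c \<le> 1" "mnorm2 k (n + m) d \<le> 1"
    define c2 where "c2 = (\<lambda>i r. c i (n + r))"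
    define d2 where "d2 = (\<lambda>i r. d i (n + r))"
    have split: "mnorm2 k (n + m) c = mnorm2 k n c + mnorm2 k m c2" "mnorm2 k (n + m) d = mnorm2 k n d +
        mnorm2 k m d2"
      unfolding c2_def d2_def by (simp_all add: sum_lessThan_add sum.distrib)
    \<comment> \<open>The two blocks see orthogonal pieces of \<open>c\<close> and \<open>d\<close>;
      this is Cauchy-Schwarz for the pairs of their norms, through the arithmetic-geometric
      mean.\<close>
    have am: "sqrt a * sqrt b \<le> (a + b) / 2" if "0 \<le> a" "0 \<le> b" for a b :: real
      using arith_geo_mean_sqrt[OF that] by (simp add: real_sqrt_mult)
    have "cmod (pform k (n + m) c (mat_dsum n F G) x d) \<le> cmod (pform k n c F x d) + cmod (pform k m c2
        G x d2)"
      unfolding pform_dsum c2_def d2_def by (rule norm_triangle_ineq)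
    also have "\<dots> \<le> N' n F * sqrt (mnorm2 k n c) * sqrt (mnorm2 k n d) + N' m G * sqrt (mnorm2 k m c2) *
        sqrt (mnorm2 k m d2)"
      by (intro add_mono dual_norm_pairing1 F G x)
    also have "\<dots> \<le> ?M * (sqrt (mnorm2 k n c) * sqrt (mnorm2 k n d)) + ?M * (sqrt (mnorm2 k m c2) * sqrt
        (mnorm2 k m d2))"
      unfolding mult.assoc by (intro add_mono mult_right_mono) (auto simp: mnorm2_nonneg)
    also have "\<dots> \<le> ?M * ((mnorm2 k n c + mnorm2 k n d) / 2) + ?M * ((mnorm2 k m c2 + mnorm2 k m d2) / 2)"
      by (intro add_mono mult_left_mono am M mnorm2_nonneg)
    also have "\<dots> = ?M * ((mnorm2 k (n + m) c + mnorm2 k (n + m) d) / 2)"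
      unfolding split by (simp add: algebra_simps add_divide_distrib)
    also have "\<dots> \<le> ?M * 1" using cd by (intro mult_left_mono M) auto
    finally show "cmod (pform k (n + m) c (mat_dsum n F G) x d) \<le> ?M" by simp
  qed
  show "?M \<le> N' (n + m) (mat_dsum n F G)"
  proof (rule max.boundedI)
    show "N' n F \<le> N' (n + m) (mat_dsum n F G)"
    proof (rule dual_norm_least[OF dual_norm_nonneg[OF FG]])
      fix k x c d assume x: "mat_in V k k x" "N k x \<le> 1" and cd: "mnorm2 k n c \<le> 1" "mnorm2 k n d \<le> 1"
      \<comment> \<open>Padded by zeros, the test vectors see only the first block; the second block
        is treated alike.\<close>
      define e where "e = (\<lambda>(c::nat \<Rightarrow> nat \<Rightarrow> complex) i r. if r < n then c i r else 0)"
      have e: "mnorm2 k (n + m) (e c) = mnorm2 k n c" for c by (simp add: e_def sum_lessThan_add)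
      have "cmod (pform k (n + m) (e c) (mat_dsum n F G) x (e d)) \<le> N' (n + m) (mat_dsum n F G)"
        by (rule dual_norm_pairing_unit[OF FG x]) (simp_all only: e cd)
      also have "pform k (n + m) (e c) (mat_dsum n F G) x (e d) = pform k n c F x d"
        unfolding pform_dsum by (simp add: bform_def e_def)
      finally show "cmod (pform k n c F x d) \<le> N' (n + m) (mat_dsum n F G)" .
    qed
    show "N' m G \<le> N' (n + m) (mat_dsum n F G)"
    proof (rule dual_norm_least[OF dual_norm_nonneg[OF FG]])
      fix k x c d assume x: "mat_in V k k x" "N k x \<le> 1" and cd: "mnorm2 k m c \<le> 1" "mnorm2 k m d \<le> 1"
      define e where "e = (\<lambda>(c::nat \<Rightarrow> nat \<Rightarrow> complex) i r. if r < n then 0 else c i (r - n))"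
      have e: "mnorm2 k (n + m) (e c) = mnorm2 k m c" for c by (simp add: e_def sum_lessThan_add)
      have "cmod (pform k (n + m) (e c) (mat_dsum n F G) x (e d)) \<le> N' (n + m) (mat_dsum n F G)"
        by (rule dual_norm_pairing_unit[OF FG x]) (simp_all only: e cd)
      also have "pform k (n + m) (e c) (mat_dsum n F G) x (e d) = pform k m c G x d"
        unfolding pform_dsum by (simp add: bform_def e_def)
      finally show "cmod (pform k m c G x d) \<le> N' (n + m) (mat_dsum n F G)" .
    qed
  qed
qed

theorem dual_operator_space: "operator_space V' N'"
  unfolding operator_space_def
proof (intro conjI allI impI; (elim conjE)?)
  show "csubspace V'" by (rule dual_csubspace)
  show "N' n x = N' n y" if "\<forall>i<n. \<forall>j<n. x i j = y i j" for n x y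
    using that by (intro dual_norm_cong) auto
  fix n m x y assume x: "mat_in V' n n x"
  show "0 \<le> N' n x" by (rule dual_norm_nonneg[OF x])
  show "(N' n x = 0) = (\<forall>i<n. \<forall>j<n. x i j = 0)" by (rule dual_norm_eq_0[OF x])
  show "N' m (mat_mult3 \<alpha> n x \<beta>) \<le> cmat_norm m n \<alpha> * N' n x * cmat_norm n m \<beta>" for \<alpha> \<beta>
    by (rule dual_norm_ruan[OF x])
  show "N' n (\<lambda>i j. x i j + y i j) \<le> N' n x + N' n y" if "mat_in V' n n y"
    by (rule dual_norm_triangle[OF x that])
  show "N' (n + m) (mat_dsum n x y) = max (N' n x) (N' m y)" if "mat_in V' m m y"
    by (rule dual_norm_dsum[OF x that])
qed

end

text \<open>Transport of structure. It places a copy of the dual in the type over which the theorem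
  quantifies.\<close>

lemma operator_space_copy:
  fixes V :: "'a::cvec set" and J :: "'a \<Rightarrow> 'b::cvec"
  assumes op: "operator_space V N" and J: "lin_on V J" and J': "\<And>x. x \<in> V \<Longrightarrow> J' (J x) = x"
  shows "operator_space (J ` V) (\<lambda>n y. N n (\<lambda>i j. J' (y i j)))"
proof -
  interpret opspace V N by unfold_locales (rule op)
  note Jadd = lin_onD(1)[OF J] and Jscl = lin_onD(2)[OF J]
  have J0: "J 0 = 0" by (rule lin_on_zero[OF J csub])
  have J'in: "J' y \<in> V" if "y \<in> J ` V" for y using that J' by auto
  have J'0: "J' 0 = 0" using J'[OF zero_in] J0 by simp
  have J'eq0: "J' y = 0 \<longleftrightarrow> y = 0" if "y \<in> J ` V" for y
    using that J0 J' J'0 by auto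
  have J'add: "J' (y + z) = J' y + J' z" if "y \<in> J ` V" "z \<in> J ` V" for y z
    using that J' Jadd add_in by (metis (no_types, lifting) imageE)
  have J'scl: "J' (cscale c y) = cscale c (J' y)" if "y \<in> J ` V" for c y
    using that J' Jscl scale_in by (metis (no_types, lifting) imageE)
  have sJ: "csubspace (J ` V)"
    unfolding csubspace_def
  proof (intro conjI ballI allI)
    show "0 \<in> J ` V" using zero_in J0 by force
    show "y + z \<in> J ` V" if yz: "y \<in> J ` V" "z \<in> J ` V" for y z
      using yz Jadd add_in by (metis (no_types, lifting) imageE imageI)
    show "cscale c y \<in> J ` V" if "y \<in> J ` V" for c y
      using that Jscl scale_in by (metis (no_types, lifting) imageE imageI)
  qed
  have "lin_on (J ` V) J'" using J'add J'scl by (simp add: lin_on_def)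
  note J'sum = lin_on_sum[OF this sJ]
  have M: "mat_in V n n (\<lambda>i j. J' (y i j))" if "mat_in (J ` V) n n y" for n y
    using that J'in by (simp add: mat_in_def)
  show ?thesis
    unfolding operator_space_def
  proof (intro conjI allI impI; (elim conjE)?)
    show "csubspace (J ` V)" by (rule sJ)
  next
    fix n :: nat and x y :: "nat \<Rightarrow> nat \<Rightarrow> 'b" assume "\<forall>i<n. \<forall>j<n. x i j = y i j"
    thus "N n (\<lambda>i j. J' (x i j)) = N n (\<lambda>i j. J' (y i j))" by (intro N_cong) auto
  next
    fix n x assume x: "mat_in (J ` V) n n x"
    show "0 \<le> N n (\<lambda>i j. J' (x i j))" by (rule N_nonneg[OF M[OF x]])
    show "(N n (\<lambda>i j. J' (x i j)) = 0) = (\<forall>i<n. \<forall>j<n. x i j = 0)"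
      unfolding N_eq_0[OF M[OF x]] using x J'eq0 by (auto simp: mat_in_def)
  next
    fix n x y assume x: "mat_in (J ` V) n n x" and y: "mat_in (J ` V) n n y"
    have "N n (\<lambda>i j. J' (x i j + y i j)) = N n (\<lambda>i j. J' (x i j) + J' (y i j))"
      using x y by (intro N_cong J'add) (auto simp: mat_in_def)
    thus "N n (\<lambda>i j. J' (x i j + y i j)) \<le> N n (\<lambda>i j. J' (x i j)) + N n (\<lambda>i j. J' (y i j))"
      using N_triangle[OF M[OF x] M[OF y]] by simp
  next
    fix m n \<alpha> x \<beta> assume x: "mat_in (J ` V) n n x"
    have "J' (mat_mult3 \<alpha> n x \<beta> i j) = mat_mult3 \<alpha> n (\<lambda>i j. J' (x i j)) \<beta> i j" for i j
    proof -
      have xin: "k < n \<Longrightarrow> l < n \<Longrightarrow> x k l \<in> J ` V" for k l using x by (simp add: mat_in_def)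
      have sc: "c \<in> J ` V \<Longrightarrow> cscale a c \<in> J ` V" for a c using sJ unfolding csubspace_def by blast
      have "J' (mat_mult3 \<alpha> n x \<beta> i j) = (\<Sum>k<n. J' (\<Sum>l<n. cscale (\<alpha> i k * \<beta> l j) (x k l)))"
        unfolding mat_mult3_def
        by (intro J'sum cv.subspace_sum sc xin) (use sJ in \<open>auto simp: csubspace_iff_subspace\<close>)
      also have "\<dots> = (\<Sum>k<n. \<Sum>l<n. J' (cscale (\<alpha> i k * \<beta> l j) (x k l)))"
        by (rule sum.cong[OF refl], rule J'sum) (auto intro!: sc xin)
      also have "\<dots> = mat_mult3 \<alpha> n (\<lambda>i j. J' (x i j)) \<beta> i j"
        unfolding mat_mult3_def by (intro sum.cong refl J'scl xin) auto
      finally show ?thesis .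
    qed
    thus "N m (\<lambda>i j. J' (mat_mult3 \<alpha> n x \<beta> i j)) \<le> cmat_norm m n \<alpha> * N n (\<lambda>i j. J' (x i j)) * cmat_norm n m \<beta>"
      using N_ruan[OF M[OF x]] by simp
  next
    fix n m x y assume x: "mat_in (J ` V) n n x" and y: "mat_in (J ` V) m m y"
    have "(\<lambda>i j. J' (mat_dsum n x y i j)) = mat_dsum n (\<lambda>i j. J' (x i j)) (\<lambda>i j. J' (y i j))"
      by (intro ext) (simp add: mat_dsum_def J'0)
    thus "N (n + m) (\<lambda>i j. J' (mat_dsum n x y i j)) = max (N n (\<lambda>i j. J' (x i j))) (N m (\<lambda>i j. J' (y i j)))"
      using N_dsum[OF M[OF x] M[OF y]] by simp
  qed
qed

section \<open>Factorisations defining the projective norm\<close>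

lemma sum_lessThan_mult2:
  fixes H :: "nat \<Rightarrow> nat \<Rightarrow> nat \<Rightarrow> nat \<Rightarrow> 'b::comm_monoid_add"
  shows "(\<Sum>c<p * q. \<Sum>d<p * q. H (c div q) (c mod q) (d div q) (d mod q)) =
    (\<Sum>i<p. \<Sum>k<q. \<Sum>j<p. \<Sum>l<q. H i k j l)"
  by (subst sum_lessThan_mult[symmetric], rule sum.cong[OF refl], subst sum_lessThan_mult[symmetric]) simp

lemma cmat_norm_least_transpose:
  assumes "\<And>v. (\<Sum>j<n. (cmod (\<Sum>i<m. v i * a i j))\<^sup>2) \<le> t\<^sup>2 * vnorm2 m v" "0 \<le> t"
  shows "cmat_norm m n a \<le> t"
proof (rule cmat_norm_least_bilinear)
  fix c d assume c: "vnorm2 m c \<le> 1" and d: "vnorm2 n d \<le> 1"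
  have "cmod (\<Sum>i<m. \<Sum>j<n. c i * a i j * d j) = cmod (\<Sum>j<n. (\<Sum>i<m. c i * a i j) * d j)"
    by (subst sum.swap) (simp add: sum_distrib_right)
  also have "\<dots> \<le> sqrt (\<Sum>j<n. (cmod (\<Sum>i<m. c i * a i j))\<^sup>2) * sqrt (vnorm2 n d)"
    by (rule cmod_sum_mult_le)
  also have "\<dots> \<le> sqrt (t\<^sup>2 * vnorm2 m c) * sqrt (vnorm2 n d)"
    by (intro mult_right_mono real_sqrt_le_mono assms) (simp add: sum_nonneg)
  also have "\<dots> = t * sqrt (vnorm2 m c) * sqrt (vnorm2 n d)" using assms(2) by (simp add: real_sqrt_mult)
  also have "\<dots> \<le> t * 1 * 1" using c d assms(2) by (intro mult_mono) (auto simp: vnorm2_nonneg)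
  finally show "cmod (\<Sum>i<m. \<Sum>j<n. c i * a i j * d j) \<le> t" by simp
qed (fact assms)

text \<open>The factorisation behind \<open>proj_q\<close> with its double index unflattened. The
  matrix \<open>b\<close> carries its outer index first, so that both outer factors have the same
  shape and \<open>rowsq\<close> applies to either.\<close>

definition proj_rep :: "'a::cvec set \<Rightarrow> 'a set \<Rightarrow> 'b::cvec set \<Rightarrow> 'b set \<Rightarrow> nat \<Rightarrow>
    (nat \<Rightarrow> nat \<Rightarrow> (('a \<Rightarrow> complex) \<times> ('b \<Rightarrow> complex) \<Rightarrow> complex)) \<Rightarrow> nat \<Rightarrow> nat \<Rightarrow>
    (nat \<Rightarrow> nat \<Rightarrow> nat \<Rightarrow> complex) \<Rightarrow> (nat \<Rightarrow> nat \<Rightarrow> nat \<Rightarrow> complex) \<Rightarrow> (nat \<Rightarrow> nat \<Rightarrow> 'a) \<Rightarrow> (nat \<Rightarrow> nat \<Rightarrow> 'b) \<Rightarrow>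
        bool" where
  "proj_rep V K W L n u p q a b x y \<longleftrightarrow> mat_in V p p x \<and> mat_in W q q y \<and>
     (\<forall>r<n. \<forall>s<n. \<forall>f\<in>annih V K. \<forall>g\<in>annih W L.
        u r s (f, g) = (\<Sum>i<p. \<Sum>k<q. \<Sum>j<p. \<Sum>l<q. a r i k * b s j l * (f (x i j) * g (y k l))))"

text \<open>For the matrix \<open>a\<close> with row index \<open>r\<close> and column index \<open>(i, k)\<close> this is the squared norm of the row
  vector \<open>v a\<close>, without conjugation.\<close>
definition rowsq :: "nat \<Rightarrow> nat \<Rightarrow> nat \<Rightarrow> (nat \<Rightarrow> nat \<Rightarrow> nat \<Rightarrow> complex) \<Rightarrow> (nat \<Rightarrow> complex) \<Rightarrow> real" where
  "rowsq n p q a v = (\<Sum>i<p. \<Sum>k<q. (cmod (\<Sum>r<n. v r * a r i k))\<^sup>2)"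

lemma rowsq_nonneg: "0 \<le> rowsq n p q a v"
  by (simp add: rowsq_def sum_nonneg)

lemma rowsq_flatten: "rowsq n p q (\<lambda>r i k. a r (i * q + k)) v = (\<Sum>c<p * q. (cmod (\<Sum>r<n. v r * a r c))\<^sup>2)"
  unfolding rowsq_def vnorm2_unflatten ..

lemma rowsq_unflatten: "(\<Sum>c<p * q. (cmod (\<Sum>r<n. v r * a r (c div q) (c mod q)))\<^sup>2) = rowsq n p q a v"
  unfolding rowsq_def by (rule sum_lessThan_mult[where h = "\<lambda>i k. (cmod (\<Sum>r<n. v r * a r i k))\<^sup>2"])

lemma rowsq_scale: "rowsq n p q (\<lambda>r i k. z * a r i k) v = (cmod z)\<^sup>2 * rowsq n p q a v"
proof -
  have e: "(\<Sum>r<n. v r * (z * a r i k)) = z * (\<Sum>r<n. v r * a r i k)" for i k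
    by (simp add: sum_distrib_left mult_ac)
  show ?thesis by (simp only: rowsq_def e norm_mult power_mult_distrib sum_distrib_left[symmetric])
qed

lemma rowsq_bounded: "\<exists>\<alpha>\<ge>0. \<forall>v. rowsq n p q a v \<le> \<alpha>\<^sup>2 * vnorm2 n v"
proof (intro exI[of _ "cmat_norm n (p * q) (\<lambda>r c. a r (c div q) (c mod q))"] conjI allI cmat_norm_nonneg)
  fix v show "rowsq n p q a v \<le> (cmat_norm n (p * q) (\<lambda>r c. a r (c div q) (c mod q)))\<^sup>2 * vnorm2 n v"
    unfolding rowsq_unflatten[symmetric] by (rule cmat_norm_apply_transpose)
qed

lemma annihD:
  assumes "f \<in> annih V K"
  shows "lin_on V f" "x \<notin> V \<Longrightarrow> f x = 0" "k \<in> K \<Longrightarrow> f k = 0"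
  using assms by (auto simp: annih_def alg_dual_def)

lemma annih_zero: "csubspace V \<Longrightarrow> annih V {0} = alg_dual V"
  by (auto simp: annih_def alg_dual_def lin_on_zero)

context opspace
begin

lemma quot_norm_bdd:
  assumes "K \<subseteq> V" "mat_in V p p x"
  shows "bdd_below {N p (\<lambda>i j. x i j + k i j) | k. mat_in K p p k}"
proof (rule bdd_belowI, clarify)
  fix k assume "mat_in K p p k"
  thus "0 \<le> N p (\<lambda>i j. x i j + k i j)" using assms
    by (intro N_nonneg) (auto simp: mat_in_def intro!: add_in)
qed

lemma quot_norm_nonneg:
  assumes "csubspace K" "K \<subseteq> V" "mat_in V p p x"
  shows "0 \<le> quot_norm V N K p x"
  unfolding quot_norm_def
proof (rule cInf_greatest)
  show "{N p (\<lambda>i j. x i j + k i j) | k. mat_in K p p k} \<noteq> {}"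
    using assms by (auto simp: mat_in_def csubspace_def intro!: exI[of _ "\<lambda>_ _. 0"])
  fix e assume "e \<in> {N p (\<lambda>i j. x i j + k i j) | k. mat_in K p p k}"
  then obtain k where k: "mat_in K p p k" "e = N p (\<lambda>i j. x i j + k i j)" by blast
  have "mat_in V p p (\<lambda>i j. x i j + k i j)" using assms k by (auto simp: mat_in_def intro!: add_in)
  thus "0 \<le> e" unfolding k by (rule N_nonneg)
qed

lemma quot_norm_le:
  assumes "csubspace K" "K \<subseteq> V" "mat_in V p p x"
  shows "quot_norm V N K p x \<le> N p x"
  unfolding quot_norm_def
  by (rule cInf_lower[OF _ quot_norm_bdd[OF assms(2,3)]])
     (use assms in \<open>auto simp: mat_in_def csubspace_def intro!: exI[of _ "\<lambda>_ _. 0"]\<close>)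

text \<open>A representative of norm below \<open>s\<close> is rescaled into the unit ball.
  Functionals in the annihilator see only the class of \<open>x\<close>, so just the factor
  \<open>s\<close> remains.\<close>

lemma quot_norm_approx:
  assumes K: "csubspace K" "K \<subseteq> V" and x: "mat_in V p p x" and s: "quot_norm V N K p x < s"
  obtains x' where "mat_in V p p x'" "N p x' \<le> 1"
    "\<And>f i j. f \<in> annih V K \<Longrightarrow> i < p \<Longrightarrow> j < p \<Longrightarrow> f (x i j) = s * f (x' i j)"
proof -
  have s0: "s > 0" using quot_norm_nonneg[OF K x] s by linarith
  have ne: "{N p (\<lambda>i j. x i j + k i j) | k. mat_in K p p k} \<noteq> {}"
    using K by (auto simp: mat_in_def csubspace_def intro!: exI[of _ "\<lambda>_ _. 0"])
  from cInf_lessD[OF ne s[unfolded quot_norm_def]]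
  obtain k where k: "mat_in K p p k" "N p (\<lambda>i j. x i j + k i j) < s" by blast
  have xk: "mat_in V p p (\<lambda>i j. x i j + k i j)"
    using x k K by (auto simp: mat_in_def intro!: add_in)
  show thesis
  proof
    let ?x' = "\<lambda>i j. cscale (of_real (inverse s)) (x i j + k i j)"
    show "mat_in V p p ?x'" using xk by (auto simp: mat_in_def intro!: scale_in)
    have "N p ?x' \<le> cmod (of_real (inverse s)) * N p (\<lambda>i j. x i j + k i j)" by (rule N_scale[OF xk])
    also have "\<dots> = inverse s * N p (\<lambda>i j. x i j + k i j)" using s0 by (simp add: norm_inverse)
    also have "\<dots> \<le> inverse s * s" using s0 k(2) by (intro mult_left_mono) auto
    finally show "N p ?x' \<le> 1" using s0 by simp
    fix f i j assume f: "f \<in> annih V K" and ij: "i < p" "j < p"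
    have in': "x i j \<in> V" "k i j \<in> K" "k i j \<in> V" using x k K ij by (auto simp: mat_in_def)
    show "f (x i j) = s * f (?x' i j)"
    proof -
      have "f (?x' i j) = inverse s * f (x i j + k i j)"
        using lin_onD(2)[OF annihD(1)[OF f] add_in[OF in'(1,3)]] by simp
      also have "f (x i j + k i j) = f (x i j)"
        using lin_onD(1)[OF annihD(1)[OF f] in'(1,3)] annihD(3)[OF f in'(2)] by simp
      finally show ?thesis using s0 by simp
    qed
  qed
qed

end

section \<open>Factorisations over a pair of quotients\<close>

locale opspaces = V: opspace V N + W: opspace W M
  for V :: "'a::cvec set" and N and W :: "'b::cvec set" and M

locale opspace_pair = opspaces V N W M
  for V :: "'a::cvec set" and N and W :: "'b::cvec set" and M +
  fixes K L
  assumes K: "csubspace K" "K \<subseteq> V" and L: "csubspace L" "L \<subseteq> W"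
begin

abbreviation "pset n u \<equiv> {cmat_norm n (p * q) a * quot_norm V N K p x * quot_norm W M L q y * cmat_norm
    (p * q) n b
      | p q a b x y. mat_in V p p x \<and> mat_in W q q y \<and>
        (\<forall>r<n. \<forall>s<n. \<forall>f\<in>annih V K. \<forall>g\<in>annih W L.
           u r s (f, g) = (\<Sum>c<p * q. \<Sum>d<p * q.
              a r c * b d s * (f (x (c div q) (d div q)) * g (y (c mod q) (d mod q)))))}"

lemma pset_bdd: "bdd_below (pset n u)"
proof (rule bdd_belowI, clarify)
  fix p q a b x y assume "mat_in V p p x" "mat_in W q q y"
  thus "0 \<le> cmat_norm n (p * q) a * quot_norm V N K p x * quot_norm W M L q y * cmat_norm (p * q) n b"
    using V.quot_norm_nonneg[OF K] W.quot_norm_nonneg[OF L] by (simp add: cmat_norm_nonneg)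
qed

lemma pset_memI:
  assumes rep: "proj_rep V K W L n u p q a b x y"
  shows "cmat_norm n (p * q) (\<lambda>r c. a r (c div q) (c mod q)) * quot_norm V N K p x * quot_norm W M L q y *
     cmat_norm (p * q) n (\<lambda>d s. b s (d div q) (d mod q)) \<in> pset n u"
proof -
  have "(\<Sum>c<p * q. \<Sum>d<p * q. a r (c div q) (c mod q) * b s (d div q) (d mod q) *
            (f (x (c div q) (d div q)) * g (y (c mod q) (d mod q)))) =
        (\<Sum>i<p. \<Sum>k<q. \<Sum>j<p. \<Sum>l<q. a r i k * b s j l * (f (x i j) * g (y k l)))" for r s f g
    by (rule sum_lessThan_mult2[where H = "\<lambda>i k j l. a r i k * b s j l * (f (x i j) * g (y k l))"])
  thus ?thesis using rep unfolding proj_rep_def by (intro CollectI exI conjI refl) auto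
qed

lemma proj_q_le:
  assumes rep: "proj_rep V K W L n u p q a b x y" and xy: "N p x \<le> 1" "M q y \<le> 1"
    and \<alpha>: "0 \<le> \<alpha>" "\<And>v. rowsq n p q a v \<le> \<alpha>\<^sup>2 * vnorm2 n v"
    and \<beta>: "0 \<le> \<beta>" "\<And>v. rowsq n p q b v \<le> \<beta>\<^sup>2 * vnorm2 n v"
  shows "proj_q V N K W M L n u \<le> \<alpha> * \<beta>"
proof -
  have x: "mat_in V p p x" and y: "mat_in W q q y" using rep by (auto simp: proj_rep_def)
  have a: "cmat_norm n (p * q) (\<lambda>r c. a r (c div q) (c mod q)) \<le> \<alpha>"
    by (rule cmat_norm_least_transpose) (simp_all only: rowsq_unflatten \<alpha>)
  have b: "cmat_norm (p * q) n (\<lambda>d s. b s (d div q) (d mod q)) \<le> \<beta>"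
  proof (rule cmat_norm_least)
    fix v assume v: "vnorm2 n v \<le> 1"
    have "(\<Sum>i<p * q. (cmod (\<Sum>j<n. b j (i div q) (i mod q) * v j))\<^sup>2) = rowsq n p q b v"
      by (simp add: mult.commute[of "b _ _ _"] rowsq_unflatten)
    also have "\<dots> \<le> \<beta>\<^sup>2 * vnorm2 n v" by (rule \<beta>)
    also have "\<dots> \<le> \<beta>\<^sup>2" using v by (simp add: mult_left_le)
    finally show "(\<Sum>i<p * q. (cmod (\<Sum>j<n. b j (i div q) (i mod q) * v j))\<^sup>2) \<le> \<beta>\<^sup>2" .
  qed (rule \<beta>)
  have qx: "quot_norm V N K p x \<le> 1" using V.quot_norm_le[OF K x] xy by simp
  have qy: "quot_norm W M L q y \<le> 1" using W.quot_norm_le[OF L y] xy by simp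
  have "proj_q V N K W M L n u \<le> cmat_norm n (p * q) (\<lambda>r c. a r (c div q) (c mod q)) * quot_norm V N K p x
      * quot_norm W M L q y * cmat_norm (p * q) n (\<lambda>d s. b s (d div q) (d mod q))"
    unfolding proj_q_def by (rule cInf_lower[OF pset_memI[OF rep] pset_bdd])
  also have "\<dots> \<le> \<alpha> * 1 * 1 * \<beta>"
    using a b qx qy \<alpha>(1) V.quot_norm_nonneg[OF K x] W.quot_norm_nonneg[OF L y]
    by (intro mult_mono) (auto simp: cmat_norm_nonneg)
  finally show ?thesis by simp
qed

text \<open>The norms of the inner factors can be moved into the outer factor \<open>a\<close>, so a
  lower bound need only be checked for inner factors in the unit balls. Quotient norms may not be
  attained; hence the excess \<open>\<delta>\<close>, which tends to zero.\<close>

lemma proj_q_ge: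
  assumes ex: "\<exists>p q a b x y. proj_rep V K W L n u p q a b x y" and c: "0 \<le> c"
    and bound: "\<And>p q a b x y \<alpha> \<beta>. proj_rep V K W L n u p q a b x y \<Longrightarrow> N p x \<le> 1 \<Longrightarrow> M q y \<le> 1 \<Longrightarrow>
       0 \<le> \<alpha> \<Longrightarrow> (\<And>v. rowsq n p q a v \<le> \<alpha>\<^sup>2 * vnorm2 n v) \<Longrightarrow>
       0 \<le> \<beta> \<Longrightarrow> (\<And>v. rowsq n p q b v \<le> \<beta>\<^sup>2 * vnorm2 n v) \<Longrightarrow> val \<le> c * (\<alpha> * \<beta>)"
  shows "val \<le> c * proj_q V N K W M L n u"
proof -
  have ne: "pset n u \<noteq> {}"
  proof
    assume "pset n u = {}"
    moreover obtain p q a b x y where "proj_rep V K W L n u p q a b x y" using ex by (elim exE)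
    ultimately show False using pset_memI by (metis (no_types, lifting) empty_iff)
  qed
  have el: "val \<le> c * e" if "e \<in> pset n u" for e
  proof -
    from that show ?thesis
    proof (unfold mem_Collect_eq, elim exE conjE)
      fix p q a b x y assume e: "e = cmat_norm n (p * q) a * quot_norm V N K p x * quot_norm W M L q y *
          cmat_norm (p * q) n b"
        and x: "mat_in V p p x" and y: "mat_in W q q y"
        and u: "\<forall>r<n. \<forall>s<n. \<forall>f\<in>annih V K. \<forall>g\<in>annih W L.
           u r s (f, g) = (\<Sum>c<p * q. \<Sum>d<p * q.
              a r c * b d s * (f (x (c div q) (d div q)) * g (y (c mod q) (d mod q))))"
    have *: "val \<le> c * (((quot_norm V N K p x + \<delta>) * (quot_norm W M L q y + \<delta>) * cmat_norm n (p * q) a)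
        * cmat_norm (p * q) n b)"
      if \<delta>: "\<delta> > 0" for \<delta>
    proof -
      define s where "s = quot_norm V N K p x + \<delta>"
      define t where "t = quot_norm W M L q y + \<delta>"
      have st: "0 < s" "0 < t"
        using \<delta> V.quot_norm_nonneg[OF K x] W.quot_norm_nonneg[OF L y] by (auto simp: s_def t_def)
      obtain x' where x': "mat_in V p p x'" "N p x' \<le> 1"
        "\<And>f i j. f \<in> annih V K \<Longrightarrow> i < p \<Longrightarrow> j < p \<Longrightarrow> f (x i j) = complex_of_real s * f (x' i j)"
        using V.quot_norm_approx[OF K x, of s] \<delta> unfolding s_def by (metis less_add_same_cancel1)
      obtain y' where y': "mat_in W q q y'" "M q y' \<le> 1"
        "\<And>f i j. f \<in> annih W L \<Longrightarrow> i < q \<Longrightarrow> j < q \<Longrightarrow> f (y i j) = complex_of_real t * f (y' i j)"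
        using W.quot_norm_approx[OF L y, of t] \<delta> unfolding t_def by (metis less_add_same_cancel1)
      let ?a = "\<lambda>r i k. complex_of_real (s * t) * a r (i * q + k)" and ?b = "\<lambda>s j l. b (j * q + l) s"
      have rep: "proj_rep V K W L n u p q ?a ?b x' y'"
        unfolding proj_rep_def
      proof (intro conjI x' y' allI impI ballI)
        fix r s' f g assume r: "r < n" "s' < n" and fg: "f \<in> annih V K" "g \<in> annih W L"
        have "u r s' (f, g) = (\<Sum>c<p * q. \<Sum>d<p * q.
            a r (c div q * q + c mod q) * b (d div q * q + d mod q) s' * (f (x (c div q) (d div q)) * g
            (y (c mod q) (d mod q))))"
          using u r fg by simp
        also have "\<dots> = (\<Sum>i<p. \<Sum>k<q. \<Sum>j<p. \<Sum>l<q. a r (i * q + k) * b (j * q + l) s' * (f (x i j) * g (y k l)))"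
          by (rule sum_lessThan_mult2[where H = "\<lambda>i k j l. a r (i * q + k) * b (j * q + l) s' * (f (x i
            j) * g (y k l))"])
        also have "\<dots> = (\<Sum>i<p. \<Sum>k<q. \<Sum>j<p. \<Sum>l<q. ?a r i k * ?b s' j l * (f (x' i j) * g (y' k l)))"
          by (intro sum.cong refl) (simp add: x'(3)[OF fg(1)] y'(3)[OF fg(2)] mult_ac)
        finally show "u r s' (f, g) = (\<Sum>i<p. \<Sum>k<q. \<Sum>j<p. \<Sum>l<q. ?a r i k * ?b s' j l * (f (x' i j) * g
            (y' k l)))" .
      qed
      have "val \<le> c * ((s * t * cmat_norm n (p * q) a) * cmat_norm (p * q) n b)"
      proof (rule bound[OF rep x'(2) y'(2)])
        show "0 \<le> s * t * cmat_norm n (p * q) a" using st by (simp add: cmat_norm_nonneg)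
        fix v
        show "rowsq n p q ?a v \<le> (s * t * cmat_norm n (p * q) a)\<^sup>2 * vnorm2 n v"
        proof -
          have "rowsq n p q ?a v = (s * t)\<^sup>2 * (\<Sum>c<p * q. (cmod (\<Sum>r<n. v r * a r c))\<^sup>2)"
            unfolding rowsq_scale rowsq_flatten using st by (simp add: norm_mult)
          also have "\<dots> \<le> (s * t)\<^sup>2 * ((cmat_norm n (p * q) a)\<^sup>2 * vnorm2 n v)"
            by (intro mult_left_mono cmat_norm_apply_transpose) simp
          finally show ?thesis by (simp add: power_mult_distrib mult_ac)
        qed
        have "rowsq n p q ?b v = (\<Sum>c<p * q. (cmod (\<Sum>r<n. b c r * v r))\<^sup>2)"
          using rowsq_flatten[of n p q "\<lambda>r c. b c r" v] by (simp add: mult.commute)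
        also have "\<dots> \<le> (cmat_norm (p * q) n b)\<^sup>2 * vnorm2 n v" by (rule cmat_norm_apply)
        finally show "rowsq n p q ?b v \<le> (cmat_norm (p * q) n b)\<^sup>2 * vnorm2 n v" .
      qed (rule cmat_norm_nonneg)
      thus ?thesis by (simp add: s_def t_def)
    qed
    have "val \<le> c * (((quot_norm V N K p x + 0) * (quot_norm W M L q y + 0) * cmat_norm n (p * q) a) *
        cmat_norm (p * q) n b)"
    proof (rule tendsto_lowerbound)
      show "((\<lambda>\<delta>. c * (((quot_norm V N K p x + \<delta>) * (quot_norm W M L q y + \<delta>) * cmat_norm n (p * q) a) *
          cmat_norm (p * q) n b))
        \<longlongrightarrow> c * (((quot_norm V N K p x + 0) * (quot_norm W M L q y + 0) * cmat_norm n (p * q) a) *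
            cmat_norm (p * q) n b)) (at_right 0)"
        by (intro tendsto_intros)
      show "\<forall>\<^sub>F \<delta> in at_right 0. val \<le> c * (((quot_norm V N K p x + \<delta>) * (quot_norm W M L q y + \<delta>) *
          cmat_norm n (p * q) a) * cmat_norm (p * q) n b)"
        by (rule eventually_mono[OF eventually_at_right_less]) (rule *)
    qed simp
      thus ?thesis by (simp add: e mult_ac)
    qed
  qed
  show ?thesis
  proof (cases "c = 0")
    case True
    thus ?thesis using el ne by fastforce
  next
    case False
    hence "val / c \<le> Inf (pset n u)"
      using c el by (intro cInf_greatest[OF ne]) (simp add: field_simps)
    thus ?thesis unfolding proj_q_def using False c by (simp add: field_simps)
  qed
qed

end

section \<open>The separation theorem\<close>

definition tens :: "'a::cvec set \<Rightarrow> 'b::cvec set \<Rightarrow> 'a \<Rightarrow> 'b \<Rightarrow> (('a \<Rightarrow> complex) \<times> ('b \<Rightarrow> complex) \<Rightarrow> complex)" where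
  "tens V W x y = (\<lambda>(f, g). if f \<in> alg_dual V \<and> g \<in> alg_dual W then f x * g y else 0)"

lemma tensorsE:
  assumes "t \<in> tensors V W"
  obtains k :: nat and xs ys where "\<And>i. i < k \<Longrightarrow> xs i \<in> V" "\<And>i. i < k \<Longrightarrow> ys i \<in> W"
    "t = (\<Sum>i<k. tens V W (xs i) (ys i))"
proof -
  from assms obtain k :: nat and xs ys where *: "\<forall>i<k. xs i \<in> V \<and> ys i \<in> W"
    "t = (\<lambda>(f, g). if f \<in> alg_dual V \<and> g \<in> alg_dual W then (\<Sum>i<k. f (xs i) * g (ys i)) else 0)"
    by (auto simp: tensors_def)
  show thesis
  proof
    show "t = (\<Sum>i<k. tens V W (xs i) (ys i))"
      unfolding *(2) by (rule ext) (auto simp: sum_fun_apply tens_def)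
  qed (use * in auto)
qed

lemma sum_tens_in_tensors:
  fixes k :: nat
  assumes "\<And>i. i < k \<Longrightarrow> xs i \<in> V" "\<And>i. i < k \<Longrightarrow> ys i \<in> W"
  shows "(\<Sum>i<k. tens V W (xs i) (ys i)) \<in> tensors V W"
  unfolding tensors_def
proof (intro CollectI exI conjI)
  show "\<forall>i<k. xs i \<in> V \<and> ys i \<in> W" using assms by auto
  show "(\<Sum>i<k. tens V W (xs i) (ys i)) =
    (\<lambda>(f, g). if f \<in> alg_dual V \<and> g \<in> alg_dual W then \<Sum>i<k. f (xs i) * g (ys i) else 0)"
    by (rule ext) (auto simp: sum_fun_apply tens_def)
qed

lemma annih_subset: "annih V K \<subseteq> alg_dual V" by (auto simp: annih_def)

lemma tens_add_left: "x \<in> V \<Longrightarrow> x' \<in> V \<Longrightarrow> tens V W (x + x') y = tens V W x y + tens V W x' y"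
  by (rule ext) (auto simp: tens_def alg_dual_def lin_on_def algebra_simps)
lemma tens_add_right: "y \<in> W \<Longrightarrow> y' \<in> W \<Longrightarrow> tens V W x (y + y') = tens V W x y + tens V W x y'"
  by (rule ext) (auto simp: tens_def alg_dual_def lin_on_def algebra_simps)
lemma tens_scale_left: "x \<in> V \<Longrightarrow> tens V W (cscale c x) y = cscale c (tens V W x y)"
  by (rule ext) (auto simp: tens_def alg_dual_def lin_on_def cscale_fun_def algebra_simps)
lemma tens_scale_right: "y \<in> W \<Longrightarrow> tens V W x (cscale c y) = cscale c (tens V W x y)"
  by (rule ext) (auto simp: tens_def alg_dual_def lin_on_def cscale_fun_def algebra_simps)

definition unit_mat :: "nat \<Rightarrow> nat \<Rightarrow> 'z::zero \<Rightarrow> nat \<Rightarrow> nat \<Rightarrow> 'z" where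
  "unit_mat r s t = (\<lambda>r' s'. if r' = r \<and> s' = s then t else 0)"

lemma unit_mat_add: "unit_mat r s (t + t' :: 'z::cvec) = unit_mat r s t + unit_mat r s t'"
  by (intro ext) (simp add: unit_mat_def)
lemma unit_mat_scale: "unit_mat r s (cscale c t :: 'z::cvec) = cscale c (unit_mat r s t)"
  by (intro ext) (simp add: unit_mat_def cscale_fun_def)

lemma tensors_subspace:
  assumes "csubspace V" "csubspace W"
  shows "csubspace (tensors V W)"
  unfolding csubspace_def
proof (intro conjI ballI allI)
  show "0 \<in> tensors V W" using sum_tens_in_tensors[of 0 _ V _ W] by simp
  fix t assume t: "t \<in> tensors V W"
  then obtain k :: nat and xs ys where t: "\<And>i. i < k \<Longrightarrow> xs i \<in> V" "\<And>i. i < k \<Longrightarrow> ys i \<in> W"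
    "t = (\<Sum>i<k. tens V W (xs i) (ys i))" using tensorsE by blast
  show "cscale c t \<in> tensors V W" for c
  proof -
    have "cscale c t = (\<Sum>i<k. tens V W (cscale c (xs i)) (ys i))"
      unfolding t(3) cv.scale_sum_right by (intro sum.cong refl) (simp add: tens_scale_left t)
    also have "\<dots> \<in> tensors V W"
      using t assms by (intro sum_tens_in_tensors) (auto simp: csubspace_def)
    finally show ?thesis .
  qed
  fix t' assume "t' \<in> tensors V W"
  then obtain k' :: nat and xs' ys' where t': "\<And>i. i < k' \<Longrightarrow> xs' i \<in> V" "\<And>i. i < k' \<Longrightarrow> ys' i \<in> W"
    "t' = (\<Sum>i<k'. tens V W (xs' i) (ys' i))" using tensorsE by blast
  have "t + t' = (\<Sum>i<k + k'. tens V W (if i < k then xs i else xs' (i - k)) (if i < k then ys i else ys'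
      (i - k)))"
    unfolding t(3) t'(3) by (simp add: sum_lessThan_add)
  also have "\<dots> \<in> tensors V W" using t t' by (intro sum_tens_in_tensors) auto
  finally show "t + t' \<in> tensors V W" .
qed

type_synonym ('a, 'b) tmat = "nat \<Rightarrow> nat \<Rightarrow> (('a \<Rightarrow> complex) \<times> ('b \<Rightarrow> complex) \<Rightarrow> complex)"

section \<open>Factorisations as a convex cone\<close>

context opspace_pair
begin

text \<open>The outer factors enter only through their quadratic functions: these are independent of
  \<open>p\<close> and \<open>q\<close> and additive under direct sums.\<close>

definition freps :: "nat \<Rightarrow> (('a, 'b) tmat \<times> ((nat \<Rightarrow> complex) \<Rightarrow> real) \<times> ((nat \<Rightarrow> complex) \<Rightarrow> real)) set" where
  "freps n = {(u, rowsq n p q a, rowsq n p q b) | u p q a b x y.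
     proj_rep V K W L n u p q a b x y \<and> N p x \<le> 1 \<and> M q y \<le> 1}"

lemma frepsE:
  assumes "(u, A, B) \<in> freps n"
  obtains p q a b x y where "A = rowsq n p q a" "B = rowsq n p q b"
    "proj_rep V K W L n u p q a b x y" "N p x \<le> 1" "M q y \<le> 1"
  using assms by (auto simp: freps_def)

lemma frepsI:
  assumes "proj_rep V K W L n u p q a b x y" "N p x \<le> 1" "M q y \<le> 1"
    "A = rowsq n p q a" "B = rowsq n p q b"
  shows "(u, A, B) \<in> freps n"
  using assms unfolding freps_def by blast

text \<open>The empty factorisation, with \<open>p = q = 0\<close>, serves every matrix that
  vanishes in the quotient.\<close>

lemma freps_zero:
  assumes "\<And>r s f g. r < n \<Longrightarrow> s < n \<Longrightarrow> f \<in> annih V K \<Longrightarrow> g \<in> annih W L \<Longrightarrow> u r s (f, g) = 0"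
  shows "(u, 0, 0) \<in> freps n"
proof (rule frepsI)
  show "proj_rep V K W L n u 0 0 (\<lambda>_ _ _. 0) (\<lambda>_ _ _. 0) (\<lambda>_ _. 0) (\<lambda>_ _. 0)"
    using assms by (simp add: proj_rep_def mat_in_def)
qed (auto simp: V.N_zero W.N_zero rowsq_def)

lemma freps_cong:
  assumes "(u, A, B) \<in> freps n"
    "\<And>r s f g. r < n \<Longrightarrow> s < n \<Longrightarrow> f \<in> annih V K \<Longrightarrow> g \<in> annih W L \<Longrightarrow> u r s (f, g) = u' r s (f, g)"
  shows "(u', A, B) \<in> freps n"
proof -
  obtain p q a b x y where *: "A = rowsq n p q a" "B = rowsq n p q b"
    "proj_rep V K W L n u p q a b x y" "N p x \<le> 1" "M q y \<le> 1" using assms(1) by (rule frepsE)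
  show ?thesis by (rule frepsI[OF _ *(4,5,1,2)]) (use *(3) assms(2) in \<open>simp add: proj_rep_def\<close>)
qed

lemma freps_scale:
  assumes "(u, A, B) \<in> freps n"
  shows "(cscale (z * w) u, \<lambda>v. (cmod z)\<^sup>2 * A v, \<lambda>v. (cmod w)\<^sup>2 * B v) \<in> freps n"
proof -
  obtain p q a b x y where *: "A = rowsq n p q a" "B = rowsq n p q b"
    "proj_rep V K W L n u p q a b x y" "N p x \<le> 1" "M q y \<le> 1" using assms(1) by (rule frepsE)
  show ?thesis
  proof (rule frepsI[OF _ *(4,5)])
    show "proj_rep V K W L n (cscale (z * w) u) p q (\<lambda>r i k. z * a r i k) (\<lambda>r i k. w * b r i k) x y"
      using *(3) by (simp add: proj_rep_def cscale_fun_def sum_distrib_left mult_ac)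
  qed (simp_all add: * rowsq_scale fun_eq_iff)
qed

text \<open>The tensor product of the two direct sums has four diagonal blocks. \<open>J\<close>
  puts \<open>a\<close> on the block of \<open>x \<otimes> y\<close>, \<open>a'\<close> on that of
  \<open>x' \<otimes> y'\<close> and zero on the two mixed ones, so that no cross terms
  appear.\<close>

lemma freps_add:
  assumes "(u, A, B) \<in> freps n" "(u', A', B') \<in> freps n"
  shows "(u + u', A + A', B + B') \<in> freps n"
proof -
  obtain p q a b x y where *: "A = rowsq n p q a" "B = rowsq n p q b"
    "proj_rep V K W L n u p q a b x y" "N p x \<le> 1" "M q y \<le> 1" using assms(1) by (rule frepsE)
  obtain p' q' a' b' x' y' where **: "A' = rowsq n p' q' a'" "B' = rowsq n p' q' b'"
    "proj_rep V K W L n u' p' q' a' b' x' y'" "N p' x' \<le> 1" "M q' y' \<le> 1" using assms(2) by (rule frepsE)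
  define J where "J = (\<lambda>(a :: nat \<Rightarrow> nat \<Rightarrow> nat \<Rightarrow> complex) a' r i k. if i < p \<and> k < q then a r i k
     else if p \<le> i \<and> q \<le> k then a' r (i - p) (k - q) else 0)"
  have J: "i < p \<Longrightarrow> k < q \<Longrightarrow> J a a' r i k = a r i k" "i < p \<Longrightarrow> J a a' r i (q + k) = 0"
    "k < q \<Longrightarrow> J a a' r (p + i) k = 0" "J a a' r (p + i) (q + k) = a' r i k" for a a' r i k
    by (auto simp: J_def)
  have x: "mat_in V p p x" "mat_in V p' p' x'" and y: "mat_in W q q y" "mat_in W q' q' y'"
    using *(3) **(3) by (auto simp: proj_rep_def)
  have D: "i < p \<Longrightarrow> j < p \<Longrightarrow> mat_dsum p x x' i j = x i j" "i < p \<Longrightarrow> mat_dsum p x x' i (p + j) = 0"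
    "j < p \<Longrightarrow> mat_dsum p x x' (p + i) j = 0" "mat_dsum p x x' (p + i) (p + j) = x' i j" for i j
    by (auto simp: mat_dsum_def)
  have D': "i < q \<Longrightarrow> j < q \<Longrightarrow> mat_dsum q y y' i j = y i j" "i < q \<Longrightarrow> mat_dsum q y y' i (q + j) = 0"
    "j < q \<Longrightarrow> mat_dsum q y y' (q + i) j = 0" "mat_dsum q y y' (q + i) (q + j) = y' i j" for i j
    by (auto simp: mat_dsum_def)
  show ?thesis
  proof (rule frepsI)
    show "N (p + p') (mat_dsum p x x') \<le> 1" using * ** by (simp add: V.N_dsum x)
    show "M (q + q') (mat_dsum q y y') \<le> 1" using * ** by (simp add: W.N_dsum y)
    show "A + A' = rowsq n (p + p') (q + q') (J a a')" "B + B' = rowsq n (p + p') (q + q') (J b b')"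
      unfolding * ** by (simp_all add: fun_eq_iff rowsq_def sum_lessThan_add J)
    show "proj_rep V K W L n (u + u') (p + p') (q + q') (J a a') (J b b') (mat_dsum p x x') (mat_dsum q y y')"
      unfolding proj_rep_def
    proof (intro conjI allI impI ballI)
      show "mat_in V (p + p') (p + p') (mat_dsum p x x')" "mat_in W (q + q') (q + q') (mat_dsum q y y')"
        using x y V.zero_in W.zero_in by (auto simp: mat_in_def mat_dsum_def)
      fix r s f g assume r: "r < n" "s < n" and fg: "f \<in> annih V K" "g \<in> annih W L"
      have f0: "f 0 = 0" using lin_on_zero[OF annihD(1)[OF fg(1)] V.csub] .
      have g0: "g 0 = 0" using lin_on_zero[OF annihD(1)[OF fg(2)] W.csub] .
      have "(u + u') r s (f, g) = (\<Sum>i<p. \<Sum>k<q. \<Sum>j<p. \<Sum>l<q. a r i k * b s j l * (f (x i j) * g (y k l)))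
        + (\<Sum>i<p'. \<Sum>k<q'. \<Sum>j<p'. \<Sum>l<q'. a' r i k * b' s j l * (f (x' i j) * g (y' k l)))"
        using *(3) **(3) r fg by (simp add: proj_rep_def)
      also have "\<dots> = (\<Sum>i<p + p'. \<Sum>k<q + q'. \<Sum>j<p + p'. \<Sum>l<q + q'. J a a' r i k * J b b' s j l *
          (f (mat_dsum p x x' i j) * g (mat_dsum q y y' k l)))"
        by (simp add: sum_lessThan_add J D D' f0 g0)
      finally show "(u + u') r s (f, g) = (\<Sum>i<p + p'. \<Sum>k<q + q'. \<Sum>j<p + p'. \<Sum>l<q + q'. J a a' r i k * J
          b b' s j l *
          (f (mat_dsum p x x' i j) * g (mat_dsum q y y' k l)))" .
    qed
  qed
qed

lemma freps_sum:
  assumes "finite I" "\<And>i. i \<in> I \<Longrightarrow> \<exists>A B. (u i, A, B) \<in> freps n"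
  shows "\<exists>A B. (\<Sum>i\<in>I. u i, A, B) \<in> freps n"
  using assms
proof (induction I rule: finite_induct)
  case empty
  have "(0, 0, 0) \<in> freps n" by (rule freps_zero) simp
  thus ?case unfolding sum.empty by blast
next
  case (insert i I)
  then obtain A B A' B' where "(u i, A, B) \<in> freps n" "(\<Sum>i\<in>I. u i, A', B') \<in> freps n"
    by blast
  from freps_add[OF this] show ?case unfolding sum.insert[OF insert.hyps] by blast
qed

lemma freps_unit:
  assumes x: "x \<in> V" and y: "y \<in> W"
  shows "\<exists>A B. (unit_mat r s (tens V W x y), A, B) \<in> freps n"
proof -
  \<comment> \<open>Adding \<open>1\<close> avoids a division by zero when
    \<open>x = 0\<close>.\<close>
  define c where "c = N 1 (\<lambda>_ _. x) + 1"
  define d where "d = M 1 (\<lambda>_ _. y) + 1"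
  have x1: "mat_in V 1 1 (\<lambda>_ _. x)" and y1: "mat_in W 1 1 (\<lambda>_ _. y)" using x y by (auto simp: mat_in_def)
  have cd: "c > 0" "d > 0" using V.N_nonneg[OF x1] W.N_nonneg[OF y1] by (auto simp: c_def d_def)
  define x' where "x' = (\<lambda>(_::nat) (_::nat). cscale (of_real (inverse c)) x)"
  define y' where "y' = (\<lambda>(_::nat) (_::nat). cscale (of_real (inverse d)) y)"
  have "N 1 x' \<le> inverse c * (c - 1)"
    using V.N_scale[OF x1, of "of_real (inverse c)"] cd by (simp add: x'_def c_def norm_inverse)
  also have "\<dots> \<le> 1" using cd by (simp add: field_simps)
  finally have x': "N 1 x' \<le> 1" .
  have "M 1 y' \<le> inverse d * (d - 1)"
    using W.N_scale[OF y1, of "of_real (inverse d)"] cd by (simp add: y'_def d_def norm_inverse)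
  also have "\<dots> \<le> 1" using cd by (simp add: field_simps)
  finally have y': "M 1 y' \<le> 1" .
  have "proj_rep V K W L n (unit_mat r s (tens V W x y)) 1 1
     (\<lambda>r' _ _. if r' = r then of_real c else 0) (\<lambda>s' _ _. if s' = s then of_real d else 0) x' y'"
    unfolding proj_rep_def
  proof (intro conjI allI impI ballI)
    show "mat_in V 1 1 x'" "mat_in W 1 1 y'"
      using x y by (auto simp: mat_in_def x'_def y'_def intro: V.scale_in W.scale_in)
    fix r' s' f g assume fg: "f \<in> annih V K" "g \<in> annih W L"
    have "f \<in> alg_dual V" "g \<in> alg_dual W" using fg annih_subset by blast+
    thus "unit_mat r s (tens V W x y) r' s' (f, g) = (\<Sum>i<1::nat. \<Sum>k<1::nat. \<Sum>j<1::nat. \<Sum>l<1::nat.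
        (if r' = r then of_real c else 0) * (if s' = s then of_real d else 0) * (f (x' i j) * g (y' k l)))"
      using lin_onD(2)[OF annihD(1)[OF fg(1)] x] lin_onD(2)[OF annihD(1)[OF fg(2)] y] cd
      by (simp add: unit_mat_def tens_def x'_def y'_def field_simps)
  qed
  thus ?thesis using frepsI x' y' by blast
qed

lemma tmat_as_sum:
  assumes u: "mat_in (tensors V W) n n u"
  obtains k :: "nat \<Rightarrow> nat \<Rightarrow> nat" and xs ys where
    "\<And>r s i. r < n \<Longrightarrow> s < n \<Longrightarrow> i < k r s \<Longrightarrow> xs r s i \<in> V"
    "\<And>r s i. r < n \<Longrightarrow> s < n \<Longrightarrow> i < k r s \<Longrightarrow> ys r s i \<in> W"
    "\<And>r s. r < n \<Longrightarrow> s < n \<Longrightarrow> u r s = (\<Sum>i<k r s. tens V W (xs r s i) (ys r s i))"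
proof -
  let ?P = "\<lambda>r s (k :: nat, xs, ys). r < n \<longrightarrow> s < n \<longrightarrow> (\<forall>i<k. xs i \<in> V) \<and> (\<forall>i<k. ys i \<in> W) \<and>
      u r s = (\<Sum>i<k. tens V W (xs i) (ys i))"
  have "\<exists>z. ?P r s z" for r s
  proof (cases "r < n \<and> s < n")
    case True
    hence "u r s \<in> tensors V W" using u by (simp add: mat_in_def)
    then obtain k :: nat and xs ys where "\<And>i. i < k \<Longrightarrow> xs i \<in> V" "\<And>i. i < k \<Longrightarrow> ys i \<in> W"
      "u r s = (\<Sum>i<k. tens V W (xs i) (ys i))" using tensorsE by blast
    thus ?thesis by (intro exI[of _ "(k, xs, ys)"]) auto
  qed auto
  hence "\<forall>r. \<exists>zr. \<forall>s. ?P r s (zr s)" by (intro allI choice)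
  then obtain z where "\<forall>r. \<forall>s. ?P r s (z r s)" by (auto dest: choice)
  hence z: "?P r s (z r s)" for r s by (elim allE)
  show thesis
  proof (rule that[of "\<lambda>r s. fst (z r s)" "\<lambda>r s. fst (snd (z r s))" "\<lambda>r s. snd (snd (z r s))"])
    fix r s assume "r < n" "s < n"
    with z[of r s] show "u r s = (\<Sum>i<fst (z r s). tens V W (fst (snd (z r s)) i) (snd (snd (z r s)) i))"
      by (auto simp: case_prod_beta)
  next
    fix r s i assume "r < n" "s < n" "i < fst (z r s)"
    with z[of r s] show "fst (snd (z r s)) i \<in> V" "snd (snd (z r s)) i \<in> W"
      by (auto simp: case_prod_beta)
  qed
qed

lemma freps_total:
  assumes u: "mat_in (tensors V W) n n u"
  shows "\<exists>A B. (u, A, B) \<in> freps n"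
proof -
  obtain k :: "nat \<Rightarrow> nat \<Rightarrow> nat" and xs ys where k:
    "\<And>r s i. r < n \<Longrightarrow> s < n \<Longrightarrow> i < k r s \<Longrightarrow> xs r s i \<in> V"
    "\<And>r s i. r < n \<Longrightarrow> s < n \<Longrightarrow> i < k r s \<Longrightarrow> ys r s i \<in> W"
    "\<And>r s. r < n \<Longrightarrow> s < n \<Longrightarrow> u r s = (\<Sum>i<k r s. tens V W (xs r s i) (ys r s i))"
    by (rule tmat_as_sum[OF u]) (rule that)
  define u' where "u' = (\<Sum>r<n. \<Sum>s<n. \<Sum>i<k r s. unit_mat r s (tens V W (xs r s i) (ys r s i)))"
  have ex: "\<exists>A B. (u', A, B) \<in> freps n"
    unfolding u'_def by (intro freps_sum freps_unit k) auto
  have eq: "u' r s = u r s" if "r < n" "s < n" for r s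
  proof -
    have "u' r s z = (\<Sum>r'<n. \<Sum>s'<n. if s' = s then (if r' = r then u r' s' z else 0) else 0)" for z
      unfolding u'_def sum_fun_apply unit_mat_def by (intro sum.cong refl) (auto simp: k sum_fun_apply)
    thus ?thesis using that by (simp add: fun_eq_iff)
  qed
  from ex obtain A B where "(u', A, B) \<in> freps n" by (elim exE)
  hence "(u, A, B) \<in> freps n" by (rule freps_cong) (simp add: eq)
  thus ?thesis by blast
qed

lemma proj_rep_exists:
  assumes u: "mat_in (tensors V W) n n u"
  shows "\<exists>p q a b x y. proj_rep V K W L n u p q a b x y"
proof -
  obtain A B where "(u, A, B) \<in> freps n" using freps_total[OF u] by blast
  then obtain p q a b x y where "proj_rep V K W L n u p q a b x y" by (rule frepsE)
  thus ?thesis by blast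
qed

end

section \<open>Hermitian forms from functionals\<close>

text \<open>The space for the two form slots. Domination by a multiple of \<open>vnorm2\<close>
  makes the separation cone total over it; complex values turn it into a \<open>cvec\<close>, while
  the cone looks only at real parts.\<close>

definition qbounded :: "nat \<Rightarrow> ((nat \<Rightarrow> complex) \<Rightarrow> complex) set" where
  "qbounded n = {A. \<exists>c\<ge>0. \<forall>v. cmod (A v) \<le> c * vnorm2 n v}"

lemma qboundedI: "0 \<le> c \<Longrightarrow> (\<And>v. cmod (A v) \<le> c * vnorm2 n v) \<Longrightarrow> A \<in> qbounded n"
  by (auto simp: qbounded_def)

lemma qbounded_subspace: "csubspace (qbounded n)"
  unfolding csubspace_def
proof (intro conjI ballI allI)
  show "0 \<in> qbounded n" by (rule qboundedI[of 0]) auto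
  fix A assume "A \<in> qbounded n"
  then obtain c where c: "0 \<le> c" "\<And>v. cmod (A v) \<le> c * vnorm2 n v" by (auto simp: qbounded_def)
  show "cscale z A \<in> qbounded n" for z
    by (rule qboundedI[of "cmod z * c"]) (use c in \<open>auto simp: cscale_fun_def norm_mult mult.assoc
        mult_left_mono\<close>)
  fix B assume "B \<in> qbounded n"
  then obtain d where d: "0 \<le> d" "\<And>v. cmod (B v) \<le> d * vnorm2 n v" by (auto simp: qbounded_def)
  show "A + B \<in> qbounded n"
  proof (rule qboundedI)
    fix v
    have "cmod ((A + B) v) \<le> cmod (A v) + cmod (B v)" by (simp add: norm_triangle_ineq)
    thus "cmod ((A + B) v) \<le> (c + d) * vnorm2 n v" using c(2)[of v] d(2)[of v] by (simp add: distrib_right)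
  qed (use c d in auto)
qed

definition qform :: "nat \<Rightarrow> (nat \<Rightarrow> nat \<Rightarrow> complex) \<Rightarrow> (nat \<Rightarrow> complex) \<Rightarrow> real" where
  "qform n H c = Re (\<Sum>r<n. \<Sum>s<n. H r s * (c r * cnj (c s)))"

text \<open>The entrywise pairing of \<open>H\<close> with the \<open>n\<close> by \<open>n\<close>
  product of \<open>a\<close> and its adjoint.\<close>

abbreviation qsum :: "nat \<Rightarrow> (nat \<Rightarrow> nat \<Rightarrow> complex) \<Rightarrow> nat \<Rightarrow> nat \<Rightarrow> (nat \<Rightarrow> nat \<Rightarrow> nat \<Rightarrow> complex) \<Rightarrow> real" where
  "qsum n H p q a \<equiv> \<Sum>i<p. \<Sum>k<q. qform n H (\<lambda>r. a r i k)"

text \<open>\<open>rowsq\<close> of \<open>a\<close> is a Hermitian form in \<open>v\<close> with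
  coefficients \<open>a r i k * cnj (a s i k)\<close>. As \<open>P\<close> is only real-linear, the
  form is expanded in the real and imaginary parts of \<open>v r * cnj (v s)\<close>, and
  \<open>H\<close> collects the values of \<open>P\<close> on these.\<close>

lemma qform_of_functional:
  fixes P :: "((nat \<Rightarrow> complex) \<Rightarrow> complex) \<Rightarrow> real"
  assumes add: "\<And>A B. A \<in> qbounded n \<Longrightarrow> B \<in> qbounded n \<Longrightarrow> P (A + B) = P A + P B"
    and scl: "\<And>t A. A \<in> qbounded n \<Longrightarrow> P (cscale (of_real t) A) = t * P A"
  obtains H where "\<And>r s. H s r = cnj (H r s)"
    and "\<And>p q a. P (\<lambda>v. of_real (rowsq n p q a v)) = (\<Sum>i<p. \<Sum>k<q. qform n H (\<lambda>r. a r i k))"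
proof -
  define R where "R = (\<lambda>r s (v :: nat \<Rightarrow> complex). complex_of_real (Re (v r * cnj (v s))))"
  define I where "I = (\<lambda>r s (v :: nat \<Rightarrow> complex). complex_of_real (Im (v r * cnj (v s))))"
  have bd: "cmod (v r) * cmod (v s) \<le> 1 * vnorm2 n v" if "r < n" "s < n" for r s and v :: "nat \<Rightarrow> complex"
  proof -
    have "(cmod (v r))\<^sup>2 \<le> vnorm2 n v" "(cmod (v s))\<^sup>2 \<le> vnorm2 n v"
      using that by (auto intro!: member_le_sum)
    moreover have "2 * (cmod (v r) * cmod (v s)) \<le> (cmod (v r))\<^sup>2 + (cmod (v s))\<^sup>2"
      using sum_squares_bound[of "cmod (v r)" "cmod (v s)"] by simp
    ultimately show ?thesis by simp
  qed
  have RI: "R r s \<in> qbounded n" "I r s \<in> qbounded n" if "r < n" "s < n" for r s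
  proof -
    have "cmod (v r * cnj (v s)) \<le> 1 * vnorm2 n v" for v :: "nat \<Rightarrow> complex"
      using bd[OF that, of v] by (simp only: norm_mult complex_mod_cnj)
    from order_trans[OF abs_Re_le_cmod this] order_trans[OF abs_Im_le_cmod this]
    have "\<bar>Re (v r * cnj (v s))\<bar> \<le> 1 * vnorm2 n v" "\<bar>Im (v r * cnj (v s))\<bar> \<le> 1 * vnorm2 n v"
      for v :: "nat \<Rightarrow> complex" .
    thus "R r s \<in> qbounded n" "I r s \<in> qbounded n"
      by (auto intro!: qboundedI[of 1] simp only: R_def I_def norm_of_real)
  qed
  note sub = qbounded_subspace[of n, unfolded csubspace_iff_subspace]
  have P0: "P 0 = 0" using scl[of 0 0] cv.subspace_0[OF sub] by simp
  have Psum: "P (\<Sum>j\<in>J. A j) = (\<Sum>j\<in>J. P (A j))" if "\<And>j. j \<in> J \<Longrightarrow> A j \<in> qbounded n" for A and J :: "nat set"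
    using that
  proof (induction J rule: infinite_finite_induct)
    case (insert j J)
    have "(\<Sum>j\<in>J. A j) \<in> qbounded n" using insert by (intro cv.subspace_sum[OF sub]) auto
    with add[of "A j" "\<Sum>j\<in>J. A j"] insert
    have "P (A j + (\<Sum>j\<in>J. A j)) = P (A j) + (\<Sum>j\<in>J. P (A j))" by force
    thus ?case by (simp only: sum.insert[OF insert.hyps])
  qed (simp_all add: P0)
  have qsum: "(\<Sum>j\<in>J. A j) \<in> qbounded n" if "\<And>j. j \<in> J \<Longrightarrow> A j \<in> qbounded n" for A and J :: "nat set"
    using that by (rule cv.subspace_sum[OF sub])
  \<comment> \<open>Zero outside the index range, so that \<open>H\<close> is Hermitian for all
    indices.\<close>
  define H where "H = (\<lambda>r s. if r < n \<and> s < n then Complex (P (R r s)) (P (I r s)) else 0)"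
  show thesis
  proof
    fix r s
    have "R s r = R r s" by (rule ext) (simp add: R_def)
    moreover have "P (I s r) = - P (I r s)" if "r < n" "s < n"
    proof -
      have "I s r = cscale (of_real (- 1)) (I r s)" by (rule ext) (simp add: I_def cscale_fun_def)
      thus ?thesis using scl[OF RI(2)[OF that], of "- 1"] by simp
    qed
    ultimately show "H s r = cnj (H r s)" by (simp add: H_def complex_eq_iff)
  next
    fix p q :: nat and a :: "nat \<Rightarrow> nat \<Rightarrow> nat \<Rightarrow> complex"
    define w where "w = (\<lambda>i k r s. a r i k * cnj (a s i k))"
    \<comment> \<open>At \<open>v\<close> this is the real part of
      \<open>v r * cnj (v s) * w i k r s\<close>, expanded into real coefficients.\<close>
    define E where "E = (\<lambda>i k r s. cscale (of_real (Re (w i k r s))) (R r s) + cscale (of_real (- Im (w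
        i k r s))) (I r s))"
    have Eq: "E i k r s \<in> qbounded n" if "r < n" "s < n" for i k r s
      unfolding E_def using RI that by (intro cv.subspace_add[OF sub] cv.subspace_scale[OF sub])
    have PE: "P (E i k r s) = Re (H r s * (a r i k * cnj (a s i k)))" if "r < n" "s < n" for i k r s
    proof -
      have "P (E i k r s) = P (cscale (of_real (Re (w i k r s))) (R r s)) + P (cscale (of_real (- Im (w
          i k r s))) (I r s))"
        unfolding E_def by (intro add cv.subspace_scale[OF sub] RI that)
      also have "\<dots> = Re (w i k r s) * P (R r s) + - Im (w i k r s) * P (I r s)"
        by (simp only: scl RI that)
      also have "\<dots> = Re (H r s * (a r i k * cnj (a s i k)))" using that by (simp add: H_def w_def
          algebra_simps)
      finally show ?thesis .
    qed
    have "(\<lambda>v. complex_of_real (rowsq n p q a v)) = (\<Sum>i<p. \<Sum>k<q. \<Sum>r<n. \<Sum>s<n. E i k r s)"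
    proof (rule ext)
      fix v :: "nat \<Rightarrow> complex"
      have "(cmod (\<Sum>r<n. v r * a r i k))\<^sup>2 = (\<Sum>r<n. \<Sum>s<n. Re (v r * cnj (v s) * w i k r s))" for i k
      proof -
        have "complex_of_real ((cmod (\<Sum>r<n. v r * a r i k))\<^sup>2) = (\<Sum>r<n. v r * a r i k) * cnj (\<Sum>s<n. v s
            * a s i k)"
          by (rule complex_norm_square)
        also have "\<dots> = (\<Sum>r<n. \<Sum>s<n. v r * cnj (v s) * w i k r s)"
          by (simp add: sum_product w_def mult_ac)
        finally have "Re (complex_of_real ((cmod (\<Sum>r<n. v r * a r i k))\<^sup>2)) = Re (\<Sum>r<n. \<Sum>s<n. v r * cnj
            (v s) * w i k r s)"
          by (rule arg_cong)
        thus ?thesis by (simp only: Re_complex_of_real Re_sum)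
      qed
      moreover have "complex_of_real (Re (v r * cnj (v s) * w i k r s)) = E i k r s v" for i k r s
        by (simp add: E_def cscale_fun_def R_def I_def algebra_simps)
      ultimately show "complex_of_real (rowsq n p q a v) = (\<Sum>i<p. \<Sum>k<q. \<Sum>r<n. \<Sum>s<n. E i k r s) v"
        unfolding rowsq_def sum_fun_apply by (simp only: of_real_sum)
    qed
    hence "P (\<lambda>v. of_real (rowsq n p q a v)) = P (\<Sum>i<p. \<Sum>k<q. \<Sum>r<n. \<Sum>s<n. E i k r s)"
      by (rule arg_cong)
    also have "\<dots> = (\<Sum>i<p. P (\<Sum>k<q. \<Sum>r<n. \<Sum>s<n. E i k r s))"
      by (intro Psum qsum Eq) auto
    also have "\<dots> = (\<Sum>i<p. \<Sum>k<q. P (\<Sum>r<n. \<Sum>s<n. E i k r s))"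
      by (intro sum.cong refl Psum qsum Eq) auto
    also have "\<dots> = (\<Sum>i<p. \<Sum>k<q. \<Sum>r<n. P (\<Sum>s<n. E i k r s))"
      by (intro sum.cong refl Psum qsum Eq) auto
    also have "\<dots> = (\<Sum>i<p. \<Sum>k<q. \<Sum>r<n. \<Sum>s<n. P (E i k r s))"
      by (intro sum.cong refl Psum Eq) auto
    also have "\<dots> = (\<Sum>i<p. \<Sum>k<q. qform n H (\<lambda>r. a r i k))"
      unfolding qform_def by (simp add: PE)
    finally show "P (\<lambda>v. of_real (rowsq n p q a v)) = (\<Sum>i<p. \<Sum>k<q. qform n H (\<lambda>r. a r i k))" .
  qed
qed

text \<open>The outcome of the Effros-Ruan argument: a functional on matrices over the tensor product
  together with positive forms that control it, in the spirit of \<open>|\<Phi>(a z b)| \<le> p\<^sub>0(a a\<^sup>*) + p\<^sub>1(b\<^sup>* b)\<close>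
  for states \<open>p\<^sub>0\<close>, \<open>p\<^sub>1\<close> and \<open>z\<close> in the unit ball.\<close>
locale separated = opspace_pair V N W M K L
  for V :: "'a::cvec set" and N and W :: "'b::cvec set" and M and K L +
  fixes n :: nat and \<Phi> :: "('a, 'b) tmat \<Rightarrow> complex" and H0 H1 :: "nat \<Rightarrow> nat \<Rightarrow> complex"
  assumes \<Phi>lin: "lin_on {u. mat_in (tensors V W) n n u} \<Phi>"
    and herm: "\<And>r s. H0 s r = cnj (H0 r s)" "\<And>r s. H1 s r = cnj (H1 r s)"
    and \<Phi>bound: "\<And>u p q a b x y. mat_in (tensors V W) n n u \<Longrightarrow> proj_rep V K W L n u p q a b x y \<Longrightarrow>
        N p x \<le> 1 \<Longrightarrow> M q y \<le> 1 \<Longrightarrow> cmod (\<Phi> u) \<le> qsum n H0 p q a + qsum n H1 p q b"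
    and H0le: "\<And>p q a l. (\<And>v. rowsq n p q a v \<le> l * vnorm2 n v) \<Longrightarrow> qsum n H0 p q a \<le> l"
    and H1le: "\<And>p q a l. (\<And>v. rowsq n p q a v \<le> l * vnorm2 n v) \<Longrightarrow> qsum n H1 p q a \<le> l"
    and Hpos: "\<And>c. 0 \<le> qform n H0 c" "\<And>c. 0 \<le> qform n H1 c"

section \<open>The separating functional\<close>

context opspace_pair
begin

definition sepdom where
  "sepdom n = {u. mat_in (tensors V W) n n u} \<times> (qbounded n \<times> qbounded n)"

text \<open>The slots \<open>A\<close> and \<open>B\<close> are functions on \<open>\<complex>\<^sup>n\<close> compared with the quadratic forms of the two outer
  factors, so a single Hahn-Banach functional on triples provides both \<open>\<Phi>\<close> and its two dominating forms.
  Over \<open>(u, 0, 0)\<close> the cone bounds \<open>\<parallel>a\<parallel>\<^sup>2 + \<parallel>b\<parallel>\<^sup>2\<close>, hence the factor \<open>2\<close> in the separation theorem.\<close>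
definition sepcone :: "nat \<Rightarrow> ((('a, 'b) tmat \<times> ((nat \<Rightarrow> complex) \<Rightarrow> complex) \<times> ((nat \<Rightarrow> complex) \<Rightarrow>
    complex)) \<times> real) set" where
  "sepcone n = {((u, A, B), l + m) | u A B l m. (u, A, B) \<in> sepdom n \<and>
     (\<exists>A' B'. (u, A', B') \<in> freps n \<and> (\<forall>v. Re (A v) + A' v \<le> l * vnorm2 n v) \<and>
        (\<forall>v. Re (B v) + B' v \<le> m * vnorm2 n v))}"

lemma sepconeI:
  assumes "(u, A, B) \<in> sepdom n" "(u, A', B') \<in> freps n" "\<And>v. Re (A v) + A' v \<le> l * vnorm2 n v"
    "\<And>v. Re (B v) + B' v \<le> m * vnorm2 n v"
  shows "((u, A, B), l + m) \<in> sepcone n"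
  using assms unfolding sepcone_def by blast

lemma sepconeE:
  assumes "((u, A, B), s) \<in> sepcone n"
  obtains A' B' l m where "s = l + m" "(u, A, B) \<in> sepdom n" "(u, A', B') \<in> freps n"
    "\<And>v. Re (A v) + A' v \<le> l * vnorm2 n v" "\<And>v. Re (B v) + B' v \<le> m * vnorm2 n v"
  using assms unfolding sepcone_def by blast

lemma tmat_subspace: "csubspace {u. mat_in (tensors V W) n n u}"
  using tensors_subspace[OF V.csub W.csub] by (auto simp: csubspace_def mat_in_def cscale_fun_def)

lemma sepdom_subspace: "csubspace (sepdom n)"
  using tmat_subspace[of n] qbounded_subspace[of n]
  by (auto simp: csubspace_def sepdom_def zero_prod_def cscale_prod_def)

lemma freps_nonneg: "(u, A, B) \<in> freps n \<Longrightarrow> 0 \<le> A v" "(u, A, B) \<in> freps n \<Longrightarrow> 0 \<le> B v"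
  by (auto elim!: frepsE simp: rowsq_nonneg)

lemma sepcone_epi:
  assumes n: "0 < n" shows "epi_cone (sepcone n)"
  unfolding epi_cone_def
proof (intro conjI allI impI)
  show "(0, 0) \<in> sepcone n"
  proof -
    have "((0, 0, 0), 0 + 0) \<in> sepcone n"
      using sepdom_subspace[of n] freps_zero[of n 0]
      by (intro sepconeI[where A' = 0 and B' = 0]) (auto simp: csubspace_def zero_prod_def)
    thus ?thesis by (simp add: zero_prod_def)
  qed
next
  fix z s z' s' assume z: "(z, s) \<in> sepcone n" "(z', s') \<in> sepcone n"
  obtain u A B u' A' B' where zz: "z = (u, A, B)" "z' = (u', A', B')" by (cases z, cases z') auto
  obtain A1 B1 l m where 1: "s = l + m" "(u, A, B) \<in> sepdom n" "(u, A1, B1) \<in> freps n"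
    "\<And>v. Re (A v) + A1 v \<le> l * vnorm2 n v" "\<And>v. Re (B v) + B1 v \<le> m * vnorm2 n v"
    using z zz by (auto elim: sepconeE)
  obtain A2 B2 l' m' where 2: "s' = l' + m'" "(u', A', B') \<in> sepdom n" "(u', A2, B2) \<in> freps n"
    "\<And>v. Re (A' v) + A2 v \<le> l' * vnorm2 n v" "\<And>v. Re (B' v) + B2 v \<le> m' * vnorm2 n v"
    using z zz by (auto elim: sepconeE)
  have "((u + u', A + A', B + B'), (l + l') + (m + m')) \<in> sepcone n"
  proof (rule sepconeI[OF _ freps_add[OF 1(3) 2(3)]])
    show "(u + u', A + A', B + B') \<in> sepdom n"
      using sepdom_subspace[of n] 1(2) 2(2) unfolding csubspace_def by fastforce
    show "Re ((A + A') v) + (A1 + A2) v \<le> (l + l') * vnorm2 n v" for v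
      using 1(4)[of v] 2(4)[of v] by (simp add: distrib_right)
    show "Re ((B + B') v) + (B1 + B2) v \<le> (m + m') * vnorm2 n v" for v
      using 1(5)[of v] 2(5)[of v] by (simp add: distrib_right)
  qed
  thus "(z + z', s + s') \<in> sepcone n" by (simp add: zz 1 2 algebra_simps)
next
  fix t :: real and z s assume t: "0 \<le> t" and z: "(z, s) \<in> sepcone n"
  obtain u A B where zz: "z = (u, A, B)" by (cases z) auto
  obtain A1 B1 l m where 1: "s = l + m" "(u, A, B) \<in> sepdom n" "(u, A1, B1) \<in> freps n"
    "\<And>v. Re (A v) + A1 v \<le> l * vnorm2 n v" "\<And>v. Re (B v) + B1 v \<le> m * vnorm2 n v"
    using z zz by (auto elim: sepconeE)
  \<comment> \<open>Multiplying both outer factors by the square root of \<open>t\<close> multiplies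
    the tensor and both squares by \<open>t\<close>.\<close>
  let ?c = "complex_of_real (sqrt t)"
  have c: "?c * ?c = of_real t" "(cmod ?c)\<^sup>2 = t" using t by (simp_all flip: of_real_mult)
  have "((cscale (of_real t) u, cscale (of_real t) A, cscale (of_real t) B), t * l + t * m) \<in> sepcone n"
  proof (rule sepconeI[OF _ freps_scale[OF 1(3), of ?c ?c, unfolded c]])
    show "(cscale (of_real t) u, cscale (of_real t) A, cscale (of_real t) B) \<in> sepdom n"
      using sepdom_subspace[of n] 1(2) unfolding csubspace_def by (force simp: cscale_prod_def)
    show "Re (cscale (complex_of_real t) A v) + t * A1 v \<le> t * l * vnorm2 n v" for v
      using mult_left_mono[OF 1(4)[of v] t] by (simp add: cscale_fun_def algebra_simps)
    show "Re (cscale (complex_of_real t) B v) + t * B1 v \<le> t * m * vnorm2 n v" for v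
      using mult_left_mono[OF 1(5)[of v] t] by (simp add: cscale_fun_def algebra_simps)
  qed
  thus "(cscale (of_real t) z, t * s) \<in> sepcone n" by (simp add: zz 1 cscale_prod_def algebra_simps)
next
  fix s assume "(0, s) \<in> sepcone n"
  then obtain A1 B1 l m where 1: "s = l + m" "(0, A1, B1) \<in> freps n"
    "\<And>v. Re 0 + A1 v \<le> l * vnorm2 n v" "\<And>v. Re 0 + B1 v \<le> m * vnorm2 n v"
    by (auto simp: zero_prod_def elim: sepconeE)
  \<comment> \<open>Because \<open>0 < n\<close>, there is a vector of positive norm on which the
    signs of \<open>l\<close> and \<open>m\<close> can be read off.\<close>
  have v: "vnorm2 n (\<lambda>_. 1) > 0" using n by simp
  have "0 \<le> l * vnorm2 n (\<lambda>_. 1)" "0 \<le> m * vnorm2 n (\<lambda>_. 1)"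
    using 1(3,4)[of "\<lambda>_. 1"] freps_nonneg[OF 1(2), of "\<lambda>_. 1"] by auto
  hence "0 \<le> l" "0 \<le> m" using v by (auto simp: zero_le_mult_iff)
  thus "0 \<le> s" using 1 by simp
qed

lemma sepcone_total:
  assumes "z \<in> sepdom n" shows "\<exists>s. (z, s) \<in> sepcone n"
proof -
  obtain u A B where z: "z = (u, A, B)" by (cases z) auto
  have u: "mat_in (tensors V W) n n u" and A: "A \<in> qbounded n" and B: "B \<in> qbounded n"
    using assms z by (auto simp: sepdom_def)
  obtain c d where c: "\<And>v. cmod (A v) \<le> c * vnorm2 n v" and d: "\<And>v. cmod (B v) \<le> d * vnorm2 n v"
    using A B by (auto simp: qbounded_def)
  obtain A' B' where rep: "(u, A', B') \<in> freps n" using freps_total[OF u] by blast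
  obtain p q a b where AB: "A' = rowsq n p q a" "B' = rowsq n p q b" using rep by (rule frepsE)
  obtain \<alpha> \<beta> where \<alpha>: "\<And>v. A' v \<le> \<alpha>\<^sup>2 * vnorm2 n v" and \<beta>: "\<And>v. B' v \<le> \<beta>\<^sup>2 * vnorm2 n v"
    using rowsq_bounded unfolding AB by metis
  have "(z, (c + \<alpha>\<^sup>2) + (d + \<beta>\<^sup>2)) \<in> sepcone n"
    unfolding z
  proof (rule sepconeI[OF _ rep])
    show "(u, A, B) \<in> sepdom n" using assms z by simp
    show "Re (A v) + A' v \<le> (c + \<alpha>\<^sup>2) * vnorm2 n v" for v
      using order_trans[OF complex_Re_le_cmod c, of v] \<alpha>[of v] by (simp add: distrib_right)
    show "Re (B v) + B' v \<le> (d + \<beta>\<^sup>2) * vnorm2 n v" for v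
      using order_trans[OF complex_Re_le_cmod d, of v] \<beta>[of v] by (simp add: distrib_right)
  qed
  thus ?thesis by blast
qed

text \<open>Over \<open>(u0, 0, 0)\<close> the cone has values
  \<open>l + m \<ge> 2 * sqrt (l * m)\<close>, and \<open>sqrt l\<close> and \<open>sqrt m\<close>
  bound the outer factors of a factorisation of \<open>u0\<close>; so \<open>2 * proj_q\<close> is a
  lower bound to separate by. The functional splits into a part on tensors, which becomes
  \<open>\<Phi>\<close>, and two parts on functions, which become \<open>H0\<close> and
  \<open>H1\<close>.\<close>

theorem separation:
  assumes n: "0 < n" and u0: "mat_in (tensors V W) n n u0"
  obtains \<Phi> H0 H1 where "separated V N W M K L n \<Phi> H0 H1" "2 * proj_q V N K W M L n u0 \<le> Re (\<Phi> u0)"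
proof -
  let ?T = "{u. mat_in (tensors V W) n n u}"
  have sT: "cv.subspace ?T" and sQ: "cv.subspace (qbounded n)"
    using tmat_subspace qbounded_subspace by (auto simp: csubspace_iff_subspace)
  have domI: "(u, A, B) \<in> sepdom n \<longleftrightarrow> u \<in> ?T \<and> A \<in> qbounded n \<and> B \<in> qbounded n" for u A B
    by (simp add: sepdom_def)
  have z0: "(u0, 0, 0) \<in> sepdom n" using u0 cv.subspace_0[OF sQ] by (simp add: domI)
  have low: "2 * proj_q V N K W M L n u0 \<le> s" if sc: "((u0, 0, 0), s) \<in> sepcone n" for s
  proof -
    obtain A B l m where 1: "s = l + m" "(u0, A, B) \<in> freps n"
      "\<And>v. Re (0 v) + A v \<le> l * vnorm2 n v" "\<And>v. Re (0 v) + B v \<le> m * vnorm2 n v"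
      using sc by (rule sepconeE) (rule that)
    have v: "vnorm2 n (\<lambda>_. 1) > 0" using n by simp
    have "0 \<le> l * vnorm2 n (\<lambda>_. 1)" "0 \<le> m * vnorm2 n (\<lambda>_. 1)"
      using 1(3,4)[of "\<lambda>_. 1"] freps_nonneg[OF 1(2), of "\<lambda>_. 1"] by auto
    hence lm: "0 \<le> l" "0 \<le> m" using v by (auto simp: zero_le_mult_iff)
    obtain p q a b x y where 2: "A = rowsq n p q a" "B = rowsq n p q b"
      "proj_rep V K W L n u0 p q a b x y" "N p x \<le> 1" "M q y \<le> 1" using 1(2) by (rule frepsE)
    have "proj_q V N K W M L n u0 \<le> sqrt l * sqrt m"
    proof (rule proj_q_le[OF 2(3-5)])
      show "rowsq n p q a v \<le> (sqrt l)\<^sup>2 * vnorm2 n v" for v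
        using 1(3)[of v] lm by (simp add: 2(1))
      show "rowsq n p q b v \<le> (sqrt m)\<^sup>2 * vnorm2 n v" for v
        using 1(4)[of v] lm by (simp add: 2(2))
    qed (use lm in auto)
    also have "\<dots> \<le> (l + m) / 2" using arith_geo_mean_sqrt[OF lm] by (simp add: real_sqrt_mult)
    finally show ?thesis using 1 by simp
  qed
  have "fst ` sepcone n \<subseteq> sepdom n" by (auto simp: sepcone_def)
  then obtain f where fadd: "\<And>x y. x \<in> sepdom n \<Longrightarrow> y \<in> sepdom n \<Longrightarrow> f (x + y) = f x + f y"
    and fscl: "\<And>t x. x \<in> sepdom n \<Longrightarrow> f (cscale (of_real t) x) = t * f x"
    and fle: "\<And>z s. (z, s) \<in> sepcone n \<Longrightarrow> f z \<le> s" and fz0: "2 * proj_q V N K W M L n u0 \<le> f (u0, 0, 0)"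
    using hahn_banach_cone[OF sepdom_subspace sepcone_epi[OF n] _ sepcone_total z0 low] by blast
  define \<phi> where "\<phi> u = f (u, 0, 0)" for u
  define P0 where "P0 A = f (0, A, 0)" for A
  define P1 where "P1 B = f (0, 0, B)" for B
  have T0: "0 \<in> ?T" and Q0: "0 \<in> qbounded n" using cv.subspace_0[OF sT] cv.subspace_0[OF sQ] by auto
  have dec: "f (u, A, B) = \<phi> u + P0 A + P1 B" if "u \<in> ?T" "A \<in> qbounded n" "B \<in> qbounded n" for u A B
  proof -
    have "f (u, A, B) = f ((u, 0, 0) + ((0, A, 0) + (0, 0, B)))" by simp
    also have "\<dots> = f (u, 0, 0) + f ((0, A, 0) + (0, 0, B))"
      by (intro fadd) (simp only: domI add_Pair add_0_left add_0_right that T0 Q0 simp_thms)+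
    also have "f ((0, A, 0) + (0, 0, B)) = f (0, A, 0) + f (0, 0, B)"
      by (intro fadd) (simp only: domI that T0 Q0 simp_thms)+
    finally show ?thesis unfolding \<phi>_def P0_def P1_def by (simp only: add.assoc)
  qed
  have \<phi>add: "\<phi> (u + u') = \<phi> u + \<phi> u'" if "u \<in> ?T" "u' \<in> ?T" for u u'
    using fadd[of "(u, 0, 0)" "(u', 0, 0)"] that Q0 by (simp add: \<phi>_def domI)
  have \<phi>scl: "\<phi> (cscale (of_real t) u) = t * \<phi> u" if "u \<in> ?T" for u t
    using fscl[of "(u, 0, 0)" t] that Q0 by (simp add: \<phi>_def domI cscale_prod_def)
  have P0add: "P0 (A + B) = P0 A + P0 B" if "A \<in> qbounded n" "B \<in> qbounded n" for A B
    using fadd[of "(0, A, 0)" "(0, B, 0)"] that Q0 T0 by (simp add: P0_def domI)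
  have P0scl: "P0 (cscale (of_real t) A) = t * P0 A" if "A \<in> qbounded n" for t A
    using fscl[of "(0, A, 0)" t] that Q0 T0 by (simp add: P0_def domI cscale_prod_def)
  have P1add: "P1 (A + B) = P1 A + P1 B" if "A \<in> qbounded n" "B \<in> qbounded n" for A B
    using fadd[of "(0, 0, A)" "(0, 0, B)"] that Q0 T0 by (simp add: P1_def domI)
  have P1scl: "P1 (cscale (of_real t) A) = t * P1 A" if "A \<in> qbounded n" for t A
    using fscl[of "(0, 0, A)" t] that Q0 T0 by (simp add: P1_def domI cscale_prod_def)
  obtain H0 where H0: "\<And>r s. H0 s r = cnj (H0 r s)"
    "\<And>p q a. P0 (\<lambda>v. of_real (rowsq n p q a v)) = qsum n H0 p q a"
    using qform_of_functional[OF P0add P0scl] by blast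
  obtain H1 where H1: "\<And>r s. H1 s r = cnj (H1 r s)"
    "\<And>p q a. P1 (\<lambda>v. of_real (rowsq n p q a v)) = qsum n H1 p q a"
    using qform_of_functional[OF P1add P1scl] by blast
  have rowq: "(\<lambda>v. complex_of_real (rowsq n p q a v)) \<in> qbounded n" for p q a
  proof -
    obtain \<alpha> where "\<And>v. rowsq n p q a v \<le> \<alpha>\<^sup>2 * vnorm2 n v" using rowsq_bounded by blast
    thus ?thesis by (intro qboundedI[of "\<alpha>\<^sup>2"]) (auto simp: rowsq_nonneg)
  qed
  have neg: "cscale (of_real (- 1)) A \<in> qbounded n" if "A \<in> qbounded n" for A
    using that by (rule cv.subspace_scale[OF sQ])
  have f0: "(0, 0, 0) \<in> freps n" by (rule freps_zero) simp
  \<comment> \<open>The complex-linear functional with real part \<open>\<phi>\<close>.\<close>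
  define \<Phi> where "\<Phi> u = Complex (\<phi> u) (- \<phi> (cscale \<i> u))" for u
  have \<Phi>lin: "lin_on ?T \<Phi>"
    unfolding lin_on_def
  proof (intro conjI ballI allI)
    fix u u' assume uu: "u \<in> ?T" "u' \<in> ?T"
    show "\<Phi> (u + u') = \<Phi> u + \<Phi> u'"
      using uu cv.subspace_scale[OF sT] by (simp add: \<Phi>_def \<phi>add cscale_add_right complex_eq_iff)
  next
    fix c u assume u: "u \<in> ?T"
    have iu: "cscale \<i> u \<in> ?T" using u by (rule cv.subspace_scale[OF sT])
    have gen: "\<phi> (cscale w u) = Re w * \<phi> u + Im w * \<phi> (cscale \<i> u)" for w
    proof -
      have eq: "cscale (of_real (Re w)) u + cscale (of_real (Im w)) (cscale \<i> u) = cscale w u"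
        by (simp add: cscale_cscale cscale_add_left[symmetric] complex_eq[symmetric] mult.commute)
      have "\<phi> (cscale (of_real (Re w)) u + cscale (of_real (Im w)) (cscale \<i> u)) =
          \<phi> (cscale (of_real (Re w)) u) + \<phi> (cscale (of_real (Im w)) (cscale \<i> u))"
        by (intro \<phi>add cv.subspace_scale[OF sT] u iu)
      thus ?thesis unfolding eq by (simp only: \<phi>scl u iu)
    qed
    show "\<Phi> (cscale c u) = cscale c (\<Phi> u)"
      using gen[of c] gen[of "\<i> * c"] by (simp add: \<Phi>_def cscale_cscale complex_eq_iff)
  qed
  have "separated V N W M K L n \<Phi> H0 H1"
  proof (unfold_locales)
    show "lin_on ?T \<Phi>" by (rule \<Phi>lin)
    show "H0 s r = cnj (H0 r s)" "H1 s r = cnj (H1 r s)" for r s by (fact H0 H1)+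
    fix u p q a b x y assume u: "mat_in (tensors V W) n n u" and rep: "proj_rep V K W L n u p q a b x y"
      and xy: "N p x \<le> 1" "M q y \<le> 1"
    let ?A = "rowsq n p q a" and ?B = "rowsq n p q b"
    \<comment> \<open>Rotating \<open>u\<close> turns the modulus of \<open>\<Phi> u\<close> into a
      real part; the first outer factor absorbs \<open>z\<close> without a change of its
      squares.\<close>
    obtain z where z: "cmod z = 1" "z * \<Phi> u = of_real (cmod (\<Phi> u))"
    proof (cases "\<Phi> u = 0")
      case True
      thus thesis by (intro that[of 1]) auto
    next
      case False
      thus thesis
        by (intro that[of "cnj (\<Phi> u) / of_real (cmod (\<Phi> u))"])
           (auto simp: norm_divide complex_norm_square[symmetric] power2_eq_square mult.commute)
    qed
    have zu: "cscale z u \<in> ?T" using u by (intro cv.subspace_scale[OF sT]) simp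
    let ?A' = "cscale (of_real (- 1)) (\<lambda>v. complex_of_real (?A v))"
    let ?B' = "cscale (of_real (- 1)) (\<lambda>v. complex_of_real (?B v))"
    have "(u, ?A, ?B) \<in> freps n" using rep xy by (intro frepsI) auto
    from freps_scale[OF this, of z 1] z have fr: "(cscale z u, ?A, ?B) \<in> freps n" by simp
    \<comment> \<open>The negated functions of the factorisation in the form slots cancel it
      exactly, so the cone value is \<open>0\<close> and the tensor is dominated by the two
      forms.\<close>
    have "((cscale z u, ?A', ?B'), 0 + 0) \<in> sepcone n"
    proof (rule sepconeI[OF _ fr])
      show "(cscale z u, ?A', ?B') \<in> sepdom n" unfolding domI using zu neg[OF rowq] by blast
    qed (simp_all add: cscale_fun_def)
    hence "\<phi> (cscale z u) + P0 ?A' + P1 ?B' \<le> 0"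
      using fle dec[OF zu neg[OF rowq] neg[OF rowq]] by fastforce
    moreover have "P0 ?A' = - qsum n H0 p q a"
      using P0scl[OF rowq, of "- 1"] H0(2) by simp
    moreover have "P1 ?B' = - qsum n H1 p q b"
      using P1scl[OF rowq, of "- 1"] H1(2) by simp
    moreover have "\<phi> (cscale z u) = cmod (\<Phi> u)"
    proof -
      have "\<phi> (cscale z u) = Re (\<Phi> (cscale z u))" by (simp add: \<Phi>_def)
      also have "\<Phi> (cscale z u) = z * \<Phi> u" using lin_onD(2)[OF \<Phi>lin, of u z] u by simp
      finally show ?thesis by (simp add: z)
    qed
    ultimately show "cmod (\<Phi> u) \<le> qsum n H0 p q a + qsum n H1 p q b"
      by simp
  next
    fix p q a l assume l: "\<And>v. rowsq n p q a v \<le> l * vnorm2 n v"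
    let ?A = "\<lambda>v. complex_of_real (rowsq n p q a v)"
    \<comment> \<open>Over the zero tensor with the empty factorisation, the cone compares the
      functions directly with \<open>l * vnorm2\<close>.\<close>
    have "((0, ?A, 0), l + 0) \<in> sepcone n"
      by (rule sepconeI[OF _ f0]) (use rowq T0 Q0 l in \<open>simp_all add: domI\<close>)
    hence "P0 ?A \<le> l" using fle by (fastforce simp: P0_def)
    thus "qsum n H0 p q a \<le> l" using H0(2) by simp
    have "((0, 0, ?A), 0 + l) \<in> sepcone n"
      by (rule sepconeI[OF _ f0]) (use rowq T0 Q0 l in \<open>simp_all add: domI\<close>)
    hence "P1 ?A \<le> l" using fle by (fastforce simp: P1_def)
    thus "qsum n H1 p q a \<le> l" using H1(2) by simp
  next
    fix c
    let ?A = "\<lambda>v. complex_of_real (rowsq n 1 1 (\<lambda>r _ _. c r) v)"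
    let ?A' = "cscale (of_real (- 1)) ?A"
    have r: "Re (?A' v) \<le> 0" for v by (simp add: cscale_fun_def rowsq_nonneg)
    \<comment> \<open>Negative functions have cone value \<open>0\<close>; hence the forms are
      positive.\<close>
    have "((0, ?A', 0), 0 + 0) \<in> sepcone n"
      by (rule sepconeI[OF _ f0]) (use neg[OF rowq] T0 Q0 r in \<open>simp_all add: domI del: of_real_minus\<close>)
    hence "P0 ?A' \<le> 0" using fle by (fastforce simp: P0_def)
    thus "0 \<le> qform n H0 c" using P0scl[OF rowq, of "- 1"] H0(2)[of 1 1 "\<lambda>r _ _. c r"] by simp
    have "((0, 0, ?A'), 0 + 0) \<in> sepcone n"
      by (rule sepconeI[OF _ f0]) (use neg[OF rowq] T0 Q0 r in \<open>simp_all add: domI del: of_real_minus\<close>)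
    hence "P1 ?A' \<le> 0" using fle by (fastforce simp: P1_def)
    thus "0 \<le> qform n H1 c" using P1scl[OF rowq, of "- 1"] H1(2)[of 1 1 "\<lambda>r _ _. c r"] by simp
  qed
  moreover have "2 * proj_q V N K W M L n u0 \<le> Re (\<Phi> u0)" using fz0 by (simp add: \<Phi>_def \<phi>_def)
  ultimately show thesis by (rule that)
qed

end

section \<open>Orthonormal bases for positive forms\<close>

definition hform :: "nat \<Rightarrow> (nat \<Rightarrow> nat \<Rightarrow> complex) \<Rightarrow> (nat \<Rightarrow> complex) \<Rightarrow> (nat \<Rightarrow> complex) \<Rightarrow> complex" where
  "hform n H a b = (\<Sum>r<n. \<Sum>s<n. H r s * (a r * cnj (b s)))"

lemma qform_hform: "qform n H c = Re (hform n H c c)"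
  by (simp only: qform_def hform_def)

lemma hform_cong: "(\<And>r. r < n \<Longrightarrow> a r = a' r) \<Longrightarrow> (\<And>r. r < n \<Longrightarrow> b r = b' r) \<Longrightarrow> hform n H a b = hform n H a' b'"
  unfolding hform_def by (intro sum.cong refl) auto

lemma hform_sum_left: "hform n H (\<lambda>r. \<Sum>i\<in>I. c i * e i r) b = (\<Sum>i\<in>I. c i * hform n H (e i) b)"
proof -
  have "hform n H (\<lambda>r. \<Sum>i\<in>I. c i * e i r) b = (\<Sum>r<n. \<Sum>s<n. \<Sum>i\<in>I. c i * (H r s * (e i r * cnj (b s))))"
    unfolding hform_def sum_distrib_left sum_distrib_right
    by (intro sum.cong refl) (simp add: mult_ac)
  also have "\<dots> = (\<Sum>r<n. \<Sum>i\<in>I. \<Sum>s<n. c i * (H r s * (e i r * cnj (b s))))"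
    by (rule sum.cong[OF refl], rule sum.swap)
  also have "\<dots> = (\<Sum>i\<in>I. \<Sum>r<n. \<Sum>s<n. c i * (H r s * (e i r * cnj (b s))))"
    by (rule sum.swap)
  finally show ?thesis by (simp only: hform_def sum_distrib_left)
qed

lemma hform_add_left: "hform n H (\<lambda>r. a r + a' r) b = hform n H a b + hform n H a' b"
  by (simp add: hform_def algebra_simps sum.distrib)
lemma hform_scale_left: "hform n H (\<lambda>r. c * a r) b = c * hform n H a b"
  by (simp add: hform_def sum_distrib_left mult_ac)

context
  fixes n :: nat and H :: "nat \<Rightarrow> nat \<Rightarrow> complex"
  assumes herm: "\<And>r s. H s r = cnj (H r s)"
begin

lemma hform_sym: "hform n H b a = cnj (hform n H a b)"
proof -
  have "cnj (hform n H a b) = (\<Sum>r<n. \<Sum>s<n. H s r * (b s * cnj (a r)))"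
    unfolding hform_def cnj_sum by (intro sum.cong refl) (simp add: herm[symmetric] mult_ac)
  also have "\<dots> = hform n H b a" unfolding hform_def by (rule sum.swap)
  finally show ?thesis ..
qed

lemma hform_sum_right: "hform n H a (\<lambda>r. \<Sum>i\<in>I. c i * e i r) = (\<Sum>i\<in>I. cnj (c i) * hform n H a (e i))"
proof -
  have "hform n H a (\<lambda>r. \<Sum>i\<in>I. c i * e i r) = cnj (\<Sum>i\<in>I. c i * hform n H (e i) a)"
    by (subst hform_sym) (simp only: hform_sum_left)
  thus ?thesis by (simp add: cnj_sum hform_sym[of a, symmetric])
qed

lemma hform_real: "hform n H a a = of_real (qform n H a)"
proof -
  have "Im (hform n H a a) = 0" using arg_cong[OF hform_sym[of a a], of Im] by simp
  thus ?thesis by (simp add: qform_hform complex_eq_iff)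
qed

text \<open>Gram-Schmidt along the flag of vectors supported below \<open>m\<close>. The new
  direction is the unit vector at \<open>m\<close> minus its projection; its coordinate at
  \<open>m\<close> stays \<open>1\<close>, so it is nonzero and the form is positive on it.\<close>

lemma orthonormal_family:
  assumes pos: "\<And>c. (\<exists>r<n. c r \<noteq> 0) \<Longrightarrow> 0 < qform n H c" and m: "m \<le> n"
  shows "\<exists>e. (\<forall>i<m. \<forall>j<m. hform n H (e i) (e j) = (if i = j then 1 else 0)) \<and>
     (\<forall>i<m. \<forall>r\<ge>m. e i r = 0) \<and>
     (\<forall>a. (\<forall>r\<ge>m. a r = 0) \<longrightarrow> (\<forall>r. a r = (\<Sum>i<m. hform n H a (e i) * e i r)))"
  using m
proof (induction m)
  case 0
  show ?case by auto
next
  case (Suc m)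
  then obtain e where e: "\<forall>i<m. \<forall>j<m. hform n H (e i) (e j) = (if i = j then 1 else 0)"
    "\<forall>i<m. \<forall>r\<ge>m. e i r = 0"
    "\<forall>a. (\<forall>r\<ge>m. a r = 0) \<longrightarrow> (\<forall>r. a r = (\<Sum>i<m. hform n H a (e i) * e i r))"
    by auto
  have orth: "i < m \<Longrightarrow> j < m \<Longrightarrow> hform n H (e i) (e j) = (if i = j then 1 else 0)" for i j
    using e(1) by blast
  have supp: "i < m \<Longrightarrow> m \<le> r \<Longrightarrow> e i r = 0" for i r using e(2) by blast
  have span: "a r = (\<Sum>i<m. hform n H a (e i) * e i r)" if "\<And>r. m \<le> r \<Longrightarrow> a r = 0" for a r
    using e(3) that by blast
  define d where "d = (\<lambda>r. if r = m then 1 else (0 :: complex))"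
  define w where "w = (\<lambda>r. d r + (\<Sum>i<m. - hform n H d (e i) * e i r))"
  have wm: "w m = 1" by (simp add: w_def d_def supp)
  have wsupp: "w r = 0" if "Suc m \<le> r" for r using that supp by (simp add: w_def d_def)
  have we: "hform n H w (e j) = 0" if "j < m" for j
  proof -
    have "hform n H w (e j) = hform n H d (e j) + (\<Sum>i<m. - hform n H d (e i) * hform n H (e i) (e j))"
      unfolding w_def hform_add_left hform_sum_left ..
    also have "(\<Sum>i<m. - hform n H d (e i) * hform n H (e i) (e j)) = (\<Sum>i<m. if i = j then - hform n H d
        (e i) else 0)"
      using that by (intro sum.cong refl) (auto simp: orth)
    finally show ?thesis using that by simp
  qed
  define g where "g = sqrt (qform n H w)"
  have g: "g > 0" "g\<^sup>2 = qform n H w"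
    using pos[of w] wm Suc.prems by (force simp: g_def)+
  define e' where "e' = (\<lambda>i. if i = m then (\<lambda>r. inverse (of_real g) * w r) else e i)"
  have e'm: "e' m = (\<lambda>r. inverse (of_real g) * w r)" by (simp add: e'_def)
  have e'i: "i < m \<Longrightarrow> e' i = e i" for i by (simp add: e'_def)
  have ww: "hform n H w (e' m) = of_real g"
  proof -
    have "hform n H w (e' m) = cnj (inverse (of_real g) * hform n H w w)"
      unfolding e'm by (subst hform_sym) (simp only: hform_scale_left)
    also have "\<dots> = of_real g" using g by (simp add: hform_real power2_eq_square flip: g(2))
    finally show ?thesis .
  qed
  have 1: "hform n H (e' i) (e' j) = (if i = j then 1 else 0)" if ij: "i < Suc m" "j < Suc m" for i j
  proof -
    have mj: "hform n H (e' m) (e' j) = (if m = j then 1 else 0)" if "j < Suc m" for j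
    proof (cases "j = m")
      case True
      have "hform n H (e' m) (e' m) = inverse (of_real g) * hform n H w (e' m)"
        unfolding e'm[THEN fun_cong, THEN ext, of id] by (subst (1) e'm) (rule hform_scale_left)
      thus ?thesis using True ww g by simp
    next
      case False
      hence "j < m" using that by simp
      thus ?thesis using we e'i False by (subst (1) e'm) (simp add: hform_scale_left)
    qed
    show ?thesis
    proof (cases "i = m")
      case False
      hence i: "i < m" using ij by simp
      show ?thesis
      proof (cases "j = m")
        case True
        thus ?thesis using mj[of i] i hform_sym[of "e' i" "e' m"] False by simp
      next
        case False
        thus ?thesis using i ij orth e'i by simp
      qed
    qed (use mj ij in simp)
  qed
  have 2: "e' i r = 0" if "i < Suc m" "Suc m \<le> r" for i r
    using that wsupp supp by (auto simp: e'_def less_Suc_eq)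
  have 3: "a r = (\<Sum>i<Suc m. hform n H a (e' i) * e' i r)" if a: "\<And>r. Suc m \<le> r \<Longrightarrow> a r = 0" for a r
  proof -
    \<comment> \<open>Since \<open>w m = 1\<close>, this clears the coordinate \<open>m\<close> and
      leaves a vector covered by the induction hypothesis.\<close>
    define b where "b = (\<lambda>r. a r + - a m * w r)"
    have bs: "b r = 0" if "m \<le> r" for r
      using that a wsupp wm by (cases "r = m") (auto simp: b_def)
    have hb: "hform n H b c = hform n H a c - a m * hform n H w c" for c
      unfolding b_def hform_add_left hform_scale_left by simp
    have bexp: "b r = (\<Sum>i<m. hform n H a (e i) * e i r)" for r
    proof -
      have "b r = (\<Sum>i<m. hform n H b (e i) * e i r)" by (rule span) (rule bs)
      thus ?thesis by (simp add: hb we)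
    qed
    have "hform n H b (e' m) = 0"
    proof -
      have "hform n H b (e' m) = hform n H (\<lambda>r. \<Sum>i<m. hform n H a (e i) * e i r) (e' m)"
        by (simp only: bexp[abs_def, symmetric] bexp)
      also have "\<dots> = (\<Sum>i<m. hform n H a (e i) * hform n H (e' i) (e' m))"
        unfolding hform_sum_left by (simp add: e'i)
      also have "\<dots> = 0" by (intro sum.neutral) (simp add: 1)
      finally show ?thesis .
    qed
    hence am: "hform n H a (e' m) = a m * of_real g" using hb[of "e' m"] ww by simp
    have "a r = b r + a m * w r" by (simp add: b_def)
    also have "a m * w r = hform n H a (e' m) * e' m r" unfolding am using g by (simp add: e'm)
    also have "b r = (\<Sum>i<m. hform n H a (e' i) * e' i r)" unfolding bexp by (simp add: e'i)
    finally show ?thesis by simp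
  qed
  show ?case using 1 2 3 by (intro exI[of _ e'] conjI allI impI) blast+
qed

lemma orthonormal_basis:
  assumes pos: "\<And>c. (\<exists>r<n. c r \<noteq> 0) \<Longrightarrow> 0 < qform n H c"
  obtains e R where "\<And>c. qform n H (\<lambda>r. \<Sum>m<n. c m * e m r) = vnorm2 n c"
    "\<And>a r. r < n \<Longrightarrow> a r = (\<Sum>m<n. R a m * e m r)"
    "\<And>a. qform n H a = vnorm2 n (R a)"
proof -
  obtain e where e: "\<forall>i<n. \<forall>j<n. hform n H (e i) (e j) = (if i = j then 1 else 0)"
    "\<forall>a. (\<forall>r\<ge>n. a r = 0) \<longrightarrow> (\<forall>r. a r = (\<Sum>i<n. hform n H a (e i) * e i r))"
    using orthonormal_family[OF pos order_refl] by auto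
  have orth: "i < n \<Longrightarrow> j < n \<Longrightarrow> hform n H (e i) (e j) = (if i = j then 1 else 0)" for i j
    using e(1) by blast
  have span: "a r = (\<Sum>i<n. hform n H a (e i) * e i r)" if "\<And>r. n \<le> r \<Longrightarrow> a r = 0" for a r
    using e(2) that by blast
  have nrm: "qform n H (\<lambda>r. \<Sum>m<n. c m * e m r) = vnorm2 n c" for c
  proof -
    have "hform n H (\<lambda>r. \<Sum>m<n. c m * e m r) (\<lambda>r. \<Sum>m<n. c m * e m r) =
       (\<Sum>i<n. \<Sum>j<n. if j = i then c i * cnj (c j) else 0)"
      unfolding hform_sum_left hform_sum_right sum_distrib_left
      by (intro sum.cong refl) (auto simp: orth)
    also have "\<dots> = (\<Sum>i<n. c i * cnj (c i))" by simp
    also have "\<dots> = of_real (vnorm2 n c)" by (simp only: complex_norm_square of_real_sum)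
    finally show ?thesis by (simp add: qform_hform)
  qed
  define R where "R a m = hform n H a (e m)" for a m
  have exp: "a r = (\<Sum>m<n. R a m * e m r)" if "r < n" for a r
  proof -
    \<comment> \<open>The expansion holds for vectors supported below \<open>n\<close>;
      \<open>hform\<close> ignores the remaining coordinates.\<close>
    let ?a = "\<lambda>r. if r < n then a r else 0"
    have "?a r = (\<Sum>i<n. hform n H ?a (e i) * e i r)" by (rule span) simp
    also have "(\<lambda>i. hform n H ?a (e i)) = R a" unfolding R_def by (intro ext hform_cong) auto
    finally show ?thesis using that by (simp add: fun_eq_iff)
  qed
  have "qform n H a = qform n H (\<lambda>r. \<Sum>m<n. R a m * e m r)" for a
    unfolding qform_hform by (rule arg_cong[of _ _ Re], rule hform_cong) (auto intro: exp)
  thus thesis using nrm exp by (intro that[of e R]) auto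
qed

end

lemma qform_add_diag:
  fixes c :: "nat \<Rightarrow> complex"
  shows "qform n (\<lambda>r s. H r s + (if r = s then of_real \<epsilon> else 0)) c = qform n H c + \<epsilon> * vnorm2 n c"
proof -
  have "(\<Sum>r<n. \<Sum>s<n. (H r s + (if r = s then of_real \<epsilon> else 0)) * (c r * cnj (c s))) =
    (\<Sum>r<n. \<Sum>s<n. H r s * (c r * cnj (c s))) + (\<Sum>r<n. \<Sum>s<n. if r = s then of_real \<epsilon> * (c r * cnj (c s))
        else 0)"
    unfolding sum.distrib[symmetric] by (intro sum.cong refl) (auto simp: algebra_simps)
  also have "(\<Sum>r<n. \<Sum>s<n. if r = s then of_real \<epsilon> * (c r * cnj (c s)) else 0) = of_real (\<epsilon> * vnorm2 n c)"
    by (simp add: complex_norm_square[symmetric] sum_distrib_left)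
  finally show ?thesis by (simp add: qform_def)
qed

section \<open>Finite rank and finite codimension\<close>

text \<open>Each functional costs at most one dimension: if it is nonzero at some \<open>k0\<close>
  in the previous kernel, a multiple of \<open>k0\<close> moves every other vector into the new
  one.\<close>

lemma finite_codim_kernel:
  fixes g :: "'j \<Rightarrow> 'a::cvec \<Rightarrow> complex"
  assumes V: "csubspace V" and J: "finite J" and g: "\<And>j. j \<in> J \<Longrightarrow> lin_on V (g j)"
  obtains T where "finite T" "T \<subseteq> V"
    "\<And>x. x \<in> V \<Longrightarrow> \<exists>k\<in>{x\<in>V. \<forall>j\<in>J. g j x = 0}. \<exists>c. x = k + (\<Sum>t\<in>T. cscale (c t) t)"
proof -
  have sV: "cv.subspace V" using V by (simp add: csubspace_iff_subspace)
  have "\<exists>T. finite T \<and> T \<subseteq> V \<and> (\<forall>x\<in>V. \<exists>k\<in>{x\<in>V. \<forall>j\<in>J. g j x = 0}. x - k \<in> cv.span T)"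
    using J g
  proof (induction J rule: finite_induct)
    case empty
    show ?case by (intro exI[of _ "{}"]) (auto intro!: bexI cv.span_zero)
  next
    case (insert j J)
    let ?K = "{x\<in>V. \<forall>j\<in>J. g j x = 0}"
    obtain T where T: "finite T" "T \<subseteq> V" "\<And>x. x \<in> V \<Longrightarrow> \<exists>k\<in>?K. x - k \<in> cv.span T"
      using insert by auto
    have gj: "lin_on V (g i)" if "i \<in> insert j J" for i using insert.prems that by auto
    show ?case
    proof (cases "\<exists>k\<in>?K. g j k \<noteq> 0")
      case False
      hence "{x\<in>V. \<forall>i\<in>insert j J. g i x = 0} = ?K" by auto
      thus ?thesis using T by auto
    next
      case True
      then obtain k0 where k0: "k0 \<in> ?K" "g j k0 \<noteq> 0" by blast
      show ?thesis
      proof (intro exI[of _ "insert k0 T"] conjI ballI)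
        fix x assume x: "x \<in> V"
        obtain k where k: "k \<in> ?K" "x - k \<in> cv.span T" using T(3)[OF x] by blast
        define c where "c = - g j k / g j k0"
        let ?k = "k + cscale c k0"
        have in': "k \<in> V" "k0 \<in> V" using k k0 by auto
        note ck = cv.subspace_scale[OF sV in'(2), of c]
        have "g i ?k = g i k + c * g i k0" if "i \<in> insert j J" for i
          using lin_onD[OF gj[OF that]] in' ck by simp
        hence "?k \<in> {x\<in>V. \<forall>i\<in>insert j J. g i x = 0}"
          using k k0 ck cv.subspace_add[OF sV in'(1) ck] by (auto simp: c_def)
        moreover have "x - ?k \<in> cv.span (insert k0 T)"
        proof -
          have "x - k \<in> cv.span (insert k0 T)" using k(2) cv.span_mono[of T "insert k0 T"] by auto
          moreover have "cscale c k0 \<in> cv.span (insert k0 T)" by (intro cv.span_scale cv.span_base) auto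
          ultimately have "(x - k) - cscale c k0 \<in> cv.span (insert k0 T)" by (rule cv.span_diff)
          thus ?thesis by (simp add: algebra_simps)
        qed
        ultimately show "\<exists>k\<in>{x\<in>V. \<forall>i\<in>insert j J. g i x = 0}. x - k \<in> cv.span (insert k0 T)" by blast
      qed (use T k0 in auto)
    qed
  qed
  then obtain T where T: "finite T" "T \<subseteq> V" "\<And>x. x \<in> V \<Longrightarrow> \<exists>k\<in>{x\<in>V. \<forall>j\<in>J. g j x = 0}. x - k \<in> cv.span T"
    by blast
  show thesis
  proof (rule that[OF T(1,2)])
    fix x assume "x \<in> V"
    then obtain k where k: "k \<in> {x\<in>V. \<forall>j\<in>J. g j x = 0}" "x - k \<in> cv.span T" using T(3) by blast
    then obtain c where "x - k = (\<Sum>t\<in>T. cscale (c t) t)" unfolding cv.span_finite[OF T(1)] by blast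
    hence "x = k + (\<Sum>t\<in>T. cscale (c t) t)" by (simp add: algebra_simps)
    thus "\<exists>k\<in>{x\<in>V. \<forall>j\<in>J. g j x = 0}. \<exists>c. x = k + (\<Sum>t\<in>T. cscale (c t) t)" using k by blast
  qed
qed

text \<open>The basis is taken inside the range, so that its vectors are values of
  \<open>\<phi>\<close> and inherit their properties, such as membership in the bidual. The
  coordinates are only algebraically linear, which suffices because tensors are tested on algebraic
  duals.\<close>

lemma finite_rank_coordinates:
  fixes \<phi> :: "'a::cvec \<Rightarrow> 'b::cvec"
  assumes V: "csubspace V" and lin: "lin_on V \<phi>" and fr: "finite_rank_on V \<phi>"
  obtains B F where "finite B" "B \<subseteq> \<phi> ` V" "\<And>b. F b \<in> alg_dual V"
    "\<And>x. x \<in> V \<Longrightarrow> \<phi> x = (\<Sum>b\<in>B. cscale (F b x) b)"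
    "\<And>b x. \<phi> x = 0 \<Longrightarrow> F b x = 0"
proof -
  have sV: "cv.subspace V" using V by (simp add: csubspace_iff_subspace)
  obtain T where T: "finite T" "\<And>x. x \<in> V \<Longrightarrow> \<exists>c. \<phi> x = (\<Sum>t\<in>T. cscale (c t) t)"
    using fr by (auto simp: finite_rank_on_def)
  have img: "\<phi> ` V \<subseteq> cv.span T" using T by (auto simp: cv.span_finite)
  obtain B where B: "B \<subseteq> \<phi> ` V" "cv.independent B" "\<phi> ` V \<subseteq> cv.span B"
    using cv.maximal_independent_subset by blast
  have fB: "finite B" using cv.independent_span_bound[OF T(1) B(2)] B(1) img by blast
  define F where "F = (\<lambda>b x. if x \<in> V then cv.representation B (\<phi> x) b else 0)"
  show thesis
  proof (rule that[OF fB B(1)])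
    show "F b \<in> alg_dual V" for b
      unfolding alg_dual_def lin_on_def
    proof (intro CollectI conjI ballI allI impI)
      fix x y assume xy: "x \<in> V" "y \<in> V"
      have "\<phi> x \<in> cv.span B" "\<phi> y \<in> cv.span B" using B(3) xy by auto
      thus "F b (x + y) = F b x + F b y"
        using xy cv.subspace_add[OF sV xy] lin_onD(1)[OF lin xy] cv.representation_add[OF B(2)]
        by (simp add: F_def)
    next
      fix c x assume x: "x \<in> V"
      have "\<phi> x \<in> cv.span B" using B(3) x by auto
      thus "F b (cscale c x) = cscale c (F b x)"
        using x cv.subspace_scale[OF sV x] lin_onD(2)[OF lin x] cv.representation_scale[OF B(2)]
        by (simp add: F_def)
    qed (simp add: F_def)
    show "\<phi> x = (\<Sum>b\<in>B. cscale (F b x) b)" if x: "x \<in> V" for x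
    proof -
      have "\<phi> x \<in> cv.span B" using B(3) x by auto
      from cv.sum_representation_eq[OF B(2) this fB order_refl] x show ?thesis by (simp add: F_def)
    qed
    show "F b x = 0" if "\<phi> x = 0" for b x
      using that by (simp add: F_def cv.representation_zero)
  qed
qed

section \<open>From approximations of the identity to the projective norm\<close>

context opspace
begin

lemma functional_bound_scale:
  assumes f: "lin_on V f" and B: "\<And>x. x \<in> V \<Longrightarrow> N 1 (\<lambda>_ _. x) \<le> 1 \<Longrightarrow> cmod (f x) \<le> B" and x: "x \<in> V"
  shows "cmod (f x) \<le> B * N 1 (\<lambda>_ _. x)"
proof (cases "N 1 (\<lambda>_ _. x) = 0")
  case True
  hence "x = 0" using N_eq_0[of 1 "\<lambda>_ _. x"] x by (simp add: mat_in_def)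
  thus ?thesis using True lin_on_zero[OF f csub] by simp
next
  case False
  have xm: "mat_in V 1 1 (\<lambda>_ _. x)" using x by (simp add: mat_in_def)
  define t where "t = N 1 (\<lambda>_ _. x)"
  have t: "t > 0" using False N_nonneg[OF xm] by (simp add: t_def)
  have "N 1 (\<lambda>_ _. cscale (of_real (inverse t)) x) \<le> cmod (of_real (inverse t)) * t"
    unfolding t_def by (rule N_scale[OF xm])
  also have "\<dots> = 1" using t by (simp add: norm_inverse)
  finally have "cmod (f (cscale (of_real (inverse t)) x)) \<le> B" using x by (intro B scale_in)
  thus ?thesis using t unfolding lin_onD(2)[OF f x]
    by (simp add: norm_mult norm_inverse t_def[symmetric] norm_divide field_simps del: One_nat_def)
qed

text \<open>Closedness and finite codimension are separated because coordinate functionals of a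
  finite-rank map need not be known to be bounded.\<close>
lemma cofinite_subI:
  assumes J: "finite J" and g: "\<And>j. j \<in> J \<Longrightarrow> lin_on V (g j)"
    and closed: "\<And>x. x \<in> V \<Longrightarrow> (\<And>e. e > 0 \<Longrightarrow> \<exists>k\<in>{x\<in>V. \<forall>j\<in>J. g j x = 0}. N 1 (\<lambda>_ _. x - k) < e) \<Longrightarrow>
      \<forall>j\<in>J. g j x = (0 :: complex)"
  shows "cofinite_sub V N {x\<in>V. \<forall>j\<in>J. g j x = 0}"
  unfolding cofinite_sub_def
proof (intro conjI ballI impI)
  let ?K = "{x\<in>V. \<forall>j\<in>J. g j x = 0}"
  show "csubspace ?K"
    unfolding csubspace_def using zero_in add_in scale_in
    by (auto simp: lin_onD[OF g] lin_on_zero[OF g csub])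
  show "?K \<subseteq> V" by auto
  show "\<exists>T. finite T \<and> T \<subseteq> V \<and> (\<forall>x\<in>V. \<exists>k\<in>?K. \<exists>c. x = k + (\<Sum>t\<in>T. cscale (c t) t))"
  proof (rule finite_codim_kernel[OF csub J g])
    fix T assume "finite T" "T \<subseteq> V" "\<And>x. x \<in> V \<Longrightarrow> \<exists>k\<in>?K. \<exists>c. x = k + (\<Sum>t\<in>T. cscale (c t) t)"
    thus ?thesis by (intro exI[of _ T] conjI ballI)
  qed
  show "x \<in> ?K" if "x \<in> V" "\<forall>e>0. \<exists>k\<in>?K. N 1 (\<lambda>_ _. x - k) < e" for x
  proof -
    have "\<forall>j\<in>J. g j x = 0" by (rule closed[OF that(1)]) (rule that(2)[rule_format])
    with that(1) show ?thesis by simp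
  qed
qed

lemma small_bound_zero:
  assumes "0 \<le> B" "\<And>e. e > 0 \<Longrightarrow> cmod z \<le> B * e"
  shows "z = 0"
proof -
  have "cmod z \<le> 0 + d" if "d > 0" for d
  proof -
    have "cmod z \<le> B * (d / (B + 1))" using that assms by (intro assms(2)) simp
    also have "\<dots> \<le> d" using that assms(1) by (simp add: field_simps)
    finally show ?thesis by simp
  qed
  hence "cmod z \<le> 0" by (rule field_le_epsilon)
  thus ?thesis by simp
qed

lemma cofinite_kernel_bounded:
  assumes J: "finite J" and g: "\<And>j. j \<in> J \<Longrightarrow> g j \<in> dual_carrier V N"
  shows "cofinite_sub V N {x\<in>V. \<forall>j\<in>J. g j x = 0}"
proof (rule cofinite_subI[OF J])
  show "lin_on V (g j)" if "j \<in> J" for j by (rule dualD(1)[OF g[OF that]])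
  fix x assume x: "x \<in> V" and ap: "\<And>e. e > 0 \<Longrightarrow> \<exists>k\<in>{x\<in>V. \<forall>j\<in>J. g j x = 0}. N 1 (\<lambda>_ _. x - k) < e"
  show "\<forall>j\<in>J. g j x = 0"
  proof
    fix j assume j: "j \<in> J"
    obtain B where B: "B \<ge> 0" "\<And>x. x \<in> V \<Longrightarrow> cmod (g j x) \<le> B * N 1 (\<lambda>_ _. x)"
      using dualD(3)[OF g[OF j]] by blast
    show "g j x = 0"
    proof (rule small_bound_zero[OF B(1)])
      fix e :: real assume "e > 0"
      then obtain k where k: "k \<in> V" "g j k = 0" "N 1 (\<lambda>_ _. x - k) < e" using ap j by blast
      have "g j x = g j ((x - k) + k)" by simp
      also have "\<dots> = g j (x - k) + g j k"
        using x k cv.subspace_diff[OF sub] by (intro lin_onD(1)[OF dualD(1)[OF g[OF j]]]) auto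
      finally have "cmod (g j x) \<le> B * N 1 (\<lambda>_ _. x - k)"
        using B(2)[of "x - k"] x k cv.subspace_diff[OF sub] by simp
      also have "\<dots> \<le> B * e" using k B(1) by (intro mult_left_mono) auto
      finally show "cmod (g j x) \<le> B * e" .
    qed
  qed
qed

end

text \<open>With zero subspaces the results on quotients apply to \<open>proj\<close>
  itself.\<close>

sublocale opspaces \<subseteq> P0: opspace_pair V N W M "{0}" "{0}"
  by unfold_locales (use V.zero_in W.zero_in in \<open>auto simp: csubspace_def\<close>)

context opspaces
begin

lemma unit_mat_in: "x \<in> V \<Longrightarrow> y \<in> W \<Longrightarrow> mat_in (tensors V W) n n (unit_mat r s (tens V W x y))"
  using tensors_subspace[OF V.csub W.csub] sum_tens_in_tensors[of 1 "\<lambda>_. x" V "\<lambda>_. y" W]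
  by (auto simp: mat_in_def unit_mat_def csubspace_def)

end

section \<open>The functional as a matrix of maps into the dual\<close>

context separated
begin

text \<open>Through these bilinear forms \<open>\<Phi>\<close> is an \<open>n\<close> by
  \<open>n\<close> matrix of maps between one space and the dual of the other.\<close>

definition T where "T r s x y = \<Phi> (unit_mat r s (tens V W x y))"

lemma T_add_left: "x \<in> V \<Longrightarrow> x' \<in> V \<Longrightarrow> y \<in> W \<Longrightarrow> T r s (x + x') y = T r s x y + T r s x' y"
  unfolding T_def by (simp only: tens_add_left unit_mat_add, rule lin_onD(1)[OF \<Phi>lin])
    (simp_all only: mem_Collect_eq unit_mat_in)
lemma T_add_right: "x \<in> V \<Longrightarrow> y \<in> W \<Longrightarrow> y' \<in> W \<Longrightarrow> T r s x (y + y') = T r s x y + T r s x y'"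
  unfolding T_def by (simp only: tens_add_right unit_mat_add, rule lin_onD(1)[OF \<Phi>lin])
    (simp_all only: mem_Collect_eq unit_mat_in)
lemma T_scale_left: "x \<in> V \<Longrightarrow> y \<in> W \<Longrightarrow> T r s (cscale c x) y = c * T r s x y"
  unfolding T_def by (simp only: tens_scale_left unit_mat_scale, subst lin_onD(2)[OF \<Phi>lin])
    (simp_all only: mem_Collect_eq unit_mat_in cscale_complex_def)
lemma T_scale_right: "x \<in> V \<Longrightarrow> y \<in> W \<Longrightarrow> T r s x (cscale c y) = c * T r s x y"
  unfolding T_def by (simp only: tens_scale_right unit_mat_scale, subst lin_onD(2)[OF \<Phi>lin])
    (simp_all only: mem_Collect_eq unit_mat_in cscale_complex_def)

lemma csub_tmat: "cv.subspace {u. mat_in (tensors V W) n n u}"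
  using tmat_subspace by (simp add: csubspace_iff_subspace)

lemma \<Phi>_sum: "(\<And>i. i \<in> I \<Longrightarrow> mat_in (tensors V W) n n (u i)) \<Longrightarrow> \<Phi> (\<Sum>i\<in>I. u i) = (\<Sum>i\<in>I. \<Phi> (u i))"
  by (rule lin_on_sum[OF \<Phi>lin tmat_subspace]) simp

lemma tmat_sum_in: "(\<And>i. i \<in> I \<Longrightarrow> mat_in (tensors V W) n n (u i)) \<Longrightarrow> mat_in (tensors V W) n n (\<Sum>i\<in>I. u i)"
  using cv.subspace_sum[OF csub_tmat, of I u] by simp

text \<open>The value of \<open>\<Phi>\<close> at the product \<open>a (x \<otimes> y) b\<close>,
  expanded in entries.\<close>

definition Tval :: "nat \<Rightarrow> nat \<Rightarrow> (nat \<Rightarrow> nat \<Rightarrow> nat \<Rightarrow> complex) \<Rightarrow> (nat \<Rightarrow> nat \<Rightarrow> nat \<Rightarrow> complex) \<Rightarrow>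
    (nat \<Rightarrow> nat \<Rightarrow> 'a) \<Rightarrow> (nat \<Rightarrow> nat \<Rightarrow> 'b) \<Rightarrow> complex" where
  "Tval p q a b x y = (\<Sum>r<n. \<Sum>s<n. \<Sum>i<p. \<Sum>k<q. \<Sum>j<p. \<Sum>l<q. a r i k * b s j l * T r s (x i j) (y k l))"

lemma Tval_bound:
  assumes x: "mat_in V p p x" "N p x \<le> 1" and y: "mat_in W q q y" "M q y \<le> 1"
  shows "cmod (Tval p q a b x y) \<le> qsum n H0 p q a + qsum n H1 p q b"
proof -
  define h where "h = (\<lambda>r s i k j l. cscale (a r i k * b s j l) (unit_mat r s (tens V W (x i j) (y k l))))"
  define w where "w = (\<Sum>r<n. \<Sum>s<n. \<Sum>i<p. \<Sum>k<q. \<Sum>j<p. \<Sum>l<q. h r s i k j l)"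
  have xin: "i < p \<Longrightarrow> j < p \<Longrightarrow> x i j \<in> V" for i j using x by (simp add: mat_in_def)
  have yin: "i < q \<Longrightarrow> j < q \<Longrightarrow> y i j \<in> W" for i j using y by (simp add: mat_in_def)
  have hin: "mat_in (tensors V W) n n (h r s i k j l)" if "i < p" "j < p" "k < q" "l < q" for r s i k j l
    unfolding h_def using cv.subspace_scale[OF csub_tmat] unit_mat_in[OF xin yin] that by simp
  have \<Phi>h: "\<Phi> (h r s i k j l) = a r i k * b s j l * T r s (x i j) (y k l)" if "i < p" "j < p" "k < q" "l
      < q" for r s i k j l
    unfolding h_def T_def using lin_onD(2)[OF \<Phi>lin] unit_mat_in[OF xin yin] that by simp
  have win: "mat_in (tensors V W) n n w"
    unfolding w_def by (intro tmat_sum_in hin) auto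
  have "\<Phi> w = Tval p q a b x y"
  proof -
    have "\<Phi> w = (\<Sum>r<n. \<Phi> (\<Sum>s<n. \<Sum>i<p. \<Sum>k<q. \<Sum>j<p. \<Sum>l<q. h r s i k j l))"
      unfolding w_def by (intro \<Phi>_sum tmat_sum_in hin) auto
    also have "\<dots> = (\<Sum>r<n. \<Sum>s<n. \<Phi> (\<Sum>i<p. \<Sum>k<q. \<Sum>j<p. \<Sum>l<q. h r s i k j l))"
      by (intro sum.cong refl \<Phi>_sum tmat_sum_in hin) auto
    also have "\<dots> = (\<Sum>r<n. \<Sum>s<n. \<Sum>i<p. \<Phi> (\<Sum>k<q. \<Sum>j<p. \<Sum>l<q. h r s i k j l))"
      by (intro sum.cong refl \<Phi>_sum tmat_sum_in hin) auto
    also have "\<dots> = (\<Sum>r<n. \<Sum>s<n. \<Sum>i<p. \<Sum>k<q. \<Phi> (\<Sum>j<p. \<Sum>l<q. h r s i k j l))"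
      by (intro sum.cong refl \<Phi>_sum tmat_sum_in hin) auto
    also have "\<dots> = (\<Sum>r<n. \<Sum>s<n. \<Sum>i<p. \<Sum>k<q. \<Sum>j<p. \<Phi> (\<Sum>l<q. h r s i k j l))"
      by (intro sum.cong refl \<Phi>_sum tmat_sum_in hin) auto
    also have "\<dots> = (\<Sum>r<n. \<Sum>s<n. \<Sum>i<p. \<Sum>k<q. \<Sum>j<p. \<Sum>l<q. \<Phi> (h r s i k j l))"
      by (intro sum.cong refl \<Phi>_sum hin) auto
    also have "\<dots> = Tval p q a b x y"
      unfolding Tval_def by (intro sum.cong refl \<Phi>h) auto
    finally show ?thesis .
  qed
  moreover have "proj_rep V K W L n w p q a b x y"
    unfolding proj_rep_def
  proof (intro conjI x y allI impI ballI)
    fix r s f g assume rs: "r < n" "s < n" and fg: "f \<in> annih V K" "g \<in> annih W L"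
    have fg': "f \<in> alg_dual V" "g \<in> alg_dual W" using fg annih_subset by blast+
    have "w r s (f, g) = (\<Sum>r'<n. \<Sum>s'<n. if s' = s then (if r' = r then
        (\<Sum>i<p. \<Sum>k<q. \<Sum>j<p. \<Sum>l<q. a r' i k * b s' j l * (f (x i j) * g (y k l))) else 0) else 0)"
      unfolding w_def sum_fun_apply h_def
      by (intro sum.cong refl) (auto simp: unit_mat_def tens_def fg' cscale_fun_def)
    thus "w r s (f, g) = (\<Sum>i<p. \<Sum>k<q. \<Sum>j<p. \<Sum>l<q. a r i k * b s j l * (f (x i j) * g (y k l)))"
      using rs by simp
  qed
  ultimately show ?thesis using \<Phi>bound[OF win _ x(2) y(2)] by simp
qed

text \<open>Cut off outside \<open>V\<close>, as membership in \<open>dual_carrier\<close>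
  demands.\<close>

definition Ty where "Ty r s y = (\<lambda>x. if x \<in> V then T r s x y else 0)"

lemma Ty_lin: "y \<in> W \<Longrightarrow> lin_on V (Ty r s y)"
  unfolding lin_on_def Ty_def using V.add_in V.scale_in by (auto simp: T_add_left T_scale_left)

lemma T_bounded:
  assumes rs: "r < n" "s < n"
  obtains c where "0 \<le> c" "\<And>x y. x \<in> V \<Longrightarrow> y \<in> W \<Longrightarrow> cmod (T r s x y) \<le> c * N 1 (\<lambda>_ _. x) * M 1 (\<lambda>_ _. y)"
proof -
  let ?d = "\<lambda>r r'. if r' = r then 1 else (0 :: complex)"
  \<comment> \<open>The two forms at the unit vectors \<open>r\<close> and \<open>s\<close>: a
    single entry has a factorisation with \<open>p = q = 1\<close> and these outer factors.\<close>
  define c where "c = qform n H0 (?d r) + qform n H1 (?d s)"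
  have c: "0 \<le> c" using Hpos by (simp add: c_def)
  have 1: "cmod (T r s x y) \<le> c" if x: "x \<in> V" "N 1 (\<lambda>_ _. x) \<le> 1" and y: "y \<in> W" "M 1 (\<lambda>_ _. y) \<le> 1" for x y
  proof -
    have "cmod (Tval 1 1 (\<lambda>r' _ _. ?d r r') (\<lambda>s' _ _. ?d s s') (\<lambda>_ _. x) (\<lambda>_ _. y)) \<le> c"
      using Tval_bound[of 1 "\<lambda>_ _. x" 1 "\<lambda>_ _. y" "\<lambda>r' _ _. ?d r r'" "\<lambda>s' _ _. ?d s s'"] x y
      by (simp add: mat_in_def c_def del: One_nat_def)
    also have "Tval 1 1 (\<lambda>r' _ _. ?d r r') (\<lambda>s' _ _. ?d s s') (\<lambda>_ _. x) (\<lambda>_ _. y) =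
       (\<Sum>r'<n. \<Sum>s'<n. if s' = s then (if r' = r then T r' s' x y else 0) else 0)"
      unfolding Tval_def by (intro sum.cong refl) auto
    finally show ?thesis using rs by simp
  qed
  have 2: "cmod (T r s x y) \<le> c * M 1 (\<lambda>_ _. y)" if x: "x \<in> V" "N 1 (\<lambda>_ _. x) \<le> 1" and y: "y \<in> W" for x y
  proof (rule W.functional_bound_scale[where f = "T r s x", OF _ _ y])
    show "lin_on W (T r s x)" using x by (simp add: lin_on_def T_add_right T_scale_right)
    show "cmod (T r s x y) \<le> c" if "y \<in> W" "M 1 (\<lambda>_ _. y) \<le> 1" for y by (rule 1[OF x that])
  qed
  have 3: "cmod (T r s x y) \<le> c * M 1 (\<lambda>_ _. y) * N 1 (\<lambda>_ _. x)" if x: "x \<in> V" and y: "y \<in> W" for x y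
  proof (rule V.functional_bound_scale[where f = "\<lambda>x. T r s x y", OF _ _ x])
    show "lin_on V (\<lambda>x. T r s x y)" using y by (simp add: lin_on_def T_add_left T_scale_left)
    show "cmod (T r s x y) \<le> c * M 1 (\<lambda>_ _. y)" if "x \<in> V" "N 1 (\<lambda>_ _. x) \<le> 1" for x by (rule 2[OF that y])
  qed
  show thesis using 3 by (intro that[OF c]) (simp add: mult_ac)
qed

lemma Ty_dual: "y \<in> W \<Longrightarrow> r < n \<Longrightarrow> s < n \<Longrightarrow> Ty r s y \<in> dual_carrier V N"
proof -
  assume y: "y \<in> W" and rs: "r < n" "s < n"
  obtain c where c: "0 \<le> c" "\<And>x y. x \<in> V \<Longrightarrow> y \<in> W \<Longrightarrow> cmod (T r s x y) \<le> c * N 1 (\<lambda>_ _. x) * M 1 (\<lambda>_ _. y)"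
    using T_bounded[OF rs] by blast
  show ?thesis
    by (rule V.dual_memI[where B = "c * M 1 (\<lambda>_ _. y)"])
       (use Ty_lin[OF y] c(2)[OF _ y] in \<open>auto simp: Ty_def mult_ac\<close>)
qed

end

lemma sum_regroup1:
  "(\<Sum>i\<in>I. \<Sum>m\<in>A. \<Sum>\<kappa>\<in>B. \<Sum>j\<in>J. \<Sum>m'\<in>C. \<Sum>l\<in>D. \<Sum>r\<in>R. \<Sum>s\<in>S. F i m \<kappa> j m' l r s) =
   (\<Sum>r\<in>R. \<Sum>s\<in>S. \<Sum>i\<in>I. \<Sum>\<kappa>\<in>B. \<Sum>j\<in>J. \<Sum>l\<in>D. \<Sum>m\<in>A. \<Sum>m'\<in>C. F i m \<kappa> j m' l r s)"
  unfolding sum.cartesian_product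
  by (rule sum.reindex_bij_witness[of _ "\<lambda>(r, s, i, \<kappa>, j, l, m, m'). (i, m, \<kappa>, j, m', l, r, s)"
        "\<lambda>(i, m, \<kappa>, j, m', l, r, s). (r, s, i, \<kappa>, j, l, m, m')"]) auto

lemma sum_regroup2:
  "(\<Sum>m\<in>A. \<Sum>\<kappa>\<in>B. \<Sum>i\<in>I. \<Sum>m'\<in>C. \<Sum>l\<in>D. \<Sum>j\<in>J. \<Sum>r\<in>R. \<Sum>s\<in>S. F i m \<kappa> j m' l r s) =
   (\<Sum>r\<in>R. \<Sum>s\<in>S. \<Sum>i\<in>I. \<Sum>\<kappa>\<in>B. \<Sum>j\<in>J. \<Sum>l\<in>D. \<Sum>m\<in>A. \<Sum>m'\<in>C. F i m \<kappa> j m' l r s)"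
  unfolding sum.cartesian_product
  by (rule sum.reindex_bij_witness[of _ "\<lambda>(r, s, i, \<kappa>, j, l, m, m'). (m, \<kappa>, i, m', l, j, r, s)"
        "\<lambda>(m, \<kappa>, i, m', l, j, r, s). (r, s, i, \<kappa>, j, l, m, m')"]) auto

text \<open>The bound is tested on the \<open>n\<close> unit vectors. The loss of a factor
  \<open>n\<close> is harmless, since it will be multiplied by \<open>\<epsilon>\<close>.\<close>

lemma rowsq_hilbert_schmidt:
  assumes "\<And>v. rowsq n p q a v \<le> l * vnorm2 n v"
  shows "(\<Sum>i<p. \<Sum>k<q. vnorm2 n (\<lambda>r. a r i k)) \<le> of_nat n * l"
proof -
  have 1: "(\<Sum>i<p. \<Sum>k<q. (cmod (a r i k))\<^sup>2) \<le> l" if "r < n" for r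
  proof -
    let ?v = "\<lambda>r'. if r' = r then 1 else (0 :: complex)"
    have "(\<Sum>r'<n. ?v r' * a r' i k) = a r i k" for i k
    proof -
      have "(\<Sum>r'<n. ?v r' * a r' i k) = (\<Sum>r'<n. if r' = r then a r' i k else 0)"
        by (intro sum.cong) auto
      thus ?thesis using that by simp
    qed
    hence "rowsq n p q a ?v = (\<Sum>i<p. \<Sum>k<q. (cmod (a r i k))\<^sup>2)" by (simp only: rowsq_def)
    moreover have "vnorm2 n ?v = 1"
    proof -
      have "vnorm2 n ?v = (\<Sum>r'<n. if r' = r then 1 else 0)" by (intro sum.cong) auto
      thus ?thesis using that by simp
    qed
    ultimately show ?thesis using assms[of ?v] by simp
  qed
  have "(\<Sum>i<p. \<Sum>k<q. vnorm2 n (\<lambda>r. a r i k)) = (\<Sum>i<p. \<Sum>r<n. \<Sum>k<q. (cmod (a r i k))\<^sup>2)"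
    by (rule sum.cong[OF refl], rule sum.swap)
  also have "\<dots> = (\<Sum>r<n. \<Sum>i<p. \<Sum>k<q. (cmod (a r i k))\<^sup>2)" by (rule sum.swap)
  also have "\<dots> \<le> (\<Sum>r<n. l)" by (intro sum_mono 1) simp
  finally show ?thesis by simp
qed

lemma sum_product_right:
  fixes t :: "'c::semiring_0"
  shows "(\<Sum>m\<in>A. \<Sum>m'\<in>B. f m * g m' * t) = (\<Sum>m\<in>A. f m) * (\<Sum>m'\<in>B. g m') * t"
  by (subst sum_product) (simp only: sum_distrib_right)

lemma div_mod_pair: "k < q \<Longrightarrow> (m * q + k) div q = (m :: nat)" "k < q \<Longrightarrow> (m * q + k) mod q = k"
  by auto

text \<open>A degenerate form has no orthonormal basis; adding \<open>\<epsilon>\<close> times the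
  identity makes it definite. The first conclusion is an inequality because the original form lies
  below the perturbed one.\<close>

lemma perturbed_basis:
  assumes herm: "\<And>r s. H s r = cnj (H r s)" and pos: "\<And>c. 0 \<le> qform n H c" and \<epsilon>: "0 < \<epsilon>"
  obtains e R where "\<And>c. qform n H (\<lambda>r. \<Sum>m<n. c m * e m r) \<le> vnorm2 n c"
    "\<And>a r. r < n \<Longrightarrow> a r = (\<Sum>m<n. R a m * e m r)"
    "\<And>a. vnorm2 n (R a) = qform n H a + \<epsilon> * vnorm2 n a"
proof -
  define H' where "H' = (\<lambda>r s. H r s + (if r = s then of_real \<epsilon> else 0))"
  have q: "qform n H' c = qform n H c + \<epsilon> * vnorm2 n c" for c
    unfolding H'_def by (rule qform_add_diag)
  have pos': "0 < qform n H' c" if "\<exists>r<n. c r \<noteq> 0" for c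
  proof -
    have "vnorm2 n c > 0" using that vnorm2_zeroD[of c n] vnorm2_nonneg[of c n] by fastforce
    thus ?thesis unfolding q using \<epsilon> pos[of c] by (intro add_nonneg_pos) auto
  qed
  have herm': "H' s r = cnj (H' r s)" for r s using herm[of s r] by (simp add: H'_def)
  obtain e R where e: "\<And>c. qform n H' (\<lambda>r. \<Sum>m<n. c m * e m r) = vnorm2 n c"
    "\<And>a r. r < n \<Longrightarrow> a r = (\<Sum>m<n. R a m * e m r)" "\<And>a. qform n H' a = vnorm2 n (R a)"
    using orthonormal_basis[OF herm' pos'] by blast
  have le: "qform n H c \<le> qform n H' c" for c unfolding q using \<epsilon> by (simp add: sum_nonneg)
  show thesis
  proof (rule that[of e R])
    show "qform n H (\<lambda>r. \<Sum>m<n. c m * e m r) \<le> vnorm2 n c" for c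
      by (rule order_trans[OF le]) (simp only: e(1) order_refl)
  qed (simp_all only: e(2)[symmetric] e(3)[symmetric] q)
qed

text \<open>By Parseval the squared coordinates sum to the perturbed form; the hypothesis on
  \<open>H\<close> bounds its main part and the Hilbert-Schmidt estimate the perturbation.\<close>

lemma coefficients_bound:
  fixes R :: "(nat \<Rightarrow> complex) \<Rightarrow> nat \<Rightarrow> complex"
  assumes R: "\<And>a. vnorm2 n (R a) = qform n H a + \<epsilon> * vnorm2 n a" and \<epsilon>: "0 \<le> \<epsilon>"
    and H: "qsum n H p q a \<le> l" and a: "\<And>v. rowsq n p q a v \<le> l * vnorm2 n v"
  shows "mnorm2 (n * q) p (\<lambda>\<mu> i. R (\<lambda>r. a r i (\<mu> mod q)) (\<mu> div q)) \<le> l * (1 + of_nat n * \<epsilon>)"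
proof -
  have "mnorm2 (n * q) p (\<lambda>\<mu> i. R (\<lambda>r. a r i (\<mu> mod q)) (\<mu> div q)) =
      (\<Sum>m<n. \<Sum>\<kappa><q. \<Sum>i<p. (cmod (R (\<lambda>r. a r i \<kappa>) m))\<^sup>2)"
    by (rule sum_lessThan_mult)
  also have "\<dots> = (\<Sum>m<n. \<Sum>i<p. \<Sum>\<kappa><q. (cmod (R (\<lambda>r. a r i \<kappa>) m))\<^sup>2)"
    by (rule sum.cong[OF refl], rule sum.swap)
  also have "\<dots> = (\<Sum>i<p. \<Sum>m<n. \<Sum>\<kappa><q. (cmod (R (\<lambda>r. a r i \<kappa>) m))\<^sup>2)" by (rule sum.swap)
  also have "\<dots> = (\<Sum>i<p. \<Sum>\<kappa><q. vnorm2 n (R (\<lambda>r. a r i \<kappa>)))"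
    by (rule sum.cong[OF refl], rule sum.swap)
  also have "\<dots> = qsum n H p q a + \<epsilon> * (\<Sum>i<p. \<Sum>\<kappa><q. vnorm2 n (\<lambda>r. a r i \<kappa>))"
    by (simp only: R sum.distrib sum_distrib_left)
  also have "\<dots> \<le> l + \<epsilon> * (of_nat n * l)"
    by (intro add_mono mult_left_mono H \<epsilon> rowsq_hilbert_schmidt a)
  finally show ?thesis by (simp add: algebra_simps)
qed

section \<open>Evaluation on the bidual\<close>

context separated
begin

text \<open>\<open>Tval\<close> with the matrix over \<open>V\<close> replaced by one over the
  bidual, acting on the functionals \<open>Ty\<close>.\<close>

definition Bval :: "nat \<Rightarrow> nat \<Rightarrow> (nat \<Rightarrow> nat \<Rightarrow> nat \<Rightarrow> complex) \<Rightarrow> (nat \<Rightarrow> nat \<Rightarrow> nat \<Rightarrow> complex) \<Rightarrow>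
    (nat \<Rightarrow> nat \<Rightarrow> ('a \<Rightarrow> complex) \<Rightarrow> complex) \<Rightarrow> (nat \<Rightarrow> nat \<Rightarrow> 'b) \<Rightarrow> complex" where
  "Bval p q a b \<xi> y = (\<Sum>r<n. \<Sum>s<n. \<Sum>i<p. \<Sum>k<q. \<Sum>j<p. \<Sum>l<q. a r i k * b s j l * \<xi> i j (Ty r s (y k l)))"

text \<open>In bases orthonormal for the perturbed forms, \<open>\<Phi>\<close> becomes a matrix \<open>G\<close> over the dual of \<open>V\<close> of norm
  at most \<open>2\<close>; evaluating \<open>\<xi>\<close> on \<open>G\<close> uses only the definition of the bidual norm.\<close>
lemma bidual_estimate_eps:
  assumes \<xi>: "mat_in (bidual_carrier V N) p p \<xi>" and y: "mat_in W q q y" "M q y \<le> 1"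
    and \<alpha>: "0 \<le> \<alpha>" "\<And>v. rowsq n p q a v \<le> \<alpha>\<^sup>2 * vnorm2 n v"
    and \<beta>: "0 \<le> \<beta>" "\<And>v. rowsq n p q b v \<le> \<beta>\<^sup>2 * vnorm2 n v" and \<epsilon>: "0 < \<epsilon>"
  shows "cmod (Bval p q a b \<xi> y) \<le> 2 * bidual_norm V N p \<xi> * (\<alpha> * \<beta>) * (1 + of_nat n * \<epsilon>)"
proof -
  interpret D: opspace "dual_carrier V N" "dual_norm V N"
    by unfold_locales (rule V.dual_operator_space)
  obtain e R where e: "\<And>c. qform n H0 (\<lambda>r. \<Sum>m<n. c m * e m r) \<le> vnorm2 n c"
    "\<And>a r. r < n \<Longrightarrow> a r = (\<Sum>m<n. R a m * e m r)"
    "\<And>a. vnorm2 n (R a) = qform n H0 a + \<epsilon> * vnorm2 n a"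
    by (rule perturbed_basis[OF herm(1) Hpos(1) \<epsilon>]) (rule that)
  obtain e' R' where e': "\<And>c. qform n H1 (\<lambda>r. \<Sum>m<n. c m * e' m r) \<le> vnorm2 n c"
    "\<And>a r. r < n \<Longrightarrow> a r = (\<Sum>m<n. R' a m * e' m r)"
    "\<And>a. vnorm2 n (R' a) = qform n H1 a + \<epsilon> * vnorm2 n a"
    by (rule perturbed_basis[OF herm(2) Hpos(2) \<epsilon>]) (rule that)
  have yin: "i < q \<Longrightarrow> j < q \<Longrightarrow> y i j \<in> W" for i j using y by (simp add: mat_in_def)
  \<comment> \<open>An index of \<open>G\<close> pairs a basis vector of the perturbed form with an
    index of \<open>y\<close>.\<close>
  define G where "G = (\<lambda>\<mu> \<nu>. \<Sum>r<n. \<Sum>s<n. cscale (e (\<mu> div q) r * e' (\<nu> div q) s) (Ty r s (y (\<mu> mod q) (\<nu>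
      mod q))))"
  have Gin: "mat_in (dual_carrier V N) (n * q) (n * q) G"
    unfolding mat_in_def G_def
    by (intro allI impI D.sum_in D.scale_in Ty_dual yin) (auto simp: div_mod_less)
  have Geval: "G (m * q + k) (m' * q + l) x = (\<Sum>r<n. \<Sum>s<n. e m r * e' m' s * T r s x (y k l))"
    if "k < q" "l < q" "x \<in> V" for m m' k l x
    using that by (simp add: G_def sum_fun_apply cscale_fun_def div_mod_pair Ty_def)
  have G2: "dual_norm V N (n * q) G \<le> 2"
  proof (rule V.dual_norm_least)
    fix k x c d assume x: "mat_in V k k x" "N k x \<le> 1" and cd: "mnorm2 k (n * q) c \<le> 1" "mnorm2 k (n *
        q) d \<le> 1"
    have xin: "i < k \<Longrightarrow> j < k \<Longrightarrow> x i j \<in> V" for i j using x by (simp add: mat_in_def)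
    \<comment> \<open>Test vectors become outer factors of a product with \<open>x\<close> and
      \<open>y\<close>. In these bases the two forms are at most the squared norms of
      \<open>c\<close> and \<open>d\<close>, whence \<open>1 + 1 = 2\<close>.\<close>
    define a' where "a' = (\<lambda>r i \<kappa>. \<Sum>m<n. c i (m * q + \<kappa>) * e m r)"
    define b' where "b' = (\<lambda>s j l. \<Sum>m<n. d j (m * q + l) * e' m s)"
    have fl: "(\<Sum>\<mu><n * q. f \<mu>) = (\<Sum>m<n. \<Sum>\<kappa><q. f (m * q + \<kappa>))" for f :: "nat \<Rightarrow> complex"
      using sum_lessThan_mult[where h = "\<lambda>m \<kappa>. f (m * q + \<kappa>)" and p = n and q = q] by simp
    have "V.pform k (n * q) c G x d = (\<Sum>i<k. \<Sum>m<n. \<Sum>\<kappa><q. \<Sum>j<k. \<Sum>m'<n. \<Sum>l<q.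
        c i (m * q + \<kappa>) * G (m * q + \<kappa>) (m' * q + l) (x i j) * d j (m' * q + l))"
      unfolding bform_def fl ..
    also have "\<dots> = (\<Sum>i<k. \<Sum>m<n. \<Sum>\<kappa><q. \<Sum>j<k. \<Sum>m'<n. \<Sum>l<q. \<Sum>r<n. \<Sum>s<n.
        (c i (m * q + \<kappa>) * e m r) * (d j (m' * q + l) * e' m' s) * T r s (x i j) (y \<kappa> l))"
      by (intro sum.cong refl) (simp add: Geval xin sum_distrib_left sum_distrib_right mult_ac)
    also have "\<dots> = (\<Sum>r<n. \<Sum>s<n. \<Sum>i<k. \<Sum>\<kappa><q. \<Sum>j<k. \<Sum>l<q. \<Sum>m<n. \<Sum>m'<n.
        (c i (m * q + \<kappa>) * e m r) * (d j (m' * q + l) * e' m' s) * T r s (x i j) (y \<kappa> l))"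
      by (rule sum_regroup1)
    also have "\<dots> = Tval k q a' b' x y"
      unfolding Tval_def a'_def b'_def by (intro sum.cong refl) (rule sum_product_right)
    finally have "cmod (V.pform k (n * q) c G x d) = cmod (Tval k q a' b' x y)" by simp
    also have "\<dots> \<le> (\<Sum>i<k. \<Sum>\<kappa><q. qform n H0 (\<lambda>r. a' r i \<kappa>)) + (\<Sum>i<k. \<Sum>\<kappa><q. qform n H1 (\<lambda>r. b' r i \<kappa>))"
      by (rule Tval_bound[OF x y])
    also have "\<dots> \<le> mnorm2 k (n * q) c + mnorm2 k (n * q) d"
    proof -
      have flr: "(\<Sum>\<mu><n * q. f \<mu>) = (\<Sum>\<kappa><q. \<Sum>m<n. f (m * q + \<kappa>))" for f :: "nat \<Rightarrow> real"
        using sum_lessThan_mult[where h = "\<lambda>m \<kappa>. f (m * q + \<kappa>)" and p = n and q = q]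
        by (subst sum.swap) simp
      show ?thesis unfolding a'_def b'_def flr by (intro add_mono sum_mono e(1) e'(1))
    qed
    finally show "cmod (V.pform k (n * q) c G x d) \<le> 2" using cd by simp
  qed simp
  \<comment> \<open>Conversely, the coordinates of the given outer factors are the test vectors for
    which the pairing of \<open>\<xi>\<close> with \<open>G\<close> is \<open>Bval\<close>.\<close>
  define c where "c = (\<lambda>\<mu> i. R (\<lambda>r. a r i (\<mu> mod q)) (\<mu> div q))"
  define d where "d = (\<lambda>\<nu> j. R' (\<lambda>s. b s j (\<nu> mod q)) (\<nu> div q))"
  have fl: "(\<Sum>\<mu><n * q. f \<mu>) = (\<Sum>m<n. \<Sum>\<kappa><q. f (m * q + \<kappa>))" for f :: "nat \<Rightarrow> 'z::comm_monoid_add"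
    using sum_lessThan_mult[where h = "\<lambda>m \<kappa>. f (m * q + \<kappa>)" and p = n and q = q] by simp
  have \<xi>in: "i < p \<Longrightarrow> j < p \<Longrightarrow> \<xi> i j \<in> dual_carrier (dual_carrier V N) (dual_norm V N)" for i j
    using \<xi> by (simp add: mat_in_def bidual_carrier_def)
  have \<xi>G: "\<xi> i j (G (m * q + \<kappa>) (m' * q + l)) = (\<Sum>r<n. \<Sum>s<n. e m r * e' m' s * \<xi> i j (Ty r s (y \<kappa> l)))"
    if "i < p" "j < p" "\<kappa> < q" "l < q" for i j m m' \<kappa> l
  proof -
    note lin = D.dualD(1)[OF \<xi>in[OF that(1,2)]]
    have "\<xi> i j (G (m * q + \<kappa>) (m' * q + l)) = (\<Sum>r<n. \<xi> i j (\<Sum>s<n. cscale (e m r * e' m' s) (Ty r s (y \<kappa>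
        l))))"
      unfolding G_def div_mod_pair[OF that(3)] div_mod_pair[OF that(4)]
      by (intro lin_on_sum[OF lin D.csub] D.sum_in D.scale_in Ty_dual yin that) auto
    also have "\<dots> = (\<Sum>r<n. \<Sum>s<n. \<xi> i j (cscale (e m r * e' m' s) (Ty r s (y \<kappa> l))))"
      by (intro sum.cong refl lin_on_sum[OF lin D.csub] D.scale_in Ty_dual yin that) auto
    also have "\<dots> = (\<Sum>r<n. \<Sum>s<n. e m r * e' m' s * \<xi> i j (Ty r s (y \<kappa> l)))"
      by (intro sum.cong refl) (simp add: lin_onD(2)[OF lin] Ty_dual yin that)
    finally show ?thesis .
  qed
  have "D.pform (n * q) p c \<xi> G d = (\<Sum>m<n. \<Sum>\<kappa><q. \<Sum>i<p. \<Sum>m'<n. \<Sum>l<q. \<Sum>j<p.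
      c (m * q + \<kappa>) i * \<xi> i j (G (m * q + \<kappa>) (m' * q + l)) * d (m' * q + l) j)"
    unfolding bform_def fl ..
  also have "\<dots> = (\<Sum>m<n. \<Sum>\<kappa><q. \<Sum>i<p. \<Sum>m'<n. \<Sum>l<q. \<Sum>j<p. \<Sum>r<n. \<Sum>s<n.
      (R (\<lambda>r. a r i \<kappa>) m * e m r) * (R' (\<lambda>s. b s j l) m' * e' m' s) * \<xi> i j (Ty r s (y \<kappa> l)))"
    by (intro sum.cong refl) (simp add: \<xi>G c_def d_def div_mod_pair sum_distrib_left sum_distrib_right
        mult_ac)
  also have "\<dots> = (\<Sum>r<n. \<Sum>s<n. \<Sum>i<p. \<Sum>\<kappa><q. \<Sum>j<p. \<Sum>l<q. \<Sum>m<n. \<Sum>m'<n.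
      (R (\<lambda>r. a r i \<kappa>) m * e m r) * (R' (\<lambda>s. b s j l) m' * e' m' s) * \<xi> i j (Ty r s (y \<kappa> l)))"
    by (rule sum_regroup2)
  also have "\<dots> = (\<Sum>r<n. \<Sum>s<n. \<Sum>i<p. \<Sum>\<kappa><q. \<Sum>j<p. \<Sum>l<q.
      (\<Sum>m<n. R (\<lambda>r. a r i \<kappa>) m * e m r) * (\<Sum>m'<n. R' (\<lambda>s. b s j l) m' * e' m' s) * \<xi> i j (Ty r s (y \<kappa> l)))"
    by (intro sum.cong refl) (rule sum_product_right)
  also have "\<dots> = Bval p q a b \<xi> y"
    unfolding Bval_def
    by (intro sum.cong refl) (simp only: lessThan_iff e(2)[symmetric] e'(2)[symmetric])
  finally have "cmod (Bval p q a b \<xi> y) = cmod (D.pform (n * q) p c \<xi> G d)" by simp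
  also have "\<dots> \<le> bidual_norm V N p \<xi> * dual_norm V N (n * q) G * sqrt (mnorm2 (n * q) p c) * sqrt
      (mnorm2 (n * q) p d)"
    unfolding bidual_norm_def by (rule D.dual_norm_pairing[OF \<xi>[unfolded bidual_carrier_def] Gin])
  also have "\<dots> \<le> bidual_norm V N p \<xi> * 2 * sqrt (\<alpha>\<^sup>2 * (1 + of_nat n * \<epsilon>)) * sqrt (\<beta>\<^sup>2 * (1 + of_nat n * \<epsilon>))"
  proof -
    have c: "mnorm2 (n * q) p c \<le> \<alpha>\<^sup>2 * (1 + of_nat n * \<epsilon>)"
      unfolding c_def by (rule coefficients_bound[OF e(3) less_imp_le[OF \<epsilon>] H0le[OF \<alpha>(2)] \<alpha>(2)])
    have d: "mnorm2 (n * q) p d \<le> \<beta>\<^sup>2 * (1 + of_nat n * \<epsilon>)"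
      unfolding d_def by (rule coefficients_bound[OF e'(3) less_imp_le[OF \<epsilon>] H1le[OF \<beta>(2)] \<beta>(2)])
    have "0 \<le> bidual_norm V N p \<xi>"
      unfolding bidual_norm_def by (rule D.dual_norm_nonneg[OF \<xi>[unfolded bidual_carrier_def]])
    thus ?thesis using c d G2 V.dual_norm_nonneg[OF Gin] \<epsilon>
      by (intro mult_mono real_sqrt_le_mono mult_nonneg_nonneg) (auto simp: mnorm2_nonneg)
  qed
  also have "\<dots> = 2 * bidual_norm V N p \<xi> * (\<alpha> * \<beta>) * (1 + of_nat n * \<epsilon>)"
    using \<alpha>(1) \<beta>(1) \<epsilon> by (simp add: real_sqrt_mult)
  finally show ?thesis .
qed

lemma bidual_estimate:
  assumes \<xi>: "mat_in (bidual_carrier V N) p p \<xi>" and y: "mat_in W q q y" "M q y \<le> 1"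
    and \<alpha>: "0 \<le> \<alpha>" "\<And>v. rowsq n p q a v \<le> \<alpha>\<^sup>2 * vnorm2 n v"
    and \<beta>: "0 \<le> \<beta>" "\<And>v. rowsq n p q b v \<le> \<beta>\<^sup>2 * vnorm2 n v"
  shows "cmod (Bval p q a b \<xi> y) \<le> 2 * bidual_norm V N p \<xi> * (\<alpha> * \<beta>)"
proof -
  let ?f = "\<lambda>\<epsilon>. 2 * bidual_norm V N p \<xi> * (\<alpha> * \<beta>) * (1 + of_nat n * \<epsilon>)"
  have "cmod (Bval p q a b \<xi> y) \<le> ?f 0"
  proof (rule tendsto_lowerbound)
    show "(?f \<longlongrightarrow> ?f 0) (at_right 0)" by (intro tendsto_intros)
    show "\<forall>\<^sub>F \<epsilon> in at_right 0. cmod (Bval p q a b \<xi> y) \<le> ?f \<epsilon>"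
      by (rule eventually_mono[OF eventually_at_right_less])
         (rule bidual_estimate_eps[OF \<xi> y \<alpha> \<beta>])
  qed simp
  thus ?thesis by simp
qed

end

section \<open>The projective norm and its cofinite hull\<close>

context opspaces
begin

text \<open>Passing to quotients leaves fewer functionals to test with, so every factorisation
  remains one.\<close>

lemma proj_q_le_proj:
  assumes u: "mat_in (tensors V W) n n u" and K: "csubspace K" "K \<subseteq> V" and L: "csubspace L" "L \<subseteq> W"
  shows "proj_q V N K W M L n u \<le> proj V N W M n u"
proof -
  interpret Q: opspace_pair V N W M K L by unfold_locales (use K L in auto)
  have "proj_q V N K W M L n u \<le> 1 * proj_q V N {0} W M {0} n u"
  proof (rule P0.proj_q_ge[OF P0.proj_rep_exists[OF u]])
    fix p q a b x y \<alpha> \<beta>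
    assume rep: "proj_rep V {0} W {0} n u p q a b x y" and xy: "N p x \<le> 1" "M q y \<le> 1"
      and \<alpha>: "0 \<le> \<alpha>" "\<And>v. rowsq n p q a v \<le> \<alpha>\<^sup>2 * vnorm2 n v"
      and \<beta>: "0 \<le> \<beta>" "\<And>v. rowsq n p q b v \<le> \<beta>\<^sup>2 * vnorm2 n v"
    have "annih V K \<subseteq> annih V {0}" "annih W L \<subseteq> annih W {0}"
      using annih_subset annih_zero[OF V.csub] annih_zero[OF W.csub] by blast+
    hence "proj_rep V K W L n u p q a b x y" using rep unfolding proj_rep_def by blast
    from Q.proj_q_le[OF this xy \<alpha> \<beta>] show "proj_q V N K W M L n u \<le> 1 * (\<alpha> * \<beta>)" by simp
  qed simp
  thus ?thesis by (simp add: proj_def)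
qed

lemma cproj_bdd:
  assumes u: "mat_in (tensors V W) n n u"
  shows "bdd_above {proj_q V N K W M L n u | K L. cofinite_sub V N K \<and> cofinite_sub W M L}"
  by (rule bdd_aboveI[of _ "proj V N W M n u"])
     (auto simp: cofinite_sub_def intro!: proj_q_le_proj[OF u])

lemma cproj_upper:
  assumes u: "mat_in (tensors V W) n n u" and K: "cofinite_sub V N K" and L: "cofinite_sub W M L"
  shows "proj_q V N K W M L n u \<le> cproj V N W M n u"
  unfolding cproj_def by (rule cSup_upper[OF _ cproj_bdd[OF u]]) (use K L in blast)

lemma cofinite_whole: "cofinite_sub V N V" "cofinite_sub W M W"
  using V.cofinite_kernel_bounded[of "{}"] W.cofinite_kernel_bounded[of "{}"] by simp_all

lemma cproj_least:
  assumes "\<And>K L. cofinite_sub V N K \<Longrightarrow> cofinite_sub W M L \<Longrightarrow> proj_q V N K W M L n u \<le> t"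
  shows "cproj V N W M n u \<le> t"
  unfolding cproj_def by (rule cSup_least) (use assms cofinite_whole in blast)+

lemma cproj_le_proj:
  assumes u: "mat_in (tensors V W) n n u"
  shows "cproj V N W M n u \<le> proj V N W M n u"
  by (rule cproj_least) (auto simp: cofinite_sub_def intro!: proj_q_le_proj[OF u])

lemma proj_q_nonneg:
  assumes u: "mat_in (tensors V W) n n u" and K: "csubspace K" "K \<subseteq> V" and L: "csubspace L" "L \<subseteq> W"
  shows "0 \<le> proj_q V N K W M L n u"
proof -
  interpret Q: opspace_pair V N W M K L by unfold_locales (use K L in auto)
  have "0 \<le> 1 * proj_q V N K W M L n u"
    by (rule Q.proj_q_ge[OF Q.proj_rep_exists[OF u]]) auto
  thus ?thesis by simp
qed

lemma cproj_nonneg: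
  assumes u: "mat_in (tensors V W) n n u"
  shows "0 \<le> cproj V N W M n u"
  by (rule order_trans[OF proj_q_nonneg[OF u] cproj_upper[OF u cofinite_whole]])
     (use V.csub W.csub in auto)

text \<open>Separation requires \<open>0 < n\<close>; for \<open>n = 0\<close> the empty
  factorisation decides.\<close>

lemma proj_0_le: "proj V N W M 0 u \<le> 0"
proof -
  have "proj_q V N {0} W M {0} 0 u \<le> 0 * 0"
    by (rule P0.proj_q_le[where p = 0 and q = 0 and a = "\<lambda>_ _ _. 0" and b = "\<lambda>_ _ _. 0" and x = "\<lambda>_ _.
        0" and y = "\<lambda>_ _. 0"])
       (auto simp: proj_rep_def mat_in_def V.N_zero W.N_zero rowsq_def)
  thus ?thesis by (simp add: proj_def)
qed

end

section \<open>Finite-rank maps into the bidual\<close>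

context opspace
begin

lemma dual_norm_one_le:
  assumes f: "lin_on V f" and B: "\<And>x. x \<in> V \<Longrightarrow> cmod (f x) \<le> B * N 1 (\<lambda>_ _. x)" and B0: "0 \<le> B"
  shows "dual_norm V N 1 (\<lambda>_ _. f) \<le> B"
proof (rule dual_norm_least[OF B0])
  fix k x c d assume x: "mat_in V k k x" "N k x \<le> 1" and cd: "mnorm2 k 1 c \<le> 1" "mnorm2 k 1 d \<le> 1"
  have "cmod (\<Sum>i<k. \<Sum>j<k. c i 0 * f (x i j) * d j 0)
      \<le> B * N k x * sqrt (vnorm2 k (\<lambda>i. c i 0)) * sqrt (vnorm2 k (\<lambda>j. d j 0))"
    by (rule functional_amplification[OF f B B0 x(1)])
  also have "\<dots> \<le> B * 1 * 1 * 1"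
    using cd x B0 by (intro mult_mono) (auto simp: N_nonneg sum_nonneg)
  finally show "cmod (pform k 1 c (\<lambda>_ _. f) x d) \<le> B" by (simp add: bform_def)
qed

definition admissible :: "real \<Rightarrow> ('a \<Rightarrow> ('a \<Rightarrow> complex) \<Rightarrow> complex) \<Rightarrow> bool" where
  "admissible C \<phi> \<longleftrightarrow> lin_on V \<phi> \<and> \<phi> ` V \<subseteq> bidual_carrier V N \<and> finite_rank_on V \<phi> \<and>
     cb_le V N (bidual_norm V N) C \<phi>"

lemma admissible_eval_bound:
  assumes \<phi>: "admissible C \<phi>" and x: "x \<in> V" and f: "f \<in> dual_carrier V N" 
  shows "cmod (\<phi> x f) \<le> C * N 1 (\<lambda>_ _. x) * dual_norm V N 1 (\<lambda>_ _. f)"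
proof -
  interpret D: opspace "dual_carrier V N" "dual_norm V N"
    by unfold_locales (rule dual_operator_space)
  have "\<phi> x \<in> dual_carrier (dual_carrier V N) (dual_norm V N)"
    using \<phi> x by (auto simp: admissible_def bidual_carrier_def)
  from D.dual_eval_bound[OF this f]
  have "cmod (\<phi> x f) \<le> bidual_norm V N 1 (\<lambda>_ _. \<phi> x) * dual_norm V N 1 (\<lambda>_ _. f)"
    by (simp only: bidual_norm_def)
  also have "\<dots> \<le> C * N 1 (\<lambda>_ _. x) * dual_norm V N 1 (\<lambda>_ _. f)"
  proof (rule mult_right_mono)
    have "\<forall>n x. mat_in V n n x \<longrightarrow> bidual_norm V N n (\<lambda>i j. \<phi> (x i j)) \<le> C * N n x"
      using \<phi> unfolding admissible_def cb_le_def by blast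
    from this[rule_format, of 1 "\<lambda>_ _. x"] x
    show "bidual_norm V N 1 (\<lambda>_ _. \<phi> x) \<le> C * N 1 (\<lambda>_ _. x)" by (simp only: mat_in_def simp_thms)
    show "0 \<le> dual_norm V N 1 (\<lambda>_ _. f)" using f by (intro dual_norm_nonneg) (simp add: mat_in_def)
  qed
  finally show ?thesis .
qed

end

context separated
begin

lemma Ty_add: "y \<in> W \<Longrightarrow> y' \<in> W \<Longrightarrow> Ty r s (y + y') = Ty r s y + Ty r s y'"
  by (rule ext) (simp add: Ty_def T_add_right)
lemma Ty_scale: "y \<in> W \<Longrightarrow> Ty r s (cscale c y) = cscale c (Ty r s y)"
  by (rule ext) (simp add: Ty_def T_scale_right cscale_fun_def)

text \<open>Outside the index range \<open>u\<close> is arbitrary, while a sum of matrix units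
  vanishes there. The difference has the empty factorisation, so \<open>\<Phi>\<close> does not see
  it.\<close>

lemma \<Phi>_expand:
  assumes u: "mat_in (tensors V W) n n u"
    and xs: "\<And>r s i. r < n \<Longrightarrow> s < n \<Longrightarrow> i < k r s \<Longrightarrow> xs r s i \<in> V"
    and ys: "\<And>r s i. r < n \<Longrightarrow> s < n \<Longrightarrow> i < k r s \<Longrightarrow> ys r s i \<in> W"
    and u_eq: "\<And>r s. r < n \<Longrightarrow> s < n \<Longrightarrow> u r s = (\<Sum>i<k r s. tens V W (xs r s i) (ys r s i))"
  shows "\<Phi> u = (\<Sum>r<n. \<Sum>s<n. \<Sum>i<k r s. T r s (xs r s i) (ys r s i))" (is "_ = ?l")
proof -
  define u' where "u' = (\<Sum>r<n. \<Sum>s<n. \<Sum>i<k r s. unit_mat r s (tens V W (xs r s i) (ys r s i)))"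
  have u': "mat_in (tensors V W) n n u'"
    unfolding u'_def by (intro tmat_sum_in unit_mat_in xs ys) auto
  have "\<Phi> u' = (\<Sum>r<n. \<Phi> (\<Sum>s<n. \<Sum>i<k r s. unit_mat r s (tens V W (xs r s i) (ys r s i))))"
    unfolding u'_def by (intro \<Phi>_sum tmat_sum_in unit_mat_in xs ys) auto
  also have "\<dots> = (\<Sum>r<n. \<Sum>s<n. \<Phi> (\<Sum>i<k r s. unit_mat r s (tens V W (xs r s i) (ys r s i))))"
    by (intro sum.cong refl \<Phi>_sum tmat_sum_in unit_mat_in xs ys) auto
  also have "\<dots> = ?l"
    unfolding T_def by (intro sum.cong refl \<Phi>_sum unit_mat_in xs ys) auto
  finally have "\<Phi> u' = ?l" .
  have eq: "u' r s = u r s" if "r < n" "s < n" for r s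
  proof -
    have "u' r s z = (\<Sum>r'<n. \<Sum>s'<n. if s' = s then (if r' = r then u r' s' z else 0) else 0)" for z
      unfolding u'_def sum_fun_apply unit_mat_def by (intro sum.cong refl) (auto simp: u_eq sum_fun_apply)
    thus ?thesis using that by (simp add: fun_eq_iff)
  qed
  have d: "mat_in (tensors V W) n n (u + - u')"
    using cv.subspace_add[OF csub_tmat, of u "- u'"] cv.subspace_neg[OF csub_tmat, of u'] u u' by simp
  have "cmod (\<Phi> (u + - u')) \<le> (\<Sum>i<(0::nat). \<Sum>k<(0::nat). qform n H0 (\<lambda>r. 0)) + (\<Sum>i<(0::nat).
      \<Sum>k<(0::nat). qform n H1 (\<lambda>r. 0))"
    by (rule \<Phi>bound[OF d, where x = "\<lambda>_ _. 0" and y = "\<lambda>_ _. 0" and a = "\<lambda>_ _ _. 0" and b = "\<lambda>_ _ _. 0"])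
       (auto simp: proj_rep_def mat_in_def V.N_zero W.N_zero eq)
  hence "\<Phi> (u + - u') = 0" by simp
  moreover have "\<Phi> u = \<Phi> ((u + - u') + u')" by simp
  moreover have "\<Phi> ((u + - u') + u') = \<Phi> (u + - u') + \<Phi> u'"
    using d u' by (intro lin_onD(1)[OF \<Phi>lin]) auto
  ultimately show ?thesis using \<open>\<Phi> u' = ?l\<close> by simp
qed

text \<open>In coordinates of \<open>\<phi>\<close> the sum consists of values of \<open>u0\<close>
  at functionals that annihilate the kernel \<open>K'\<close> of \<open>\<phi>\<close> and a
  subspace \<open>L'\<close> of finite codimension. It therefore depends only on the image of
  \<open>u0\<close> in the quotients and can be computed from any factorisation there; this gives
  \<open>Bval\<close> at the image of \<open>x\<close> under \<open>\<phi>\<close>, where the bidual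
  estimate and the cb-bound of \<open>\<phi>\<close> apply.\<close>

lemma finite_rank_estimate:
  assumes C: "0 \<le> C" and \<phi>: "V.admissible C \<phi>" and u0: "mat_in (tensors V W) n n u0"
    and xs: "\<And>r s i. r < n \<Longrightarrow> s < n \<Longrightarrow> i < k r s \<Longrightarrow> xs r s i \<in> V"
    and ys: "\<And>r s i. r < n \<Longrightarrow> s < n \<Longrightarrow> i < k r s \<Longrightarrow> ys r s i \<in> W"
    and u0_eq: "\<And>r s. r < n \<Longrightarrow> s < n \<Longrightarrow> u0 r s = (\<Sum>i<k r s. tens V W (xs r s i) (ys r s i))"
  shows "cmod (\<Sum>r<n. \<Sum>s<n. \<Sum>i<k r s. \<phi> (xs r s i) (Ty r s (ys r s i))) \<le> 2 * C * cproj V N W M n u0"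
proof -
  let ?S = "\<Sum>r<n. \<Sum>s<n. \<Sum>i<k r s. \<phi> (xs r s i) (Ty r s (ys r s i))"
  interpret D: opspace "dual_carrier V N" "dual_norm V N"
    by unfold_locales (rule V.dual_operator_space)
  have lin: "lin_on V \<phi>" and fr: "finite_rank_on V \<phi>"
    and bid: "\<And>x. x \<in> V \<Longrightarrow> \<phi> x \<in> dual_carrier (dual_carrier V N) (dual_norm V N)"
    using \<phi> by (auto simp: V.admissible_def bidual_carrier_def)
  have cb: "mat_in V p p x \<Longrightarrow> bidual_norm V N p (\<lambda>i j. \<phi> (x i j)) \<le> C * N p x" for p x
    using \<phi> unfolding V.admissible_def cb_le_def by blast
  obtain B F where B: "finite B" "B \<subseteq> \<phi> ` V" and F: "\<And>b. F b \<in> alg_dual V"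
    and exp: "\<And>x. x \<in> V \<Longrightarrow> \<phi> x = (\<Sum>b\<in>B. cscale (F b x) b)"
    and F0: "\<And>b x. \<phi> x = 0 \<Longrightarrow> F b x = 0"
    by (rule finite_rank_coordinates[OF V.csub lin fr]) (rule that)
  have Bbid: "b \<in> dual_carrier (dual_carrier V N) (dual_norm V N)" if "b \<in> B" for b
    using that B(2) bid by blast
  \<comment> \<open>A basis vector of the range, composed with the map \<open>Ty r s\<close>; these
    are bounded functionals on \<open>W\<close>, and \<open>L'\<close> is their common
    kernel.\<close>
  define g :: "(('a \<Rightarrow> complex) \<Rightarrow> complex) \<times> nat \<times> nat \<Rightarrow> 'b \<Rightarrow> complex"
    where "g = (\<lambda>(b, r, s) y. if y \<in> W then b (Ty r s y) else 0)"
  define J where "J = B \<times> {..<n} \<times> {..<n}"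
  have g: "g j \<in> dual_carrier W M" if j: "j \<in> J" for j
  proof -
    obtain b r s where j': "j = (b, r, s)" by (cases j) auto
    have b: "b \<in> B" and rs: "r < n" "s < n" using j j' by (auto simp: J_def)
    note bl = D.dualD(1)[OF Bbid[OF b]]
    obtain Bb where Bb: "Bb \<ge> 0" "\<forall>f\<in>dual_carrier V N. cmod (b f) \<le> Bb * dual_norm V N 1 (\<lambda>_ _. f)"
      using D.dualD(3)[OF Bbid[OF b]] by blast
    obtain c where c: "0 \<le> c" "\<And>x y. x \<in> V \<Longrightarrow> y \<in> W \<Longrightarrow> cmod (T r s x y) \<le> c * N 1 (\<lambda>_ _. x) * M 1 (\<lambda>_ _. y)"
      using T_bounded[OF rs] by blast
    show ?thesis unfolding j'
    proof (rule W.dual_memI)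
      show "lin_on W (g (b, r, s))"
        unfolding lin_on_def g_def using W.add_in W.scale_in lin_onD[OF bl] rs
        by (simp add: Ty_add Ty_scale Ty_dual)
      show "g (b, r, s) y = 0" if "y \<notin> W" for y using that by (simp add: g_def)
      fix y assume y: "y \<in> W"
      have My: "0 \<le> M 1 (\<lambda>_ _. y)" using y by (intro W.N_nonneg) (simp add: mat_in_def)
      have "dual_norm V N 1 (\<lambda>_ _. Ty r s y) \<le> c * M 1 (\<lambda>_ _. y)"
      proof (rule V.dual_norm_one_le[OF Ty_lin[OF y]])
        show "cmod (Ty r s y x) \<le> c * M 1 (\<lambda>_ _. y) * N 1 (\<lambda>_ _. x)" if "x \<in> V" for x
          using c(2)[OF that y] that by (simp add: Ty_def mult_ac)
      qed (use c(1) My in simp)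
      hence "Bb * dual_norm V N 1 (\<lambda>_ _. Ty r s y) \<le> Bb * (c * M 1 (\<lambda>_ _. y))"
        using Bb(1) by (rule mult_left_mono)
      moreover have "cmod (b (Ty r s y)) \<le> Bb * dual_norm V N 1 (\<lambda>_ _. Ty r s y)"
        using Bb(2) Ty_dual[OF y rs] by blast
      ultimately show "cmod (g (b, r, s) y) \<le> (Bb * c) * M 1 (\<lambda>_ _. y)" using y by (simp add: g_def mult_ac)
    qed
  qed
  define K' where "K' = {x\<in>V. \<forall>b\<in>B. F b x = 0}"
  define L' where "L' = {y\<in>W. \<forall>j\<in>J. g j y = 0}"
  have L: "cofinite_sub W M L'"
    unfolding L'_def by (rule W.cofinite_kernel_bounded[OF _ g]) (use B in \<open>auto simp: J_def\<close>)
  \<comment> \<open>A limit of points of \<open>K'\<close> is sent to \<open>0\<close> by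
    \<open>\<phi>\<close>, because each evaluation of \<open>\<phi>\<close> is bounded, and the
    coordinates vanish where \<open>\<phi>\<close> does.\<close>
  have K: "cofinite_sub V N K'"
    unfolding K'_def
  proof (rule V.cofinite_subI[OF B(1)])
    show "lin_on V (F b)" for b using F[of b] by (simp add: alg_dual_def)
    fix x assume x: "x \<in> V" and ap: "\<And>e. e > 0 \<Longrightarrow> \<exists>k\<in>{x\<in>V. \<forall>b\<in>B. F b x = 0}. N 1 (\<lambda>_ _. x - k) < e"
    have "\<phi> x f = 0" for f
    proof (cases "f \<in> dual_carrier V N")
      case False
      thus ?thesis using D.dualD(2)[OF bid[OF x]] by blast
    next
      case f: True
      have f0: "0 \<le> dual_norm V N 1 (\<lambda>_ _. f)" using f by (intro V.dual_norm_nonneg) (simp add: mat_in_def)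
      show ?thesis
      proof (rule V.small_bound_zero)
        show "0 \<le> C * dual_norm V N 1 (\<lambda>_ _. f)" using C f0 by simp
        fix e :: real assume "e > 0"
        then obtain k where k: "k \<in> V" "\<forall>b\<in>B. F b k = 0" "N 1 (\<lambda>_ _. x - k) < e" using ap by blast
        have "\<phi> k = 0" using exp[OF k(1)] k(2) by simp
        moreover have xk: "x - k \<in> V" using x k by (intro cv.subspace_diff[OF V.sub])
        ultimately have "\<phi> x = \<phi> (x - k)" using lin_onD(1)[OF lin xk k(1)] by simp
        hence "cmod (\<phi> x f) \<le> C * N 1 (\<lambda>_ _. x - k) * dual_norm V N 1 (\<lambda>_ _. f)"
          using V.admissible_eval_bound[OF \<phi> xk f] by simp
        also have "\<dots> \<le> C * e * dual_norm V N 1 (\<lambda>_ _. f)"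
          using k(3) C f0 by (intro mult_right_mono mult_left_mono) auto
        finally show "cmod (\<phi> x f) \<le> C * dual_norm V N 1 (\<lambda>_ _. f) * e" by (simp add: mult_ac)
      qed
    qed
    hence "\<phi> x = 0" by (simp add: fun_eq_iff)
    thus "\<forall>b\<in>B. F b x = 0" using F0 by blast
  qed
  interpret Q: opspace_pair V N W M K' L'
    by unfold_locales (use K L in \<open>auto simp: cofinite_sub_def\<close>)
  have FK: "F b \<in> annih V K'" if "b \<in> B" for b using F that by (auto simp: annih_def K'_def)
  have gL: "g j \<in> annih W L'" if "j \<in> J" for j
    using W.dualD[OF g[OF that]] that by (auto simp: annih_def alg_dual_def L'_def)
  have S: "?S = (\<Sum>r<n. \<Sum>s<n. \<Sum>b\<in>B. u0 r s (F b, g (b, r, s)))"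
  proof (rule sum.cong[OF refl], rule sum.cong[OF refl])
    fix r s assume rs: "r \<in> {..<n}" "s \<in> {..<n}"
    have "(\<Sum>i<k r s. \<phi> (xs r s i) (Ty r s (ys r s i))) = (\<Sum>i<k r s. \<Sum>b\<in>B. F b (xs r s i) * g (b, r, s)
        (ys r s i))"
      using rs xs ys by (intro sum.cong refl) (simp add: exp sum_fun_apply cscale_fun_def g_def)
    also have "\<dots> = (\<Sum>b\<in>B. \<Sum>i<k r s. F b (xs r s i) * g (b, r, s) (ys r s i))" by (rule sum.swap)
    also have "\<dots> = (\<Sum>b\<in>B. u0 r s (F b, g (b, r, s)))"
    proof (rule sum.cong[OF refl])
      fix b assume b: "b \<in> B"
      have "F b \<in> alg_dual V" "g (b, r, s) \<in> alg_dual W"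
        using FK[OF b] gL[of "(b, r, s)"] b rs annih_subset by (auto simp: J_def)
      thus "(\<Sum>i<k r s. F b (xs r s i) * g (b, r, s) (ys r s i)) = u0 r s (F b, g (b, r, s))"
        using rs by (simp add: u0_eq sum_fun_apply tens_def)
    qed
    finally show "(\<Sum>i<k r s. \<phi> (xs r s i) (Ty r s (ys r s i))) = (\<Sum>b\<in>B. u0 r s (F b, g (b, r, s)))" .
  qed
  have "cmod ?S \<le> (2 * C) * proj_q V N K' W M L' n u0"
  proof (rule Q.proj_q_ge[OF Q.proj_rep_exists[OF u0]])
    show "0 \<le> 2 * C" using C by simp
    fix p q a b x y \<alpha> \<beta>
    assume rep: "proj_rep V K' W L' n u0 p q a b x y" and xy: "N p x \<le> 1" "M q y \<le> 1"
      and \<alpha>: "0 \<le> \<alpha>" "\<And>v. rowsq n p q a v \<le> \<alpha>\<^sup>2 * vnorm2 n v"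
      and \<beta>: "0 \<le> \<beta>" "\<And>v. rowsq n p q b v \<le> \<beta>\<^sup>2 * vnorm2 n v"
    have x: "mat_in V p p x" and y: "mat_in W q q y" using rep by (auto simp: proj_rep_def)
    have xin: "i < p \<Longrightarrow> j < p \<Longrightarrow> x i j \<in> V" for i j using x by (simp add: mat_in_def)
    have yin: "i < q \<Longrightarrow> j < q \<Longrightarrow> y i j \<in> W" for i j using y by (simp add: mat_in_def)
    have "?S = (\<Sum>r<n. \<Sum>s<n. \<Sum>b'\<in>B. \<Sum>i<p. \<Sum>k<q. \<Sum>j<p. \<Sum>l<q. a r i k * b s j l * (F b' (x i j) * g (b', r,
        s) (y k l)))"
      unfolding S using rep FK gL by (intro sum.cong refl) (simp add: proj_rep_def J_def)
    also have "\<dots> = Bval p q a b (\<lambda>i j. \<phi> (x i j)) y"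
      unfolding Bval_def
    proof (rule sum.cong[OF refl], rule sum.cong[OF refl])
      fix r s assume rs: "r \<in> {..<n}" "s \<in> {..<n}"
      let ?h = "\<lambda>b' i k j l. a r i k * b s j l * (F b' (x i j) * g (b', r, s) (y k l))"
      have "(\<Sum>b'\<in>B. \<Sum>i<p. \<Sum>k<q. \<Sum>j<p. \<Sum>l<q. ?h b' i k j l) = (\<Sum>i<p. \<Sum>k<q. \<Sum>j<p. \<Sum>l<q. \<Sum>b'\<in>B. ?h b' i k j l)"
        unfolding sum.cartesian_product
        by (rule sum.reindex_bij_witness[of _ "\<lambda>(i, k, j, l, b'). (b', i, k, j, l)" "\<lambda>(b', i, k, j, l).
            (i, k, j, l, b')"]) auto
      also have "\<dots> = (\<Sum>i<p. \<Sum>k<q. \<Sum>j<p. \<Sum>l<q. a r i k * b s j l * \<phi> (x i j) (Ty r s (y k l)))"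
        by (intro sum.cong refl)
           (simp add: exp xin yin sum_fun_apply cscale_fun_def g_def sum_distrib_left)
      finally show "(\<Sum>b'\<in>B. \<Sum>i<p. \<Sum>k<q. \<Sum>j<p. \<Sum>l<q. ?h b' i k j l) =
         (\<Sum>i<p. \<Sum>k<q. \<Sum>j<p. \<Sum>l<q. a r i k * b s j l * \<phi> (x i j) (Ty r s (y k l)))" .
    qed
    finally have "cmod ?S = cmod (Bval p q a b (\<lambda>i j. \<phi> (x i j)) y)" by simp
    also have "\<dots> \<le> 2 * bidual_norm V N p (\<lambda>i j. \<phi> (x i j)) * (\<alpha> * \<beta>)"
      by (rule bidual_estimate[OF _ y xy(2) \<alpha> \<beta>])
         (use xin bid in \<open>auto simp: mat_in_def bidual_carrier_def\<close>)
    also have "\<dots> \<le> 2 * C * (\<alpha> * \<beta>)"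
    proof -
      have "bidual_norm V N p (\<lambda>i j. \<phi> (x i j)) \<le> C * N p x" by (rule cb[OF x])
      also have "\<dots> \<le> C" using xy(1) C by (simp add: mult_left_le)
      finally show ?thesis using \<alpha>(1) \<beta>(1) by (intro mult_right_mono) auto
    qed
    finally show "cmod ?S \<le> 2 * C * (\<alpha> * \<beta>)" .
  qed
  also have "\<dots> \<le> 2 * C * cproj V N W M n u0"
    using C cproj_upper[OF u0 K L] by (intro mult_left_mono) auto
  finally show ?thesis .
qed

end

text \<open>For a functional norming \<open>u\<close>, weak-star convergence at finitely many pairs
  carries the finite-rank estimate over to \<open>\<Phi> u\<close>. The factor \<open>2\<close> of
  the separation theorem appears on both sides and cancels.\<close>

theorem wcbap_imp_id_cb_le:
  fixes V :: "'a::cvec set" and W :: "'b::cvec set"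
  assumes V: "operator_space V N" and W: "operator_space W M" and C: "0 \<le> C" and ap: "wcbap V N C"
  shows "id_cb_le V N W M C"
  unfolding id_cb_le_def
proof (intro allI impI)
  fix n and u :: "('a, 'b) tmat" assume u: "mat_in (tensors V W) n n u"
  interpret opspaces V N W M by unfold_locales (use V W in auto)
  show "proj V N W M n u \<le> C * cproj V N W M n u"
  proof (cases "n = 0")
    case True
    have "proj V N W M n u \<le> 0" unfolding True by (rule proj_0_le)
    also have "\<dots> \<le> C * cproj V N W M n u" using C cproj_nonneg[OF u] by simp
    finally show ?thesis .
  next
    case False
    hence n: "0 < n" by simp
    obtain \<Phi> H0 H1 where sep: "separated V N W M {0} {0} n \<Phi> H0 H1"
      and big: "2 * proj_q V N {0} W M {0} n u \<le> Re (\<Phi> u)"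
      by (rule P0.separation[OF n u]) (rule that)
    interpret S: separated V N W M "{0}" "{0}" n \<Phi> H0 H1 by (rule sep)
    obtain k :: "nat \<Rightarrow> nat \<Rightarrow> nat" and xs ys where
      xs: "\<And>r s i. r < n \<Longrightarrow> s < n \<Longrightarrow> i < k r s \<Longrightarrow> xs r s i \<in> V" and
      ys: "\<And>r s i. r < n \<Longrightarrow> s < n \<Longrightarrow> i < k r s \<Longrightarrow> ys r s i \<in> W" and
      u_eq: "\<And>r s. r < n \<Longrightarrow> s < n \<Longrightarrow> u r s = (\<Sum>i<k r s. tens V W (xs r s i) (ys r s i))"
      by (rule P0.tmat_as_sum[OF u]) (rule that)
    obtain Fi :: "('a \<Rightarrow> ('a \<Rightarrow> complex) \<Rightarrow> complex) filter" where Fi: "Fi \<noteq> bot"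
      "eventually (\<lambda>\<phi>. V.admissible C \<phi>) Fi"
      "\<And>x f. x \<in> V \<Longrightarrow> f \<in> dual_carrier V N \<Longrightarrow> ((\<lambda>\<phi>. \<phi> x f) \<longlongrightarrow> kappa V N x f) Fi"
      using ap unfolding wcbap_def V.admissible_def[abs_def] by blast
    let ?S = "\<lambda>\<phi>. \<Sum>r<n. \<Sum>s<n. \<Sum>i<k r s. \<phi> (xs r s i) (S.Ty r s (ys r s i))"
    let ?l = "\<Sum>r<n. \<Sum>s<n. \<Sum>i<k r s. S.T r s (xs r s i) (ys r s i)"
    have "(?S \<longlongrightarrow> ?l) Fi"
    proof (intro tendsto_sum)
      fix r s i assume "r \<in> {..<n}" "s \<in> {..<n}" "i \<in> {..<k r s}"
      hence *: "r < n" "s < n" "xs r s i \<in> V" "ys r s i \<in> W" using xs ys by auto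
      have Ty: "S.Ty r s (ys r s i) \<in> dual_carrier V N" using * by (intro S.Ty_dual)
      have "kappa V N (xs r s i) (S.Ty r s (ys r s i)) = S.T r s (xs r s i) (ys r s i)"
        using Ty *(3) by (simp add: kappa_def S.Ty_def)
      with Fi(3)[OF *(3) Ty]
      show "((\<lambda>\<phi>. \<phi> (xs r s i) (S.Ty r s (ys r s i))) \<longlongrightarrow> S.T r s (xs r s i) (ys r s i)) Fi" by simp
    qed
    hence "((\<lambda>\<phi>. cmod (?S \<phi>)) \<longlongrightarrow> cmod ?l) Fi" by (rule tendsto_norm)
    moreover have "eventually (\<lambda>\<phi>. cmod (?S \<phi>) \<le> 2 * C * cproj V N W M n u) Fi"
      using Fi(2) by (rule eventually_mono) (rule S.finite_rank_estimate[OF C _ u xs ys u_eq])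
    ultimately have le: "cmod ?l \<le> 2 * C * cproj V N W M n u"
      by (rule tendsto_upperbound) (rule Fi(1))
    have "\<Phi> u = ?l" by (rule S.\<Phi>_expand[OF u xs ys u_eq])
    hence "2 * proj_q V N {0} W M {0} n u \<le> cmod ?l"
      using big complex_Re_le_cmod[of "\<Phi> u"] by simp
    with le show ?thesis by (simp add: proj_def)
  qed
qed

section \<open>From the projective norm to approximations of the identity\<close>

text \<open>From a Hamel basis only the vectors occurring in \<open>X\<close> are kept, while the
  coordinate functionals are defined on all of \<open>V\<close>.\<close>

lemma finite_coordinates:
  fixes X :: "'a::cvec set"
  assumes V: "csubspace V" and X: "finite X" "X \<subseteq> V"
  obtains B F where "finite B" "B \<subseteq> V" "\<And>b. F b \<in> alg_dual V" "\<And>x. x \<in> X \<Longrightarrow> x = (\<Sum>b\<in>B. cscale (F b x) b)"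
proof -
  have sV: "cv.subspace V" using V by (simp add: csubspace_iff_subspace)
  obtain B0 where B0: "B0 \<subseteq> V" "cv.independent B0" "V \<subseteq> cv.span B0"
    using cv.maximal_independent_subset by blast
  define F where "F = (\<lambda>b x. if x \<in> V then cv.representation B0 x b else 0)"
  define B where "B = (\<Union>x\<in>X. {b. cv.representation B0 x b \<noteq> 0})"
  show thesis
  proof (rule that[of B F])
    show fB: "finite B" unfolding B_def using X by (intro finite_UN_I cv.finite_representation) auto
    show "B \<subseteq> V" unfolding B_def using B0(1) cv.representation_ne_zero by blast
    show "F b \<in> alg_dual V" for b
      unfolding alg_dual_def lin_on_def
    proof (intro CollectI conjI ballI allI impI)
      fix x y assume xy: "x \<in> V" "y \<in> V"
      have "x \<in> cv.span B0" "y \<in> cv.span B0" using B0(3) xy by auto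
      thus "F b (x + y) = F b x + F b y"
        using xy cv.subspace_add[OF sV xy] cv.representation_add[OF B0(2)] by (simp add: F_def)
    next
      fix c x assume x: "x \<in> V"
      have "x \<in> cv.span B0" using B0(3) x by auto
      thus "F b (cscale c x) = cscale c (F b x)"
        using x cv.subspace_scale[OF sV x] cv.representation_scale[OF B0(2)] by (simp add: F_def)
    qed (simp add: F_def)
    fix x assume x: "x \<in> X"
    have xV: "x \<in> V" using x X by auto
    have "x = (\<Sum>b | cv.representation B0 x b \<noteq> 0. cscale (cv.representation B0 x b) b)"
      using cv.sum_nonzero_representation_eq[OF B0(2), of x] B0(3) xV by auto
    also have "\<dots> = (\<Sum>b\<in>B. cscale (F b x) b)"
      using xV x by (intro sum.mono_neutral_cong_left fB) (auto simp: F_def B_def)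
    finally show "x = (\<Sum>b\<in>B. cscale (F b x) b)" .
  qed
qed

text \<open>The algebraic duals separate the algebraic tensor product, so a bilinear form is
  determined by the values of a tensor on pairs of functionals.\<close>
lemma bilinear_well_defined:
  fixes V :: "'a::cvec set" and W :: "'b::cvec set" and T :: "'a \<Rightarrow> 'b \<Rightarrow> complex"
  assumes V: "csubspace V" and W: "csubspace W"
    and T1: "\<And>y. y \<in> W \<Longrightarrow> lin_on V (\<lambda>x. T x y)" and T2: "\<And>x. x \<in> V \<Longrightarrow> lin_on W (T x)"
    and I: "finite I" and x: "\<And>i. i \<in> I \<Longrightarrow> x i \<in> V" and y: "\<And>i. i \<in> I \<Longrightarrow> y i \<in> W"
    and J: "finite J" and x': "\<And>i. i \<in> J \<Longrightarrow> x' i \<in> V" and y': "\<And>i. i \<in> J \<Longrightarrow> y' i \<in> W"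
    and eq: "\<And>f g. f \<in> alg_dual V \<Longrightarrow> g \<in> alg_dual W \<Longrightarrow>
      (\<Sum>i\<in>I. c i * (f (x i) * g (y i))) = (\<Sum>i\<in>J. c' i * (f (x' i) * g (y' i)))"
  shows "(\<Sum>i\<in>I. c i * T (x i) (y i)) = (\<Sum>i\<in>J. c' i * T (x' i) (y' i))"
proof -
  have sV: "cv.subspace V" and sW: "cv.subspace W" using V W by (simp_all add: csubspace_iff_subspace)
  obtain B F where B: "finite B" "B \<subseteq> V" "\<And>b. F b \<in> alg_dual V"
    "\<And>z. z \<in> x ` I \<union> x' ` J \<Longrightarrow> z = (\<Sum>b\<in>B. cscale (F b z) b)"
    by (rule finite_coordinates[OF V, of "x ` I \<union> x' ` J"]) (use I J x x' in auto)
  obtain B' F' where B': "finite B'" "B' \<subseteq> W" "\<And>b. F' b \<in> alg_dual W"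
    "\<And>z. z \<in> y ` I \<union> y' ` J \<Longrightarrow> z = (\<Sum>b\<in>B'. cscale (F' b z) b)"
    by (rule finite_coordinates[OF W, of "y ` I \<union> y' ` J"]) (use I J y y' in auto)
  have T: "T u v = (\<Sum>b\<in>B. \<Sum>b'\<in>B'. T b b' * (F b u * F' b' v))"
    if u: "u \<in> x ` I \<union> x' ` J" and v: "v \<in> y ` I \<union> y' ` J" for u v
  proof -
    have vW: "v \<in> W" using v y y' by auto
    have "T u v = T (\<Sum>b\<in>B. cscale (F b u) b) v" using B(4)[OF u] by simp
    also have "\<dots> = (\<Sum>b\<in>B. T (cscale (F b u) b) v)"
      using B(2) by (intro lin_on_sum[OF T1[OF vW] V] cv.subspace_scale[OF sV]) auto
    also have "\<dots> = (\<Sum>b\<in>B. F b u * T b v)"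
      using B(2) by (intro sum.cong refl) (auto simp: lin_onD(2)[OF T1[OF vW]])
    also have "\<dots> = (\<Sum>b\<in>B. F b u * (\<Sum>b'\<in>B'. F' b' v * T b b'))"
    proof (rule sum.cong[OF refl])
      fix b assume b: "b \<in> B"
      hence bV: "b \<in> V" using B(2) by auto
      have "T b v = T b (\<Sum>b'\<in>B'. cscale (F' b' v) b')" using B'(4)[OF v] by simp
      also have "\<dots> = (\<Sum>b'\<in>B'. T b (cscale (F' b' v) b'))"
        using B'(2) by (intro lin_on_sum[OF T2[OF bV] W] cv.subspace_scale[OF sW]) auto
      also have "\<dots> = (\<Sum>b'\<in>B'. F' b' v * T b b')"
        using B'(2) by (intro sum.cong refl) (auto simp: lin_onD(2)[OF T2[OF bV]])
      finally show "F b u * T b v = F b u * (\<Sum>b'\<in>B'. F' b' v * T b b')" by simp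
    qed
    finally show ?thesis by (simp add: sum_distrib_left mult_ac)
  qed
  have ex: "(\<Sum>i\<in>I. c i * T (x i) (y i)) = (\<Sum>b\<in>B. \<Sum>b'\<in>B'. T b b' * (\<Sum>i\<in>I. c i * (F b (x i) * F' b' (y i))))"
  proof -
    have "(\<Sum>i\<in>I. c i * T (x i) (y i)) = (\<Sum>i\<in>I. \<Sum>b\<in>B. \<Sum>b'\<in>B'. T b b' * (c i * (F b (x i) * F' b' (y i))))"
      by (intro sum.cong refl) (simp add: T sum_distrib_left mult_ac)
    also have "\<dots> = (\<Sum>b\<in>B. \<Sum>b'\<in>B'. \<Sum>i\<in>I. T b b' * (c i * (F b (x i) * F' b' (y i))))"
      by (subst sum.swap, rule sum.cong[OF refl], rule sum.swap)
    finally show ?thesis by (simp only: sum_distrib_left)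
  qed
  have ex': "(\<Sum>i\<in>J. c' i * T (x' i) (y' i)) = (\<Sum>b\<in>B. \<Sum>b'\<in>B'. T b b' * (\<Sum>i\<in>J. c' i * (F b (x' i) * F' b'
      (y' i))))"
  proof -
    have "(\<Sum>i\<in>J. c' i * T (x' i) (y' i)) = (\<Sum>i\<in>J. \<Sum>b\<in>B. \<Sum>b'\<in>B'. T b b' * (c' i * (F b (x' i) * F' b' (y'
        i))))"
      by (intro sum.cong refl) (simp add: T sum_distrib_left mult_ac)
    also have "\<dots> = (\<Sum>b\<in>B. \<Sum>b'\<in>B'. \<Sum>i\<in>J. T b b' * (c' i * (F b (x' i) * F' b' (y' i))))"
      by (subst sum.swap, rule sum.cong[OF refl], rule sum.swap)
    finally show ?thesis by (simp only: sum_distrib_left)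
  qed
  show ?thesis unfolding ex ex' using eq B(3) B'(3) by simp
qed

lemma finite_rank_on_iff_span:
  "finite_rank_on V \<phi> \<longleftrightarrow> (\<exists>T. finite T \<and> \<phi> ` V \<subseteq> cv.span T)"
  unfolding finite_rank_on_def
  by (rule ex_cong1, rule conj_cong[OF refl]) (simp add: cv.span_finite image_subset_iff image_iff)

section \<open>Sums and multiples of finite-rank maps\<close>

context opspace
begin

lemma admissible_add:
  assumes \<phi>: "admissible C \<phi>" and \<psi>: "admissible D \<psi>"
  shows "admissible (C + D) (\<phi> + \<psi>)"
proof -
  interpret E: opspace "dual_carrier V N" "dual_norm V N"
    by unfold_locales (rule dual_operator_space)
  interpret E2: opspace "bidual_carrier V N" "bidual_norm V N"
    unfolding bidual_carrier_def bidual_norm_def by unfold_locales (rule E.dual_operator_space)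
  have bid: "\<And>x. x \<in> V \<Longrightarrow> \<phi> x \<in> bidual_carrier V N" "\<And>x. x \<in> V \<Longrightarrow> \<psi> x \<in> bidual_carrier V N"
    and lin: "lin_on V \<phi>" "lin_on V \<psi>"
    using \<phi> \<psi> by (auto simp: admissible_def)
  show ?thesis
    unfolding admissible_def
  proof (intro conjI)
    show "lin_on V (\<phi> + \<psi>)" using lin unfolding lin_on_def by (simp add: cscale_add_right)
    show "(\<phi> + \<psi>) ` V \<subseteq> bidual_carrier V N" using bid E2.add_in by auto
    obtain T T' where T: "finite T" "\<phi> ` V \<subseteq> cv.span T" "finite T'" "\<psi> ` V \<subseteq> cv.span T'"
      using \<phi> \<psi> by (auto simp: admissible_def finite_rank_on_iff_span)
    have "(\<phi> + \<psi>) ` V \<subseteq> cv.span (T \<union> T')"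
      using T(2,4) cv.span_mono[of T "T \<union> T'"] cv.span_mono[of T' "T \<union> T'"]
      by (auto intro!: cv.span_add)
    thus "finite_rank_on V (\<phi> + \<psi>)" unfolding finite_rank_on_iff_span using T by (intro exI[of _ "T \<union>
        T'"]) auto
    show "cb_le V N (bidual_norm V N) (C + D) (\<phi> + \<psi>)"
      unfolding cb_le_def
    proof (intro allI impI)
      fix n x assume x: "mat_in V n n x"
      have "bidual_norm V N n (\<lambda>i j. (\<phi> + \<psi>) (x i j)) \<le> bidual_norm V N n (\<lambda>i j. \<phi> (x i j)) +
          bidual_norm V N n (\<lambda>i j. \<psi> (x i j))"
        using E2.N_triangle[of n "\<lambda>i j. \<phi> (x i j)" "\<lambda>i j. \<psi> (x i j)"] x bid by (simp add: mat_in_def)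
      also have "\<dots> \<le> C * N n x + D * N n x"
        using \<phi> \<psi> x unfolding admissible_def cb_le_def by (intro add_mono) blast+
      finally show "bidual_norm V N n (\<lambda>i j. (\<phi> + \<psi>) (x i j)) \<le> (C + D) * N n x" by (simp add: distrib_right)
    qed
  qed
qed

lemma admissible_scale:
  assumes \<phi>: "admissible C \<phi>" and t: "0 \<le> t"
  shows "admissible (t * C) (cscale (of_real t) \<phi>)"
proof -
  interpret E: opspace "dual_carrier V N" "dual_norm V N"
    by unfold_locales (rule dual_operator_space)
  interpret E2: opspace "bidual_carrier V N" "bidual_norm V N"
    unfolding bidual_carrier_def bidual_norm_def by unfold_locales (rule E.dual_operator_space)
  have bid: "\<And>x. x \<in> V \<Longrightarrow> \<phi> x \<in> bidual_carrier V N" and lin: "lin_on V \<phi>"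
    using \<phi> by (auto simp: admissible_def)
  have app: "cscale (of_real t) \<phi> x = cscale (of_real t) (\<phi> x)" for x by (simp add: cscale_fun_def)
  show ?thesis
    unfolding admissible_def
  proof (intro conjI)
    show "lin_on V (cscale (of_real t) \<phi>)"
      unfolding lin_on_def app using lin_onD[OF lin] by (simp add: cscale_add_right cscale_cscale
          mult.commute)
    show "cscale (of_real t) \<phi> ` V \<subseteq> bidual_carrier V N" unfolding image_subset_iff app using bid
        E2.scale_in by blast
    obtain T where T: "finite T" "\<phi> ` V \<subseteq> cv.span T"
      using \<phi> by (auto simp: admissible_def finite_rank_on_iff_span)
    have "cscale (of_real t) \<phi> ` V \<subseteq> cv.span T" unfolding image_subset_iff app using T(2) cv.span_scale
        by blast
    thus "finite_rank_on V (cscale (of_real t) \<phi>)" unfolding finite_rank_on_iff_span using T by blast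
    show "cb_le V N (bidual_norm V N) (t * C) (cscale (of_real t) \<phi>)"
      unfolding cb_le_def app
    proof (intro allI impI)
      fix n x assume x: "mat_in V n n x"
      have "bidual_norm V N n (\<lambda>i j. cscale (of_real t) (\<phi> (x i j))) \<le> cmod (of_real t) * bidual_norm V
          N n (\<lambda>i j. \<phi> (x i j))"
        using x bid by (intro E2.N_scale) (simp add: mat_in_def)
      also have "\<dots> = t * bidual_norm V N n (\<lambda>i j. \<phi> (x i j))" using t by simp
      also have "\<dots> \<le> t * (C * N n x)"
        using \<phi> x t unfolding admissible_def cb_le_def by (intro mult_left_mono) blast+
      finally show "bidual_norm V N n (\<lambda>i j. cscale (of_real t) (\<phi> (x i j))) \<le> t * C * N n x" by (simp
          add: mult.assoc)
    qed
  qed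
qed

lemma admissible_mono: "admissible C \<phi> \<Longrightarrow> C \<le> D \<Longrightarrow> admissible D \<phi>"
  unfolding admissible_def cb_le_def by (meson N_nonneg mult_right_mono order_trans)

lemma admissible_zero: "admissible 0 0"
proof -
  interpret E: opspace "dual_carrier V N" "dual_norm V N"
    by unfold_locales (rule dual_operator_space)
  interpret E2: opspace "bidual_carrier V N" "bidual_norm V N"
    unfolding bidual_carrier_def bidual_norm_def by unfold_locales (rule E.dual_operator_space)
  have "bidual_norm V N n (\<lambda>i j. 0) = 0" for n by (rule E2.N_zero)
  moreover have "finite_rank_on V (0 :: 'a \<Rightarrow> ('a \<Rightarrow> complex) \<Rightarrow> complex)"
    unfolding finite_rank_on_iff_span by (intro exI[of _ "{}"]) (auto simp: cv.span_zero)
  ultimately show ?thesis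
    using E2.zero_in by (simp add: admissible_def lin_on_def cb_le_def image_subset_iff
        zero_fun_def[symmetric])
qed

end

text \<open>A completely isometric copy of the dual in any type. It covers both the dual itself,
  with \<open>j = id\<close>, and the copy in the type of the universally quantified spaces.\<close>

locale dual_copy = opspaces V N W M
  for V :: "'a::cvec set" and N and W :: "'b::cvec set" and M +
  fixes j :: "('a \<Rightarrow> complex) \<Rightarrow> 'b" and j' :: "'b \<Rightarrow> 'a \<Rightarrow> complex"
  assumes j_in: "\<And>f. f \<in> dual_carrier V N \<Longrightarrow> j f \<in> W" and j'j: "\<And>f. f \<in> dual_carrier V N \<Longrightarrow> j' (j f) = f"
    and j'_in: "\<And>y. y \<in> W \<Longrightarrow> j' y \<in> dual_carrier V N"
    and j_lin: "lin_on (dual_carrier V N) j" and j'_lin: "lin_on W j'"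
    and M_eq: "\<And>q y. mat_in W q q y \<Longrightarrow> M q y = dual_norm V N q (\<lambda>i j. j' (y i j))"
begin

text \<open>The trace corresponds to the identity of the dual. On a factorisation it is the pairing
  of a matrix over the dual with a matrix over \<open>V\<close>, which \<open>dual_norm\<close>
  bounds by definition.\<close>

lemma trace_le_proj:
  fixes m :: nat
  assumes xs: "\<And>i. i < m \<Longrightarrow> xs i \<in> V" and fs: "\<And>i. i < m \<Longrightarrow> fs i \<in> dual_carrier V N"
  shows "cmod (\<Sum>i<m. fs i (xs i)) \<le> proj V N W M 1 (\<lambda>_ _. \<Sum>i<m. tens V W (xs i) (j (fs i)))"
proof -
  let ?u = "\<lambda>(_::nat) (_::nat). \<Sum>i<m. tens V W (xs i) (j (fs i))"
  have u: "mat_in (tensors V W) 1 1 ?u"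
    using sum_tens_in_tensors[of m xs V "\<lambda>i. j (fs i)" W] xs fs j_in by (simp add: mat_in_def)
  have "cmod (\<Sum>i<m. fs i (xs i)) \<le> 1 * proj_q V N {0} W M {0} 1 ?u"
  proof (rule P0.proj_q_ge[OF P0.proj_rep_exists[OF u]])
    fix p q a b x y \<alpha> \<beta>
    assume rep: "proj_rep V {0} W {0} 1 ?u p q a b x y" and xy: "N p x \<le> 1" "M q y \<le> 1"
      and \<alpha>: "0 \<le> \<alpha>" "\<And>v. rowsq 1 p q a v \<le> \<alpha>\<^sup>2 * vnorm2 1 v"
      and \<beta>: "0 \<le> \<beta>" "\<And>v. rowsq 1 p q b v \<le> \<beta>\<^sup>2 * vnorm2 1 v"
    have x: "mat_in V p p x" and y: "mat_in W q q y" using rep by (auto simp: proj_rep_def)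
    let ?J = "{..<p} \<times> {..<q} \<times> {..<p} \<times> {..<q}"
    \<comment> \<open>The trace depends only on the tensor, so it can be computed from the
      factorisation.\<close>
    have "(\<Sum>i<m. 1 * j' (j (fs i)) (xs i)) =
        (\<Sum>(i, k, jj, l)\<in>?J. a 0 i k * b 0 jj l * j' (y k l) (x i jj))"
    proof -
      have "(\<Sum>i<m. 1 * (\<lambda>x y. j' y x) (xs i) (j (fs i))) =
        (\<Sum>z\<in>?J. (\<lambda>(i, k, jj, l). a 0 i k * b 0 jj l) z * (\<lambda>x y. j' y x) ((\<lambda>(i, k, jj, l). x i jj) z)
            ((\<lambda>(i, k, jj, l). y k l) z))"
      proof (rule bilinear_well_defined[OF V.csub W.csub])
        show "lin_on V (\<lambda>x. j' y x)" if "y \<in> W" for y using V.dualD(1)[OF j'_in[OF that]] .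
        show "lin_on W (\<lambda>y. j' y x)" for x
          using lin_onD[OF j'_lin] by (simp add: lin_on_def cscale_fun_def)
        show "xs i \<in> V" "j (fs i) \<in> W" if "i \<in> {..<m}" for i using that xs fs j_in by auto
        show "(\<lambda>(i, k, jj, l). x i jj) z \<in> V" "(\<lambda>(i, k, jj, l). y k l) z \<in> W" if "z \<in> ?J" for z
          using that x y by (auto simp: mat_in_def)
        fix f g assume fg: "f \<in> alg_dual V" "g \<in> alg_dual W"
        have "(\<Sum>i<m. 1 * (f (xs i) * g (j (fs i)))) = ?u 0 0 (f, g)"
          using fg by (simp add: sum_fun_apply tens_def)
        also have "\<dots> = (\<Sum>i<p. \<Sum>k<q. \<Sum>jj<p. \<Sum>l<q. a 0 i k * b 0 jj l * (f (x i jj) * g (y k l)))"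
          using rep fg unfolding proj_rep_def annih_zero[OF V.csub] annih_zero[OF W.csub] by blast
        also have "\<dots> = (\<Sum>z\<in>?J. (\<lambda>(i, k, jj, l). a 0 i k * b 0 jj l) z *
            (f ((\<lambda>(i, k, jj, l). x i jj) z) * g ((\<lambda>(i, k, jj, l). y k l) z)))"
          unfolding sum.cartesian_product by (intro sum.cong refl) auto
        finally show "(\<Sum>i<m. 1 * (f (xs i) * g (j (fs i)))) = (\<Sum>z\<in>?J. (\<lambda>(i, k, jj, l). a 0 i k * b 0 jj l) z *
            (f ((\<lambda>(i, k, jj, l). x i jj) z) * g ((\<lambda>(i, k, jj, l). y k l) z)))" .
      qed auto
      thus ?thesis by (simp add: case_prod_beta)
    qed
    also have "\<dots> = bform p q (a 0) (\<lambda>i k jj l. j' (y k l) (x i jj)) (b 0)"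
      unfolding bform_def sum.cartesian_product by (intro sum.cong refl) auto
    finally have "cmod (\<Sum>i<m. fs i (xs i)) = cmod (bform p q (a 0) (\<lambda>i k jj l. j' (y k l) (x i jj)) (b 0))"
      using j'j fs by simp
    also have "\<dots> \<le> dual_norm V N q (\<lambda>k l. j' (y k l)) * N p x * sqrt (mnorm2 p q (a 0)) * sqrt (mnorm2 p
        q (b 0))"
      by (rule V.dual_norm_pairing[OF _ x]) (use y j'_in in \<open>auto simp: mat_in_def\<close>)
    also have "\<dots> \<le> 1 * 1 * \<alpha> * \<beta>"
    proof -
      have "mnorm2 p q (a 0) \<le> \<alpha>\<^sup>2" "mnorm2 p q (b 0) \<le> \<beta>\<^sup>2"
        using \<alpha>(2)[of "\<lambda>_. 1"] \<beta>(2)[of "\<lambda>_. 1"] by (simp_all add: rowsq_def)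
      hence "sqrt (mnorm2 p q (a 0)) \<le> \<alpha>" "sqrt (mnorm2 p q (b 0)) \<le> \<beta>"
        using \<alpha>(1) \<beta>(1) by (auto intro: real_le_lsqrt)
      moreover have "dual_norm V N q (\<lambda>k l. j' (y k l)) \<le> 1" using M_eq[OF y] xy by simp
      ultimately show ?thesis
        using xy(1) V.N_nonneg[OF x] \<alpha>(1) \<beta>(1) W.N_nonneg[OF y] M_eq[OF y]
        by (intro mult_mono mult_nonneg_nonneg) (auto simp: mnorm2_nonneg)
    qed
    finally show "cmod (\<Sum>i<m. fs i (xs i)) \<le> 1 * (\<alpha> * \<beta>)" by simp
  qed simp
  thus ?thesis by (simp add: proj_def)
qed

end

context separated
begin

lemma Tval_bound_scaled:
  assumes x: "mat_in V p p x" and y: "mat_in W q q y" "M q y \<le> 1"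
  shows "cmod (Tval p q a b x y) \<le> N p x *
    (qsum n H0 p q a + qsum n H1 p q b)"
    (is "_ \<le> _ * ?Q")
proof -
  have xin: "i < p \<Longrightarrow> j < p \<Longrightarrow> x i j \<in> V" for i j using x by (simp add: mat_in_def)
  have yin: "i < q \<Longrightarrow> j < q \<Longrightarrow> y i j \<in> W" for i j using y by (simp add: mat_in_def)
  have scl: "Tval p q a b (\<lambda>i j. cscale c (x i j)) y = c * Tval p q a b x y" for c
  proof -
    have "Tval p q a b (\<lambda>i j. cscale c (x i j)) y =
      (\<Sum>r<n. \<Sum>s<n. \<Sum>i<p. \<Sum>k<q. \<Sum>j<p. \<Sum>l<q. c * (a r i k * b s j l * T r s (x i j) (y k l)))"
      unfolding Tval_def by (intro sum.cong refl) (simp add: T_scale_left xin yin mult_ac)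
    thus ?thesis by (simp only: Tval_def sum_distrib_left)
  qed
  show ?thesis
  proof (cases "N p x = 0")
    case True
    have "Tval p q a b x y = Tval p q a b (\<lambda>i j. cscale 0 (x i j)) y"
      unfolding Tval_def using True V.N_eq_0[OF x] by (intro sum.cong refl) auto
    thus ?thesis using True scl[of 0] by simp
  next
    case False
    define t where "t = N p x"
    have t: "t > 0" using False V.N_nonneg[OF x] by (simp add: t_def)
    have "N p (\<lambda>i j. cscale (of_real (inverse t)) (x i j)) \<le> cmod (of_real (inverse t)) * t"
      unfolding t_def by (rule V.N_scale[OF x])
    also have "\<dots> = 1" using t by (simp add: norm_inverse)
    finally have "cmod (Tval p q a b (\<lambda>i j. cscale (of_real (inverse t)) (x i j)) y) \<le> ?Q"
      using xin by (intro Tval_bound y) (auto simp: mat_in_def intro: V.scale_in)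
    thus ?thesis unfolding scl t_def[symmetric] using t
      by (simp add: norm_mult norm_inverse norm_divide field_simps)
  qed
qed

end

context dual_copy
begin

lemma M_one: "f \<in> dual_carrier V N \<Longrightarrow> M 1 (\<lambda>_ _. j f) = dual_norm V N 1 (\<lambda>_ _. f)"
  using M_eq[of 1 "\<lambda>_ _. j f"] j_in j'j by (simp add: mat_in_def)

text \<open>At level one a functional norming the quotient tensor already is a map into the bidual
  of \<open>V\<close>, because \<open>W\<close> is a copy of the dual. It vanishes on
  \<open>K\<close>, and finite codimension of \<open>K\<close> gives finite rank.\<close>

lemma admissible_of_separated:
  assumes K: "cofinite_sub V N K" and L: "cofinite_sub W M L" and u: "mat_in (tensors V W) 1 1 u"
    and xs: "\<And>i. i < m \<Longrightarrow> xs i \<in> V" and fs: "\<And>i. i < m \<Longrightarrow> fs i \<in> dual_carrier V N"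
    and u_eq: "u 0 0 = (\<Sum>i<(m::nat). tens V W (xs i) (j (fs i)))"
  obtains \<phi> where "V.admissible 1 \<phi>" "proj_q V N K W M L 1 u \<le> Re (\<Sum>i<m. \<phi> (xs i) (fs i))"
proof -
  interpret Q: opspace_pair V N W M K L
    by unfold_locales (use K L in \<open>auto simp: cofinite_sub_def\<close>)
  interpret D: opspace "dual_carrier V N" "dual_norm V N"
    by unfold_locales (rule V.dual_operator_space)
  obtain \<Phi> H0 H1 where sep: "separated V N W M K L 1 \<Phi> H0 H1"
    and big: "2 * proj_q V N K W M L 1 u \<le> Re (\<Phi> u)"
    by (rule Q.separation[OF zero_less_one u]) (rule that)
  interpret S: separated V N W M K L 1 \<Phi> H0 H1 by (rule sep)
  have vanish: "\<Phi> w = 0" if w: "mat_in (tensors V W) 1 1 w" "\<forall>f\<in>annih V K. \<forall>g\<in>annih W L. w 0 0 (f, g) =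
      0" for w
  proof -
    have "proj_rep V K W L 1 w 0 0 (\<lambda>_ _ _. 0) (\<lambda>_ _ _. 0) (\<lambda>_ _. 0) (\<lambda>_ _. 0)"
      using w(2) by (simp add: proj_rep_def mat_in_def)
    from S.\<Phi>bound[OF w(1) this] have "cmod (\<Phi> w) \<le> 0" by (simp add: V.N_zero W.N_zero)
    thus ?thesis by simp
  qed
  \<comment> \<open>Halved because \<open>\<Phi>\<close> is dominated by two forms, each at most
    \<open>1\<close> on normalised outer factors.\<close>
  define \<phi> where "\<phi> = (\<lambda>x f. if x \<in> V \<and> f \<in> dual_carrier V N then S.T 0 0 x (j f) / 2 else 0)"
  obtain c where c: "0 \<le> c" "\<And>x y. x \<in> V \<Longrightarrow> y \<in> W \<Longrightarrow> cmod (S.T 0 0 x y) \<le> c * N 1 (\<lambda>_ _. x) * M 1 (\<lambda>_ _. y)"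
    by (rule S.T_bounded[OF zero_less_one zero_less_one]) (rule that)
  have lin: "lin_on V \<phi>"
    unfolding lin_on_def
    using V.add_in V.scale_in j_in
    by (auto simp: \<phi>_def fun_eq_iff cscale_fun_def S.T_add_left S.T_scale_left add_divide_distrib)
  have bid: "\<phi> x \<in> dual_carrier (dual_carrier V N) (dual_norm V N)" if x: "x \<in> V" for x
  proof (rule D.dual_memI)
    show "lin_on (dual_carrier V N) (\<phi> x)"
      unfolding lin_on_def using D.add_in D.scale_in j_in x lin_onD[OF j_lin]
      by (simp add: \<phi>_def S.T_add_right S.T_scale_right add_divide_distrib)
    show "\<phi> x f = 0" if "f \<notin> dual_carrier V N" for f using that by (simp add: \<phi>_def)
    fix f assume f: "f \<in> dual_carrier V N"
    have "cmod (\<phi> x f) \<le> cmod (S.T 0 0 x (j f))" using x f by (simp add: \<phi>_def norm_divide)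
    also have "\<dots> \<le> c * N 1 (\<lambda>_ _. x) * dual_norm V N 1 (\<lambda>_ _. f)"
      using c(2)[OF x j_in[OF f]] by (simp only: M_one[OF f])
    finally show "cmod (\<phi> x f) \<le> c * N 1 (\<lambda>_ _. x) * dual_norm V N 1 (\<lambda>_ _. f)" .
  qed
  have cb: "cb_le V N (bidual_norm V N) 1 \<phi>"
    unfolding cb_le_def
  proof (intro allI impI)
    fix p x assume x: "mat_in V p p x"
    have xin: "i < p \<Longrightarrow> jj < p \<Longrightarrow> x i jj \<in> V" for i jj using x by (simp add: mat_in_def)
    show "bidual_norm V N p (\<lambda>i j. \<phi> (x i j)) \<le> 1 * N p x"
      unfolding bidual_norm_def
    proof (rule D.dual_norm_least)
      show "0 \<le> 1 * N p x" using V.N_nonneg[OF x] by simp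
      fix q G c d assume G: "mat_in (dual_carrier V N) q q G" "dual_norm V N q G \<le> 1"
        and cd: "mnorm2 q p c \<le> 1" "mnorm2 q p d \<le> 1"
      let ?y = "\<lambda>k l. j (G k l)" and ?a = "\<lambda>(_::nat) i k. c k i" and ?b = "\<lambda>(_::nat) i k. d k i"
      have Gin: "k < q \<Longrightarrow> l < q \<Longrightarrow> G k l \<in> dual_carrier V N" for k l using G by (simp add: mat_in_def)
      have y: "mat_in W q q ?y" using Gin j_in by (simp add: mat_in_def)
      have "M q ?y = dual_norm V N q (\<lambda>k l. j' (j (G k l)))" by (rule M_eq[OF y])
      also have "\<dots> = dual_norm V N q G" by (rule V.dual_norm_cong) (simp add: j'j Gin)
      finally have y1: "M q ?y \<le> 1" using G by simp
      have rs: "rowsq 1 p q (\<lambda>(_::nat) i k. c k i) v \<le> 1 * vnorm2 1 v" if "mnorm2 q p c \<le> 1" for c v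
      proof -
        have "rowsq 1 p q (\<lambda>(_::nat) i k. c k i) v = (cmod (v 0))\<^sup>2 * (\<Sum>i<p. \<Sum>k<q. (cmod (c k i))\<^sup>2)"
          by (simp add: rowsq_def norm_mult power_mult_distrib sum_distrib_left)
        also have "(\<Sum>i<p. \<Sum>k<q. (cmod (c k i))\<^sup>2) = mnorm2 q p c" by (rule sum.swap)
        finally show ?thesis using that by (simp add: mult_left_le)
      qed
      have "D.pform q p c (\<lambda>i j. \<phi> (x i j)) G d = (\<Sum>k<q. \<Sum>i<p. \<Sum>l<q. \<Sum>jj<p. c k i * (S.T 0 0 (x i jj)
          (?y k l) / 2) * d l jj)"
        unfolding bform_def by (intro sum.cong refl) (simp add: \<phi>_def xin Gin)
      also have "\<dots> = (\<Sum>i<p. \<Sum>k<q. \<Sum>jj<p. \<Sum>l<q. c k i * (S.T 0 0 (x i jj) (?y k l) / 2) * d l jj)"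
        by (subst sum.swap, rule sum.cong[OF refl], rule sum.cong[OF refl], rule sum.swap)
      also have "\<dots> = S.Tval p q ?a ?b x ?y / 2"
        unfolding S.Tval_def by (simp add: sum_divide_distrib mult_ac)
      finally have "cmod (D.pform q p c (\<lambda>i j. \<phi> (x i j)) G d) = cmod (S.Tval p q ?a ?b x ?y / 2)"
        by (rule arg_cong)
      also have "\<dots> = cmod (S.Tval p q ?a ?b x ?y) / 2" by (simp add: norm_divide)
      also have "\<dots> \<le> (N p x * ((\<Sum>i<p. \<Sum>k<q. qform 1 H0 (\<lambda>r. ?a r i k)) + (\<Sum>i<p. \<Sum>k<q. qform 1 H1 (\<lambda>r. ?b
          r i k)))) / 2"
        using S.Tval_bound_scaled[OF x y y1, of ?a ?b] by simp
      also have "\<dots> \<le> (N p x * (1 + 1)) / 2"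
        by (intro divide_right_mono mult_left_mono add_mono S.H0le S.H1le rs cd V.N_nonneg[OF x]) simp
      finally show "cmod (D.pform q p c (\<lambda>i j. \<phi> (x i j)) G d) \<le> 1 * N p x" by simp
    qed
  qed
  \<comment> \<open>Tensors with first factor in \<open>K\<close> vanish on the annihilators, so
    \<open>\<Phi>\<close> is zero on them.\<close>
  have \<phi>K: "\<phi> k = 0" if k: "k \<in> K" for k
  proof (rule ext)
    fix f
    have kV: "k \<in> V" using k Q.K by auto
    show "\<phi> k f = 0 f"
    proof (cases "f \<in> dual_carrier V N")
      case f: True
      have "\<Phi> (unit_mat 0 0 (tens V W k (j f))) = 0"
        by (rule vanish[OF unit_mat_in[OF kV j_in[OF f]]]) (use k in \<open>auto simp: unit_mat_def tens_def
            annihD(3)\<close>)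
      thus ?thesis by (simp add: \<phi>_def S.T_def)
    qed (simp add: \<phi>_def)
  qed
  have fr: "finite_rank_on V \<phi>"
  proof -
    obtain T where T: "finite T" "T \<subseteq> V" "\<forall>x\<in>V. \<exists>k\<in>K. \<exists>c. x = k + (\<Sum>t\<in>T. cscale (c t) t)"
      using K by (auto simp: cofinite_sub_def)
    have "\<phi> x \<in> cv.span (\<phi> ` T)" if "x \<in> V" for x
    proof -
      obtain k c where k: "k \<in> K" "x = k + (\<Sum>t\<in>T. cscale (c t) t)" using T(3) \<open>x \<in> V\<close> by blast
      have kV: "k \<in> V" using k Q.K by auto
      have tV: "cscale (c t) t \<in> V" if "t \<in> T" for t using T(2) that by (intro V.scale_in) auto
      have "\<phi> x = \<phi> k + \<phi> (\<Sum>t\<in>T. cscale (c t) t)"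
        unfolding k(2) by (intro lin_onD(1)[OF lin] kV V.sum_in tV)
      also have "\<phi> k = 0" by (rule \<phi>K[OF k(1)])
      also have "\<phi> (\<Sum>t\<in>T. cscale (c t) t) = (\<Sum>t\<in>T. \<phi> (cscale (c t) t))"
        by (rule lin_on_sum[OF lin V.csub tV])
      also have "\<dots> = (\<Sum>t\<in>T. cscale (c t) (\<phi> t))"
        using T(2) by (intro sum.cong refl lin_onD(2)[OF lin]) auto
      finally have "\<phi> x = (\<Sum>t\<in>T. cscale (c t) (\<phi> t))" by (simp only: add_0_left)
      thus ?thesis by (simp only:) (intro cv.span_sum cv.span_scale cv.span_base imageI)
    qed
    thus ?thesis unfolding finite_rank_on_iff_span using T(1) by blast
  qed
  have "\<Phi> u = (\<Sum>r<1. \<Sum>s<1. \<Sum>i<m. S.T r s (xs i) (j (fs i)))"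
    by (rule S.\<Phi>_expand[OF u, where k = "\<lambda>_ _. m" and xs = "\<lambda>_ _. xs" and ys = "\<lambda>_ _ i. j (fs i)"])
       (use xs fs j_in u_eq in auto)
  also have "\<dots> = 2 * (\<Sum>i<m. \<phi> (xs i) (fs i))"
    using xs fs by (simp add: \<phi>_def sum_distrib_left)
  finally have "proj_q V N K W M L 1 u \<le> Re (\<Sum>i<m. \<phi> (xs i) (fs i))" using big by simp
  moreover have "V.admissible 1 \<phi>"
    unfolding V.admissible_def using lin fr cb bid by (auto simp: bidual_carrier_def)
  ultimately show thesis by (rule that[rotated])
qed

text \<open>If no \<open>\<phi>\<close> is close to the embedding on \<open>I\<close>, a functional \<open>g\<close> separates the embedding from the maps of
  cb-norm at most \<open>(1 + \<eta>) C\<close>; read as a tensor, \<open>g\<close> violates the inequality between the two norms.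
  The slack \<open>\<eta>\<close> makes the separation strict.\<close>
lemma approximation_exists:
  assumes C: "0 < C" and id: "id_norm_le V N W M C"
    and I: "finite I" "\<And>x f. (x, f) \<in> I \<Longrightarrow> x \<in> V \<and> f \<in> dual_carrier V N" and \<epsilon>: "0 < \<epsilon>"
  shows "\<exists>\<phi>. V.admissible C \<phi> \<and> (\<forall>(x, f)\<in>I. cmod (\<phi> x f - f x) < \<epsilon>)"
proof (rule ccontr)
  assume no: "\<not> ?thesis"
  define nrm where "nrm w = (\<Sum>i\<in>I. cmod (w i))" for w :: "'a \<times> ('a \<Rightarrow> complex) \<Rightarrow> complex"
  define res where "res \<phi> = (\<lambda>(x, f). \<phi> x f)" for \<phi> :: "'a \<Rightarrow> ('a \<Rightarrow> complex) \<Rightarrow> complex"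
  define z :: "'a \<times> ('a \<Rightarrow> complex) \<Rightarrow> complex" where "z = (\<lambda>(x, f). f x)"
  have nrm_nonneg: "0 \<le> nrm w" for w by (simp add: nrm_def sum_nonneg)
  have nrm_add: "nrm (v + w) \<le> nrm v + nrm w" for v w
    unfolding nrm_def sum.distrib[symmetric] by (intro sum_mono) (simp add: norm_triangle_ineq)
  have nrm_scale: "nrm (cscale c w) = cmod c * nrm w" for c w
    by (simp add: nrm_def cscale_fun_def norm_mult sum_distrib_left)
  \<comment> \<open>Small enough that moving \<open>z\<close> by \<open>\<eta>\<close> times itself
    costs at most half of \<open>\<epsilon>\<close>; the other half is
    \<open>\<delta>\<close>.\<close>
  define \<eta> where "\<eta> = \<epsilon> / (2 * (nrm z + 1))"
  have \<eta>: "0 < \<eta>" "\<eta> * nrm z \<le> \<epsilon> / 2"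
    using \<epsilon> nrm_nonneg[of z] by (auto simp: \<eta>_def field_simps)
  define C' where "C' = (1 + \<eta>) * C"
  have C': "0 < C'" using C \<eta> by (simp add: C'_def)
  define \<delta> where "\<delta> = \<epsilon> / 2"
  have \<delta>: "0 < \<delta>" using \<epsilon> by (simp add: \<delta>_def)
  \<comment> \<open>The cone of the infimal convolution of two gauges: that of the maps of cb-norm
    at most \<open>C'\<close>, restricted to \<open>I\<close>, and the norm
    \<open>nrm / \<delta>\<close>. The second makes the cone total.\<close>
  define G where "G = {(w, s). \<exists>t\<ge>0. \<exists>\<phi>. V.admissible (t * C') \<phi> \<and> t + nrm (w - res \<phi>) / \<delta> \<le> s}"
  have GI: "0 \<le> t \<Longrightarrow> V.admissible (t * C') \<phi> \<Longrightarrow> t + nrm (w - res \<phi>) / \<delta> \<le> s \<Longrightarrow> (w, s) \<in> G" for t \<phi> w s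
    unfolding G_def by blast
  have GE: "\<exists>t \<phi>. 0 \<le> t \<and> V.admissible (t * C') \<phi> \<and> t + nrm (w - res \<phi>) / \<delta> \<le> s" if "(w, s) \<in> G" for w s
    using that unfolding G_def by blast
  have res_add: "res (\<phi> + \<psi>) = res \<phi> + res \<psi>" for \<phi> \<psi> by (rule ext) (simp add: res_def case_prod_beta)
  have res_scale: "res (cscale c \<phi>) = cscale c (res \<phi>)" for c \<phi>
    by (rule ext) (simp add: res_def case_prod_beta cscale_fun_def)
  have res0: "res 0 = 0" by (rule ext) (simp add: res_def case_prod_beta)
  have adm0: "V.admissible (0 * C') 0" using V.admissible_zero by simp
  have epi: "epi_cone G"
    unfolding epi_cone_def
  proof (intro conjI allI impI)
    show "(0, 0) \<in> G" by (rule GI[OF order_refl adm0]) (simp add: res0 nrm_def)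
  next
    fix w s w' s' assume "(w, s) \<in> G" "(w', s') \<in> G"
    then obtain t \<phi> t' \<phi>' where *: "0 \<le> t" "V.admissible (t * C') \<phi>" "t + nrm (w - res \<phi>) / \<delta> \<le> s"
      "0 \<le> t'" "V.admissible (t' * C') \<phi>'" "t' + nrm (w' - res \<phi>') / \<delta> \<le> s'" using GE by meson
    have "nrm ((w + w') - res (\<phi> + \<phi>')) \<le> nrm (w - res \<phi>) + nrm (w' - res \<phi>')"
      using nrm_add[of "w - res \<phi>" "w' - res \<phi>'"] by (simp add: res_add algebra_simps)
    hence "nrm ((w + w') - res (\<phi> + \<phi>')) / \<delta> \<le> nrm (w - res \<phi>) / \<delta> + nrm (w' - res \<phi>') / \<delta>"
      using \<delta> by (simp add: divide_right_mono flip: add_divide_distrib)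
    moreover have "V.admissible ((t + t') * C') (\<phi> + \<phi>')"
      using V.admissible_add[OF *(2,5)] by (simp add: distrib_right)
    ultimately show "(w + w', s + s') \<in> G" using * by (intro GI[of "t + t'"]) auto
  next
    fix r :: real and w s assume r: "0 \<le> r" and "(w, s) \<in> G"
    then obtain t \<phi> where *: "0 \<le> t" "V.admissible (t * C') \<phi>" "t + nrm (w - res \<phi>) / \<delta> \<le> s" using GE by meson
    have "nrm (cscale (of_real r) w - res (cscale (of_real r) \<phi>)) = r * nrm (w - res \<phi>)"
      using nrm_scale[of "of_real r" "w - res \<phi>"] r by (simp add: res_scale cv.scale_right_diff_distrib)
    moreover have "r * (t + nrm (w - res \<phi>) / \<delta>) \<le> r * s" using r *(3) by (rule mult_left_mono[rotated])
    moreover have "V.admissible (r * t * C') (cscale (of_real r) \<phi>)"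
      using V.admissible_scale[OF *(2) r] by (simp add: mult.assoc)
    ultimately show "(cscale (of_real r) w, r * s) \<in> G" using * r by (intro GI[of "r * t"]) (auto simp:
        algebra_simps)
  next
    fix s assume "(0, s) \<in> G"
    then obtain t \<phi> where "0 \<le> t" "t + nrm (0 - res \<phi>) / \<delta> \<le> s" using GE by meson
    moreover have "0 \<le> nrm (0 - res \<phi>) / \<delta>" using nrm_nonneg \<delta> by simp
    ultimately show "0 \<le> s" by linarith
  qed
  have tot: "\<exists>s. (w, s) \<in> G" for w using GI[OF order_refl adm0 order_refl] by blast
  \<comment> \<open>For \<open>t < 1\<close> the map shrunk by \<open>1 / (1 + \<eta>)\<close> is
    admissible for \<open>C\<close> and misses \<open>z\<close> by \<open>\<epsilon>\<close>
    somewhere on \<open>I\<close>. Undoing the shrinking costs at most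
    \<open>\<epsilon> / 2\<close>, which leaves a distance of at least
    \<open>\<delta>\<close>.\<close>
  have low: "1 \<le> s" if sG: "(z, s) \<in> G" for s
  proof -
    obtain t \<phi> where *: "0 \<le> t" "V.admissible (t * C') \<phi>" "t + nrm (z - res \<phi>) / \<delta> \<le> s" using GE[OF sG]
        by meson
    have d0: "0 \<le> nrm (z - res \<phi>) / \<delta>" using nrm_nonneg \<delta> by simp
    show ?thesis
    proof (cases "1 \<le> t")
      case True
      thus ?thesis using * d0 by simp
    next
      case False
      define q where "q = inverse (1 + \<eta>)"
      have q: "0 < q" "q * (1 + \<eta>) = 1" using \<eta> by (auto simp: q_def)
      have "V.admissible C' \<phi>"
        by (rule V.admissible_mono[OF *(2)]) (use False C' in \<open>simp add: mult_left_le_one_le *(1)\<close>)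
      from V.admissible_scale[OF this, of q] q have ad: "V.admissible C (cscale (of_real q) \<phi>)"
        by (simp add: C'_def mult.assoc[symmetric])
      then obtain i where i: "i \<in> I" "\<epsilon> \<le> cmod (res (cscale (of_real q) \<phi>) i - z i)"
        using no by (force simp: res_def z_def not_less)
      have "cmod ((z - res (cscale (of_real q) \<phi>)) i) \<le> nrm (z - res (cscale (of_real q) \<phi>))"
        unfolding nrm_def by (rule member_le_sum[OF i(1)]) (use I in auto)
      hence "\<epsilon> \<le> nrm (z - cscale (of_real q) (res \<phi>))"
        using i(2) by (simp add: norm_minus_commute res_scale)
      also have "\<dots> \<le> (1 + \<eta>) * nrm (z - cscale (of_real q) (res \<phi>))"
        using \<eta> nrm_nonneg[of "z - cscale (of_real q) (res \<phi>)"] by (simp add: distrib_right)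
      also have "\<dots> = nrm (cscale (of_real (1 + \<eta>)) (z - cscale (of_real q) (res \<phi>)))"
        unfolding nrm_scale norm_of_real using \<eta> by simp
      also have "cscale (of_real (1 + \<eta>)) (z - cscale (of_real q) (res \<phi>)) = (z - res \<phi>) + cscale
          (of_real \<eta>) z"
      proof -
        have "cscale (of_real (1 + \<eta>)) (cscale (of_real q) (res \<phi>)) = res \<phi>"
          using q(2) by (simp only: cscale_cscale of_real_mult[symmetric] mult.commute[of "1 + \<eta>"]
            of_real_1 cscale_one)
        moreover have "cscale (of_real (1 + \<eta>)) z = z + cscale (of_real \<eta>) z"
          by (simp only: of_real_add of_real_1 cscale_add_left cscale_one)
        ultimately show ?thesis by (simp only: cv.scale_right_diff_distrib) (simp add: algebra_simps)
      qed
      also have "nrm \<dots> \<le> nrm (z - res \<phi>) + nrm (cscale (of_real \<eta>) z)" by (rule nrm_add)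
      also have "nrm (cscale (of_real \<eta>) z) \<le> \<epsilon> / 2" using \<eta> by (simp add: nrm_scale)
      finally have "\<epsilon> \<le> nrm (z - res \<phi>) + \<epsilon> / 2" by (simp only: add_le_cancel_left)
      hence "\<delta> \<le> nrm (z - res \<phi>)" unfolding \<delta>_def by linarith
      hence "1 \<le> nrm (z - res \<phi>) / \<delta>" using \<delta> by simp
      thus ?thesis using * by linarith
    qed
  qed
  have U: "csubspace (UNIV :: ('a \<times> ('a \<Rightarrow> complex) \<Rightarrow> complex) set)" by (simp add: csubspace_def)
  obtain g where gadd: "\<And>v w. g (v + w) = g v + g w" and gscl: "\<And>t w. g (cscale (of_real t) w) = t * g w"
    and gle: "\<And>w s. (w, s) \<in> G \<Longrightarrow> g w \<le> s" and gz: "1 \<le> g z"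
    by (rule hahn_banach_cone[OF U epi, of z 1]) (use tot low in auto)
  define e where "e i = (\<lambda>i'. if i' = i then 1 else (0 :: complex))" for i :: "'a \<times> ('a \<Rightarrow> complex)"
  \<comment> \<open>\<open>g\<close> is only real-linear; with these coefficients it is the real
    part of a complex-linear form.\<close>
  define \<mu> where "\<mu> i = Complex (g (e i)) (- g (cscale \<i> (e i)))" for i
  have gsum: "g (\<Sum>i\<in>A. w i) = (\<Sum>i\<in>A. g (w i))" for A :: "('a \<times> ('a \<Rightarrow> complex)) set" and w
  proof (induction A rule: infinite_finite_induct)
    have "g 0 = 0" using gscl[of 0 0] by simp
    thus "g (\<Sum>i\<in>{}. w i) = (\<Sum>i\<in>{}. g (w i))" "infinite A \<Longrightarrow> g (\<Sum>i\<in>A. w i) = (\<Sum>i\<in>A. g (w i))" for A by simp_all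
  next
    case (insert i A)
    thus ?case by (simp only: sum.insert[OF insert.hyps] gadd)
  qed
  have grep: "g w = Re (\<Sum>i\<in>I. \<mu> i * w i)" for w
  proof -
    define w' where "w' = (\<Sum>i\<in>I. cscale (of_real (Re (w i))) (e i) + cscale (of_real (Im (w i))) (cscale
        \<i> (e i)))"
    have w'i: "w' i = w i" if "i \<in> I" for i
    proof -
      have "w' i = (\<Sum>i'\<in>I. if i' = i then w i' else 0)"
        unfolding w'_def sum_fun_apply
        by (intro sum.cong refl) (auto simp: cscale_fun_def e_def complex_eq_iff)
      thus ?thesis using that I by simp
    qed
    \<comment> \<open>A function vanishing on \<open>I\<close> has \<open>nrm\<close> zero, so
      \<open>g\<close> depends only on the coordinates in \<open>I\<close>.\<close>
    have zero: "g v \<le> 0" if "\<And>i. i \<in> I \<Longrightarrow> v i = 0" for v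
      by (rule gle, rule GI[OF order_refl adm0]) (simp add: res0 nrm_def that)
    have "g w + g (cscale (of_real (- 1)) w') = g (w + cscale (of_real (- 1)) w')" by (rule gadd[symmetric])
    also have "\<dots> \<le> 0" by (rule zero) (simp add: w'i cscale_fun_def)
    finally have 1: "g w \<le> g w'" using gscl[of "- 1" w'] by simp
    have "g w' + g (cscale (of_real (- 1)) w) = g (w' + cscale (of_real (- 1)) w)" by (rule gadd[symmetric])
    also have "\<dots> \<le> 0" by (rule zero) (simp add: w'i cscale_fun_def)
    finally have 2: "g w' \<le> g w" using gscl[of "- 1" w] by simp
    have "g w' = (\<Sum>i\<in>I. Re (w i) * g (e i) + Im (w i) * g (cscale \<i> (e i)))"
      unfolding w'_def gsum by (simp only: gadd gscl)
    also have "\<dots> = (\<Sum>i\<in>I. Re (\<mu> i * w i))"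
      by (intro sum.cong refl) (simp add: \<mu>_def mult.commute)
    finally show ?thesis using 1 2 by simp
  qed
  obtain h where h: "bij_betw h {..<card I} I" using I(1) ex_bij_betw_nat_finite[of I] by (auto simp:
      atLeast0LessThan)
  define m where "m = card I"
  \<comment> \<open>With the coefficient moved into the first factor, \<open>g\<close> is the trace
    of a tensor whose second factors are the given functionals.\<close>
  define xs where "xs i = cscale (\<mu> (h i)) (fst (h i))" for i
  define fs where "fs i = snd (h i)" for i
  have hI: "h i \<in> I" if "i < m" for i using h that by (auto simp: bij_betw_def m_def)
  have hV: "fst (h i) \<in> V" "snd (h i) \<in> dual_carrier V N" if "i < m" for i
    using I(2)[of "fst (h i)" "snd (h i)"] hI[OF that] by auto
  have xs: "xs i \<in> V" if "i < m" for i unfolding xs_def using hV[OF that] by (intro V.scale_in)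
  have fs: "fs i \<in> dual_carrier V N" if "i < m" for i unfolding fs_def using hV[OF that] by simp
  have reidx: "(\<Sum>i<m. F (h i)) = (\<Sum>i\<in>I. F i)" for F :: "_ \<Rightarrow> complex"
    unfolding m_def by (rule sum.reindex_bij_betw[OF h])
  let ?u = "\<lambda>(_::nat) (_::nat). \<Sum>i<m. tens V W (xs i) (j (fs i))"
  have u: "mat_in (tensors V W) 1 1 ?u"
    using sum_tens_in_tensors[of m xs V "\<lambda>i. j (fs i)" W] xs fs j_in by (simp add: mat_in_def)
  have "1 \<le> cmod (\<Sum>i<m. fs i (xs i))"
  proof -
    have "(\<Sum>i<m. fs i (xs i)) = (\<Sum>i<m. \<mu> (h i) * z (h i))"
      using hV by (intro sum.cong refl)
        (simp add: fs_def xs_def z_def case_prod_beta lin_onD(2)[OF V.dualD(1)])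
    also have "\<dots> = (\<Sum>i\<in>I. \<mu> i * z i)" by (rule reidx)
    finally have "g z = Re (\<Sum>i<m. fs i (xs i))" by (simp add: grep)
    thus ?thesis using gz complex_Re_le_cmod[of "\<Sum>i<m. fs i (xs i)"] by linarith
  qed
  also have "\<dots> \<le> proj V N W M 1 ?u" by (rule trace_le_proj[OF xs fs])
  also have "\<dots> \<le> C * cproj V N W M 1 ?u" using id u unfolding id_norm_le_def by blast
  also have "\<dots> \<le> C * (1 / C')"
  proof (rule mult_left_mono[OF cproj_least])
    fix K L assume KL: "cofinite_sub V N K" "cofinite_sub W M L"
    obtain \<phi> where \<phi>: "V.admissible 1 \<phi>" "proj_q V N K W M L 1 ?u \<le> Re (\<Sum>i<m. \<phi> (xs i) (fs i))"
      by (rule admissible_of_separated[OF KL u xs fs refl]) (assumption | rule that)+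
    have lin: "lin_on V \<phi>" using \<phi> by (simp add: V.admissible_def)
    have "(\<Sum>i<m. \<phi> (xs i) (fs i)) = (\<Sum>i<m. \<mu> (h i) * res \<phi> (h i))"
      using hV by (intro sum.cong refl)
        (simp add: fs_def xs_def res_def case_prod_beta lin_onD(2)[OF lin] cscale_fun_def)
    also have "\<dots> = (\<Sum>i\<in>I. \<mu> i * res \<phi> i)" by (rule reidx)
    finally have "Re (\<Sum>i<m. \<phi> (xs i) (fs i)) = g (res \<phi>)" by (simp add: grep)
    \<comment> \<open>The map is admissible for \<open>1 = (1 / C') * C'\<close> and has distance
      zero from itself.\<close>
    also have "\<dots> \<le> 1 / C'"
      by (rule gle, rule GI[of "1 / C'" \<phi>]) (use \<phi>(1) C' in \<open>simp_all add: nrm_def\<close>)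
    finally show "proj_q V N K W M L 1 ?u \<le> 1 / C'" using \<phi>(2) by simp
  qed (use C in simp)
  also have "\<dots> = 1 / (1 + \<eta>)" using C by (simp add: C'_def)
  also have "\<dots> < 1" using \<eta> by simp
  finally show False by simp
qed

text \<open>The net runs over finite sets of triples \<open>(x, f, k)\<close>, where
  \<open>k\<close> prescribes the accuracy \<open>1 / (1 + k)\<close> at \<open>x\<close> and
  \<open>f\<close>.\<close>

theorem id_norm_le_imp_wcbap:
  assumes C: "0 < C" and id: "id_norm_le V N W M C"
  shows "wcbap V N C"
proof -
  have ex: "\<exists>\<phi>. V.admissible C \<phi> \<and>
      (\<forall>(x, f, k)\<in>S. x \<in> V \<longrightarrow> f \<in> dual_carrier V N \<longrightarrow> cmod (\<phi> x f - f x) < 1 / (1 + real k))"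
    if S: "finite S" for S :: "('a \<times> ('a \<Rightarrow> complex) \<times> nat) set"
  proof -
    define I where "I = {(x, f). x \<in> V \<and> f \<in> dual_carrier V N} \<inter> (\<lambda>(x, f, k). (x, f)) ` S"
    define \<epsilon> where "\<epsilon> = Min (insert 1 ((\<lambda>(x, f, k). 1 / (1 + real k)) ` S))"
    have \<epsilon>: "0 < \<epsilon>" unfolding \<epsilon>_def using S by (subst Min_gr_iff) auto
    have \<epsilon>le: "\<epsilon> \<le> 1 / (1 + real k)" if "(x, f, k) \<in> S" for x f k
      unfolding \<epsilon>_def using S that by (intro Min_le) force+
    have "\<exists>\<phi>. V.admissible C \<phi> \<and> (\<forall>(x, f)\<in>I. cmod (\<phi> x f - f x) < \<epsilon>)"
      by (rule approximation_exists[OF C id _ _ \<epsilon>]) (use S in \<open>auto simp: I_def\<close>)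
    then obtain \<phi> where \<phi>: "V.admissible C \<phi>" "\<And>x f. (x, f) \<in> I \<Longrightarrow> cmod (\<phi> x f - f x) < \<epsilon>" by auto
    have "cmod (\<phi> x f - f x) < 1 / (1 + real k)" if "(x, f, k) \<in> S" "x \<in> V" "f \<in> dual_carrier V N" for x f k
    proof -
      have "(x, f) \<in> I" using that by (force simp: I_def)
      from \<phi>(2)[OF this] \<epsilon>le[OF that(1)] show ?thesis by linarith
    qed
    thus ?thesis using \<phi>(1) by blast
  qed
  define \<psi> where "\<psi> S = (SOME \<phi>. V.admissible C \<phi> \<and>
      (\<forall>(x, f, k)\<in>S. x \<in> V \<longrightarrow> f \<in> dual_carrier V N \<longrightarrow> cmod (\<phi> x f - f x) < 1 / (1 + real k)))"
    for S :: "('a \<times> ('a \<Rightarrow> complex) \<times> nat) set"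
  have \<psi>: "V.admissible C (\<psi> S) \<and>
      (\<forall>(x, f, k)\<in>S. x \<in> V \<longrightarrow> f \<in> dual_carrier V N \<longrightarrow> cmod (\<psi> S x f - f x) < 1 / (1 + real k))"
    if "finite S" for S unfolding \<psi>_def by (rule someI_ex[OF ex[OF that]])
  let ?F = "filtermap \<psi> (finite_subsets_at_top UNIV)"
  show ?thesis
    unfolding wcbap_def
  proof (intro exI[of _ ?F] conjI ballI)
    show "?F \<noteq> bot" by (simp add: filtermap_bot_iff)
    have "eventually (\<lambda>S. V.admissible C (\<psi> S)) (finite_subsets_at_top UNIV)"
      using \<psi> by (intro eventually_finite_subsets_at_top_weakI) blast
    thus "eventually (\<lambda>\<phi>. lin_on V \<phi> \<and> \<phi> ` V \<subseteq> bidual_carrier V N \<and> finite_rank_on V \<phi> \<and>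
        cb_le V N (bidual_norm V N) C \<phi>) ?F"
      unfolding eventually_filtermap V.admissible_def .
    fix x f assume x: "x \<in> V" and f: "f \<in> dual_carrier V N"
    show "((\<lambda>\<phi>. \<phi> x f) \<longlongrightarrow> kappa V N x f) ?F"
      unfolding filterlim_filtermap
    proof (rule tendstoI)
      fix e :: real assume e: "0 < e"
      obtain k where k: "1 / (1 + real k) < e" using e nat_approx_posE[OF e] by (metis of_nat_Suc)
      show "eventually (\<lambda>S. dist (\<psi> S x f) (kappa V N x f) < e) (finite_subsets_at_top UNIV)"
        unfolding eventually_finite_subsets_at_top
      proof (intro exI[of _ "{(x, f, k)}"] conjI allI impI)
        fix S :: "('a \<times> ('a \<Rightarrow> complex) \<times> nat) set"
        assume S: "finite S \<and> {(x, f, k)} \<subseteq> S \<and> S \<subseteq> UNIV"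
        hence "cmod (\<psi> S x f - f x) < 1 / (1 + real k)" using \<psi>[of S] x f by blast
        thus "dist (\<psi> S x f) (kappa V N x f) < e" using k f by (simp add: kappa_def dist_norm)
      qed auto
    qed
  qed
qed

end

section \<open>The equivalences\<close>

context opspaces
begin

lemma proj_eq_cproj_iff: "proj_eq_cproj V N W M \<longleftrightarrow> id_cb_le V N W M 1"
  unfolding proj_eq_cproj_def id_cb_le_def using cproj_le_proj by (auto intro: antisym)

lemma id_norm_le_of_cb: "id_cb_le V N W M C \<Longrightarrow> id_norm_le V N W M C"
  unfolding id_cb_le_def id_norm_le_def by blast

end

lemma opspacesI: "operator_space V N \<Longrightarrow> operator_space W M \<Longrightarrow> opspaces V N W M"
  by (simp add: opspaces_def opspace_def)

lemma dual_copy_id: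
  assumes "operator_space V N"
  shows "dual_copy V N (dual_carrier V N) (dual_norm V N) id id"
proof -
  interpret opspace V N by unfold_locales (rule assms)
  interpret opspaces V N "dual_carrier V N" "dual_norm V N"
    by (rule opspacesI[OF assms dual_operator_space])
  show ?thesis by unfold_locales (auto simp: lin_on_def)
qed

text \<open>The circle closes at level one: a cb-bound for the dual contains the norm bound, which
  already yields the approximation property and thereby the cb-bound again.\<close>

lemma wcbap_iff_dual:
  assumes V: "operator_space V N" and C: "0 < C"
  shows "wcbap V N C \<longleftrightarrow> id_cb_le V N (dual_carrier V N) (dual_norm V N) C"
proof -
  interpret opspace V N by unfold_locales (rule V)
  interpret D: dual_copy V N "dual_carrier V N" "dual_norm V N" id id by (rule dual_copy_id[OF V])
  show ?thesis
    using wcbap_imp_id_cb_le[OF V dual_operator_space, of C] D.id_norm_le_imp_wcbap[OF C]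
      D.id_norm_le_of_cb C by auto
qed

text \<open>The dual of \<open>V\<close> lives in the type \<open>'a \<Rightarrow> complex\<close>; evaluation at indicator functions
  is a left inverse of an embedding of that type into \<open>('a \<Rightarrow> complex) \<Rightarrow> complex\<close>.\<close>
lemma wcbap_of_all_spaces:
  fixes V :: "'a::cvec set"
  assumes V: "operator_space V N" and C: "0 < C"
    and all: "\<And>(W :: (('a \<Rightarrow> complex) \<Rightarrow> complex) set) M. operator_space W M \<Longrightarrow> id_norm_le V N W M C"
  shows "wcbap V N C"
proof -
  interpret opspace V N by unfold_locales (rule V)
  define d where "d a b = (if b = a then 1 else (0 :: complex))" for a b :: 'a
  have inj: "d a = d b \<longleftrightarrow> a = b" for a b by (auto simp: d_def fun_eq_iff split: if_splits)
  \<comment> \<open>Away from indicator functions the value is \<open>h\<close> at an arbitrary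
    point independent of \<open>h\<close>; this keeps \<open>J\<close> linear and does not affect
    \<open>J'\<close>.\<close>
  define J :: "('a \<Rightarrow> complex) \<Rightarrow> ('a \<Rightarrow> complex) \<Rightarrow> complex" where "J h g = h (THE a. g = d a)" for h g
  define J' :: "(('a \<Rightarrow> complex) \<Rightarrow> complex) \<Rightarrow> 'a \<Rightarrow> complex" where "J' y a = y (d a)" for y a
  have J'J: "J' (J h) = h" for h by (rule ext) (simp add: J_def J'_def inj)
  have Jlin: "lin_on (dual_carrier V N) J"
    by (auto simp: lin_on_def J_def cscale_fun_def fun_eq_iff)
  let ?W = "J ` dual_carrier V N" and ?M = "\<lambda>n y. dual_norm V N n (\<lambda>i j. J' (y i j))"
  have W: "operator_space ?W ?M"
    by (rule operator_space_copy[OF dual_operator_space Jlin]) (rule J'J)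
  interpret W: opspaces V N ?W ?M by (rule opspacesI[OF V W])
  interpret D: dual_copy V N ?W ?M J J'
    by unfold_locales (auto simp: J'J Jlin, auto simp: lin_on_def J'_def cscale_fun_def fun_eq_iff)
  show ?thesis by (rule D.id_norm_le_imp_wcbap[OF C all[OF W]])
qed

text \<open>Consequences for every space are stated with an arbitrary type \<open>'b\<close>;
  hypotheses on every space range over one fixed type, which contains a copy of the dual.\<close>

theorem theorem6p13:
  fixes V :: "'a::cvec set" and N :: "nat \<Rightarrow> (nat \<Rightarrow> nat \<Rightarrow> 'a) \<Rightarrow> real" and C :: real
  assumes "operator_space V N" and "1 \<le> C"
  shows
    "(wcbap V N C \<longrightarrow> (\<forall>(W :: 'b::cvec set) M. operator_space W M \<longrightarrow>
                          id_cb_le V N W M C \<and> id_norm_le V N W M C))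
   \<and> (wcbap V N C \<longleftrightarrow> id_cb_le V N (dual_carrier V N) (dual_norm V N) C)
   \<and> ((\<forall>(W :: (('a \<Rightarrow> complex) \<Rightarrow> complex) set) M. operator_space W M \<longrightarrow> id_norm_le V N W M C)
        \<longrightarrow> wcbap V N C)
   \<and> (wcbap V N 1 \<longrightarrow> (\<forall>(W :: 'b::cvec set) M. operator_space W M \<longrightarrow> proj_eq_cproj V N W M))
   \<and> (wcbap V N 1 \<longleftrightarrow> proj_eq_cproj V N (dual_carrier V N) (dual_norm V N))
   \<and> ((\<forall>(W :: (('a \<Rightarrow> complex) \<Rightarrow> complex) set) M. operator_space W M \<longrightarrow> proj_eq_cproj V N W M)
        \<longrightarrow> wcbap V N 1)"
proof (intro conjI impI allI)
  note V = assms(1)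
  have C: "0 < C" using assms(2) by simp
  interpret opspace V N by unfold_locales (rule V)
  interpret D: opspaces V N "dual_carrier V N" "dual_norm V N"
    by (rule opspacesI[OF V dual_operator_space])
  show "id_cb_le V N W M C" "id_norm_le V N W M C"
    if "wcbap V N C" "operator_space W M" for W :: "'b set" and M
    using wcbap_imp_id_cb_le[OF V that(2) _ that(1)] opspaces.id_norm_le_of_cb[OF opspacesI[OF V that(2)]] C
    by auto
  show "wcbap V N C \<longleftrightarrow> id_cb_le V N (dual_carrier V N) (dual_norm V N) C"
    by (rule wcbap_iff_dual[OF V C])
  show "wcbap V N C"
    if "\<forall>(W :: (('a \<Rightarrow> complex) \<Rightarrow> complex) set) M. operator_space W M \<longrightarrow> id_norm_le V N W M C"
    using that by (intro wcbap_of_all_spaces[OF V C]) blast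
  show "proj_eq_cproj V N W M" if "wcbap V N 1" "operator_space W M" for W :: "'b set" and M
    using wcbap_imp_id_cb_le[OF V that(2) _ that(1)] opspaces.proj_eq_cproj_iff[OF opspacesI[OF V that(2)]]
    by simp
  show "wcbap V N 1 \<longleftrightarrow> proj_eq_cproj V N (dual_carrier V N) (dual_norm V N)"
    unfolding D.proj_eq_cproj_iff by (rule wcbap_iff_dual[OF V]) simp
  show "wcbap V N 1"
    if all: "\<forall>(W :: (('a \<Rightarrow> complex) \<Rightarrow> complex) set) M. operator_space W M \<longrightarrow> proj_eq_cproj V N W M"
  proof (rule wcbap_of_all_spaces[OF V])
    fix W :: "(('a \<Rightarrow> complex) \<Rightarrow> complex) set" and M assume W: "operator_space W M"
    interpret E: opspaces V N W M by (rule opspacesI[OF V W])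
    show "id_norm_le V N W M 1"
      using all W E.proj_eq_cproj_iff E.id_norm_le_of_cb by blast
  qed simp
qed

end
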